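(* Let $\mathcal{G}$ be a finite groupoid, $K$ a commutative ring, $R$ an associative unital $K$-algebra, and $\beta=(\{E_g\}_{g\in\mathcal{G}},\{\beta_g\}_{g\in\mathcal{G}})$ a unital action of $\mathcal{G}$ on $R$ with $R=\bigoplus_{e\in\mathcal{G}_0}E_e$. Suppose that $R$ is a $\beta$-Galois extension of $R^{\beta}$ and that $R^{\beta}$ is separable over $C(R)^{\beta}$. For a wide subgroupoid $\mathcal{H}$ of $\mathcal{G}$ put $\theta(\mathcal{H})=R^{\beta_{\mathcal{H}}}$. Then the map $\sigma:\mathcal{H}\mapsto\theta(\mathcal{H})C(R)$ on the set of wide subgroupoids of $\mathcal{G}$ is injective if and only if the map $\gamma:\mathcal{H}\mapsto V_R(\theta(\mathcal{H}))$ on the set of wide subgroupoids of $\mathcal{G}$ is injective.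
   Context: A groupoid $\mathcal{G}$ is a small category in which every morphism is invertible; it is identified with its set of morphisms, and is finite if this set is finite. $d(g)$, $r(g)$ are the domain and range of $g$, $\mathcal{G}_0$ is the set of objects, identified with the identity morphisms; $gh$ is defined iff $d(g)=r(h)$. A subgroupoid is a non-empty subset closed under (defined) products and inverses; a subgroupoid $\mathcal{H}$ is wide if $\mathcal{H}_0=\mathcal{G}_0$. An action $\beta=(\{E_g\},\{\beta_g\})$ of $\mathcal{G}$ on $R$: for each $g$, $E_g=E_{r(g)}$ is an ideal of $R$ and $\beta_g:E_{g^{-1}}\to E_g$ is a $K$-algebra isomorphism, with $\beta_e=\mathrm{Id}_{E_e}$ for $e\in\mathcal{G}_0$ and $\beta_g(\beta_h(r))=\beta_{gh}(r)$ whenever $d(g)=r(h)$ and $r\in E_{h^{-1}}=E_{(gh)^{-1}}$. It is unital if each $E_g$ has an identity element, denoted $1_g$. Invariants: $R^{\beta}=\{r\in R\mid \beta_g(r1_{g^{-1}})=r1_g \text{ for all } g\in\mathcal{G}\}$. $C(R)$ is the center of $R$ and $C(R)^{\beta}=C(R)\cap R^{\beta}$. For a wide subgroupoid $\mathcal{H}$, $\beta_{\mathcal{H}}=\{\beta_h\mid h\in\mathcal{H}\}$ is an action of $\mathcal{H}$ on $R$ and $R^{\beta_{\mathcal{H}}}=\{r\in R\mid \beta_h(r1_{h^{-1}})=r1_h \text{ for all } h\in\mathcal{H}\}$. $R$ is a $\beta$-Galois extension of $R^{\beta}$ if there are $x_i,y_i\in R$, $1\le i\le m$, with $\sum_i x_i\beta_g(y_i1_{g^{-1}})=\sum_{e\in\mathcal{G}_0}\delta_{e,g}1_e$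 for all $g\in\mathcal{G}$. A ring $A$ is separable over a subring $S$ if there is $z=\sum_i a_i\otimes b_i\in A\otimes_S A$ with $\sum_i a_ib_i=1_A$ and $az=za$ for all $a\in A$. For a subring $S$ of $R$, $V_R(S)=\{r\in R\mid rs=sr \text{ for all } s\in S\}$, and $SC(R)$ is the set of finite sums of products $sc$ with $s\in S$, $c\in C(R)$. *)

theory Defs
  imports "HOL-Algebra.Algebra"
begin

text \<open>A groupoid is identified with its set of morphisms and an object with its identity morphism,
  so domain and range are themselves morphisms.  The composite \<open>gcomp G g h\<close> is meaningful only if
  the domain of \<open>g\<close> equals the range of \<open>h\<close>; outside this case its value is unconstrained.\<close>

record 'g groupoid = "'g partial_object" +
  gdom :: "'g \<Rightarrow> 'g"
  grng :: "'g \<Rightarrow> 'g"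
  gcomp :: "'g \<Rightarrow> 'g \<Rightarrow> 'g"

definition gobjects :: "('g, 'x) groupoid_scheme \<Rightarrow> 'g set" where
  "gobjects G = gdom G ` carrier G"

definition is_ginverse :: "('g, 'x) groupoid_scheme \<Rightarrow> 'g \<Rightarrow> 'g \<Rightarrow> bool" where
  "is_ginverse G g h \<longleftrightarrow> h \<in> carrier G \<and> gdom G h = grng G g \<and> grng G h = gdom G g \<and>
     gcomp G g h = grng G g \<and> gcomp G h g = gdom G g"

definition ginv :: "('g, 'x) groupoid_scheme \<Rightarrow> 'g \<Rightarrow> 'g" where
  "ginv G g = (THE h. is_ginverse G g h)"

locale groupoid =
  fixes G :: "('g, 'x) groupoid_scheme"
  assumes dom_closed: "g \<in> carrier G \<Longrightarrow> gdom G g \<in> carrier G"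
    and rng_closed: "g \<in> carrier G \<Longrightarrow> grng G g \<in> carrier G"
    and dom_dom: "g \<in> carrier G \<Longrightarrow> gdom G (gdom G g) = gdom G g"
    and rng_dom: "g \<in> carrier G \<Longrightarrow> grng G (gdom G g) = gdom G g"
    and dom_rng: "g \<in> carrier G \<Longrightarrow> gdom G (grng G g) = grng G g"
    and rng_rng: "g \<in> carrier G \<Longrightarrow> grng G (grng G g) = grng G g"
    and comp_closed: "\<lbrakk>g \<in> carrier G; h \<in> carrier G; gdom G g = grng G h\<rbrakk> \<Longrightarrow> gcomp G g h \<in> carrier G"
    and dom_comp: "\<lbrakk>g \<in> carrier G; h \<in> carrier G; gdom G g = grng G h\<rbrakk>
      \<Longrightarrow> gdom G (gcomp G g h) = gdom G h"
    and rng_comp: "\<lbrakk>g \<in> carrier G; h \<in> carrier G; gdom G g = grng G h\<rbrakk>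
      \<Longrightarrow> grng G (gcomp G g h) = grng G g"
    and comp_assoc: "\<lbrakk>g \<in> carrier G; h \<in> carrier G; k \<in> carrier G;
        gdom G g = grng G h; gdom G h = grng G k\<rbrakk>
      \<Longrightarrow> gcomp G (gcomp G g h) k = gcomp G g (gcomp G h k)"
    and comp_dom: "g \<in> carrier G \<Longrightarrow> gcomp G g (gdom G g) = g"
    and rng_comp_left: "g \<in> carrier G \<Longrightarrow> gcomp G (grng G g) g = g"
    and ex_inverse: "g \<in> carrier G \<Longrightarrow> \<exists>h. is_ginverse G g h"

definition subgroupoid :: "('g, 'x) groupoid_scheme \<Rightarrow> 'g set \<Rightarrow> bool" where
  "subgroupoid G H \<longleftrightarrow> H \<subseteq> carrier G \<and> H \<noteq> {} \<and>
     (\<forall>g\<in>H. \<forall>h\<in>H. gdom G g = grng G h \<longrightarrow> gcomp G g h \<in> H) \<and>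
     (\<forall>h\<in>H. ginv G h \<in> H)"

definition wide_subgroupoids :: "('g, 'x) groupoid_scheme \<Rightarrow> 'g set set" where
  "wide_subgroupoids G =
     {H. subgroupoid G H \<and> gobjects (G\<lparr>carrier := H\<rparr>) = gobjects G}"

text \<open>The library locale \<open>algebra\<close> requires a commutative algebra, hence the following
  noncommutative version.\<close>

locale assoc_algebra = module K R + ring R
  for K :: "('k, 'y) ring_scheme" and R :: "('k, 'a, 'z) module_scheme" +
  assumes smult_mult_left: "\<lbrakk>k \<in> carrier K; x \<in> carrier R; y \<in> carrier R\<rbrakk>
      \<Longrightarrow> k \<odot>\<^bsub>R\<^esub> (x \<otimes>\<^bsub>R\<^esub> y) = (k \<odot>\<^bsub>R\<^esub> x) \<otimes>\<^bsub>R\<^esub> y"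
    and smult_mult_right: "\<lbrakk>k \<in> carrier K; x \<in> carrier R; y \<in> carrier R\<rbrakk>
      \<Longrightarrow> k \<odot>\<^bsub>R\<^esub> (x \<otimes>\<^bsub>R\<^esub> y) = x \<otimes>\<^bsub>R\<^esub> (k \<odot>\<^bsub>R\<^esub> y)"

definition ring_centralizer :: "('a, 'm) ring_scheme \<Rightarrow> 'a set \<Rightarrow> 'a set" where
  "ring_centralizer R S = {r \<in> carrier R. \<forall>s\<in>S. r \<otimes>\<^bsub>R\<^esub> s = s \<otimes>\<^bsub>R\<^esub> r}"

definition ring_center :: "('a, 'm) ring_scheme \<Rightarrow> 'a set" where
  "ring_center R = {c \<in> carrier R. \<forall>r\<in>carrier R. c \<otimes>\<^bsub>R\<^esub> r = r \<otimes>\<^bsub>R\<^esub> c}"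

definition sums_of_products :: "('a, 'm) ring_scheme \<Rightarrow> 'a set \<Rightarrow> 'a set \<Rightarrow> 'a set" where
  "sums_of_products R S T =
     {\<Oplus>\<^bsub>R\<^esub>i\<in>{1..n}. s i \<otimes>\<^bsub>R\<^esub> t i | (n::nat) s t. s \<in> {1..n} \<rightarrow> S \<and> t \<in> {1..n} \<rightarrow> T}"

definition is_identity_of :: "('a, 'm) ring_scheme \<Rightarrow> 'a set \<Rightarrow> 'a \<Rightarrow> bool" where
  "is_identity_of R I u \<longleftrightarrow> u \<in> I \<and> (\<forall>x\<in>I. u \<otimes>\<^bsub>R\<^esub> x = x \<and> x \<otimes>\<^bsub>R\<^esub> u = x)"

definition identity_of :: "('a, 'm) ring_scheme \<Rightarrow> 'a set \<Rightarrow> 'a" where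
  "identity_of R I = (THE u. is_identity_of R I u)"

text \<open>Ideals need not be unital, so preservation of identities is not demanded; when both ideals have
  an identity element, it is automatic.\<close>

definition ideal_algebra_iso ::
  "('k, 'y) ring_scheme \<Rightarrow> ('k, 'a, 'z) module_scheme \<Rightarrow> 'a set \<Rightarrow> 'a set \<Rightarrow> ('a \<Rightarrow> 'a) \<Rightarrow> bool" where
  "ideal_algebra_iso K R I J f \<longleftrightarrow> bij_betw f I J \<and>
     (\<forall>x\<in>I. \<forall>y\<in>I. f (x \<oplus>\<^bsub>R\<^esub> y) = f x \<oplus>\<^bsub>R\<^esub> f y \<and> f (x \<otimes>\<^bsub>R\<^esub> y) = f x \<otimes>\<^bsub>R\<^esub> f y) \<and>
     (\<forall>k\<in>carrier K. \<forall>x\<in>I. f (k \<odot>\<^bsub>R\<^esub> x) = k \<odot>\<^bsub>R\<^esub> f x)"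

definition is_direct_sum :: "('a, 'm) ring_scheme \<Rightarrow> 'i set \<Rightarrow> ('i \<Rightarrow> 'a set) \<Rightarrow> bool" where
  "is_direct_sum R I E \<longleftrightarrow>
     (\<forall>r\<in>carrier R. \<exists>!x. x \<in> (\<Pi>\<^sub>E i\<in>I. E i) \<and> r = (\<Oplus>\<^bsub>R\<^esub>i\<in>I. x i))"

text \<open>For a subring \<open>S\<close> of a ring \<open>A\<close>, the abelian group \<open>A \<otimes>\<^sub>S A\<close> is the quotient of the free
  abelian group on \<open>A \<times> A\<close> by the biadditivity and \<open>S\<close>-balancedness relations.\<close>

definition tensor_relators :: "('a, 'm) ring_scheme \<Rightarrow> 'a set \<Rightarrow> ('a \<times> 'a \<Rightarrow>\<^sub>0 int) set" where
  "tensor_relators A S =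
     {frag_of (a \<oplus>\<^bsub>A\<^esub> a', b) - (frag_of (a, b) + frag_of (a', b)) | a a' b.
        a \<in> carrier A \<and> a' \<in> carrier A \<and> b \<in> carrier A} \<union>
     {frag_of (a, b \<oplus>\<^bsub>A\<^esub> b') - (frag_of (a, b) + frag_of (a, b')) | a b b'.
        a \<in> carrier A \<and> b \<in> carrier A \<and> b' \<in> carrier A} \<union>
     {frag_of (a \<otimes>\<^bsub>A\<^esub> s, b) - frag_of (a, s \<otimes>\<^bsub>A\<^esub> b) | a s b.
        a \<in> carrier A \<and> s \<in> S \<and> b \<in> carrier A}"

definition tensor_relations :: "('a, 'm) ring_scheme \<Rightarrow> 'a set \<Rightarrow> ('a \<times> 'a \<Rightarrow>\<^sub>0 int) set" where
  "tensor_relations A S =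
     generate (free_Abelian_group (carrier A \<times> carrier A)) (tensor_relators A S)"

definition tensor_square :: "('a, 'm) ring_scheme \<Rightarrow> 'a set \<Rightarrow> ('a \<times> 'a \<Rightarrow>\<^sub>0 int) set monoid" where
  "tensor_square A S = free_Abelian_group (carrier A \<times> carrier A) Mod tensor_relations A S"

definition pure_tensor :: "('a, 'm) ring_scheme \<Rightarrow> 'a set \<Rightarrow> 'a \<Rightarrow> 'a \<Rightarrow> ('a \<times> 'a \<Rightarrow>\<^sub>0 int) set" where
  "pure_tensor A S a b =
     tensor_relations A S #>\<^bsub>free_Abelian_group (carrier A \<times> carrier A)\<^esub> frag_of (a, b)"

text \<open>With \<open>z = \<Sum>i. x i \<otimes> y i\<close>, the elements \<open>a z\<close> and \<open>z a\<close> of the \<open>A\<close>-bimodule \<open>A \<otimes>\<^sub>S A\<close> are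
  \<open>\<Sum>i. a x i \<otimes> y i\<close> and \<open>\<Sum>i. x i \<otimes> y i a\<close>.  The group \<open>tensor_square A S\<close> is written
  multiplicatively in the library, so sums of tensors are \<open>finprod\<close>.\<close>

definition separable_over :: "('a, 'm) ring_scheme \<Rightarrow> 'a set \<Rightarrow> bool" where
  "separable_over A S \<longleftrightarrow>
     (\<exists>(m::nat) x y. x \<in> {1..m} \<rightarrow> carrier A \<and> y \<in> {1..m} \<rightarrow> carrier A \<and>
        (\<Oplus>\<^bsub>A\<^esub>i\<in>{1..m}. x i \<otimes>\<^bsub>A\<^esub> y i) = \<one>\<^bsub>A\<^esub> \<and>
        (\<forall>a\<in>carrier A.
           (\<Otimes>\<^bsub>tensor_square A S\<^esub>i\<in>{1..m}. pure_tensor A S (a \<otimes>\<^bsub>A\<^esub> x i) (y i)) =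
           (\<Otimes>\<^bsub>tensor_square A S\<^esub>i\<in>{1..m}. pure_tensor A S (x i) (y i \<otimes>\<^bsub>A\<^esub> a))))"

locale groupoid_action = groupoid G + assoc_algebra K R
  for G :: "('g, 'x) groupoid_scheme"
    and K :: "('k, 'y) ring_scheme"
    and R :: "('k, 'a, 'z) module_scheme" +
  fixes E :: "'g \<Rightarrow> 'a set" and \<beta> :: "'g \<Rightarrow> 'a \<Rightarrow> 'a"
  assumes E_rng: "g \<in> carrier G \<Longrightarrow> E g = E (grng G g)"
    and E_ideal: "g \<in> carrier G \<Longrightarrow> ideal (E g) R"
    and \<beta>_iso: "g \<in> carrier G \<Longrightarrow> ideal_algebra_iso K R (E (ginv G g)) (E g) (\<beta> g)"
    and \<beta>_object: "\<lbrakk>e \<in> gobjects G; r \<in> E e\<rbrakk> \<Longrightarrow> \<beta> e r = r"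
    and \<beta>_comp: "\<lbrakk>g \<in> carrier G; h \<in> carrier G; gdom G g = grng G h; r \<in> E (ginv G h)\<rbrakk>
      \<Longrightarrow> \<beta> g (\<beta> h r) = \<beta> (gcomp G g h) r"

locale unital_groupoid_action = groupoid_action +
  assumes E_unital: "g \<in> carrier G \<Longrightarrow> \<exists>u. is_identity_of R (E g) u"

text \<open>The invariants under the morphisms in \<open>H\<close>; \<open>H = carrier G\<close> gives the invariants of the whole
  action.\<close>

definition action_invariants ::
  "('g, 'x) groupoid_scheme \<Rightarrow> ('a, 'm) ring_scheme \<Rightarrow> ('g \<Rightarrow> 'a set) \<Rightarrow> ('g \<Rightarrow> 'a \<Rightarrow> 'a)
     \<Rightarrow> 'g set \<Rightarrow> 'a set" where
  "action_invariants G R E \<beta> H = {r \<in> carrier R. \<forall>h\<in>H.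
     \<beta> h (r \<otimes>\<^bsub>R\<^esub> identity_of R (E (ginv G h))) = r \<otimes>\<^bsub>R\<^esub> identity_of R (E h)}"

definition galois_extension ::
  "('g, 'x) groupoid_scheme \<Rightarrow> ('a, 'm) ring_scheme \<Rightarrow> ('g \<Rightarrow> 'a set) \<Rightarrow> ('g \<Rightarrow> 'a \<Rightarrow> 'a) \<Rightarrow> bool" where
  "galois_extension G R E \<beta> \<longleftrightarrow>
     (\<exists>(m::nat) x y. x \<in> {1..m} \<rightarrow> carrier R \<and> y \<in> {1..m} \<rightarrow> carrier R \<and>
        (\<forall>g\<in>carrier G.
           (\<Oplus>\<^bsub>R\<^esub>i\<in>{1..m}. x i \<otimes>\<^bsub>R\<^esub> \<beta> g (y i \<otimes>\<^bsub>R\<^esub> identity_of R (E (ginv G g)))) =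
           (\<Oplus>\<^bsub>R\<^esub>e\<in>gobjects G. if e = g then identity_of R (E e) else \<zero>\<^bsub>R\<^esub>)))"

end

theory Submission
  imports Defs
begin

text \<open>
  Let \<open>A\<close> be the ring of invariants of a wide subgroupoid \<open>H\<close> and \<open>C\<close> the centre of \<open>R\<close>.  The centralizer
  of \<open>A C\<close> is that of \<open>A\<close>, so it suffices to recover \<open>A C\<close> as the double centralizer of \<open>A\<close>.

  The Galois coordinates and the separability element of the full ring of invariants combine to
  \<open>\<Sum>k. u k \<otimes> v k\<close> with \<open>\<Sum>k. u k * v k = 1\<close> such that every \<open>w = \<Sum>k. u k * n * \<beta> h (v k)\<close> satisfies
  \<open>s w = w \<beta> h s\<close> for all \<open>s\<close>.  For \<open>r\<close> in the double centralizer, the \<open>c \<in> C\<close> with \<open>c r \<in> A C\<close> form an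
  ideal of \<open>C\<close>; if it were proper, it would lie in a maximal two-sided ideal \<open>I\<close> of \<open>R\<close>.  If \<open>h\<close> is in the
  inertia group of \<open>I\<close>, that is, acts trivially on \<open>C\<close> modulo \<open>I\<close>, then a density argument in the simple
  ring \<open>R / I\<close> yields such a \<open>w\<close> outside \<open>I\<close>, whence some \<open>f \<in> C - I\<close> with \<open>f (\<beta> h r - r) = 0\<close>.  So after
  multiplication by an element of \<open>C - I\<close> the inertia group fixes \<open>r\<close>, and the remaining \<open>\<beta> h\<close> are separated
  from the identity by their action on \<open>C\<close> modulo \<open>I\<close>; combinations over \<open>C\<close> of a trace over coset
  representatives then give \<open>c r \<in> A C\<close> for some \<open>c \<in> C - I\<close>.
\<close>

section \<open>Sums, maximal ideals and the centre\<close>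

text \<open>The map \<open>n \<mapsto> \<Sum>k. u k * n * v k\<close> is the hinge between
  \<open>R\<close> and \<open>C\<close>. Taking objects for \<open>h\<close> in the relation for
  \<open>w\<close> shows that its values are central; it is \<open>C\<close>-linear, sends
  \<open>1\<close> to \<open>1\<close> and maps every two-sided ideal into itself. Hence a proper
  ideal of \<open>C\<close> sits inside a proper ideal of \<open>R\<close>, central elements of
  \<open>R / I\<close> lift to \<open>C\<close>, and an annihilator in \<open>R\<close> can be
  replaced by one in \<open>C\<close>. Working with maximal two-sided ideals of \<open>R\<close>
  rather than maximal ideals of \<open>C\<close> makes the quotient simple. The equation for
  \<open>f\<close> comes from two commutation rules: \<open>\<beta> h\<close> fixes \<open>A\<close>
  up to an identity element, so \<open>w\<close> centralizes \<open>A\<close> and commutes with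
  \<open>r\<close>; compared with \<open>r w = w \<beta> h r\<close> this gives
  \<open>w (\<beta> h r - r) = 0\<close>. Finitely many such local conditions can be met at once
  because \<open>I\<close> behaves like a prime ideal towards central elements, so that
  \<open>C - I\<close> is closed under products.\<close>

lemma (in comm_monoid) hom_finprod:
  assumes "comm_monoid H" and h: "h \<in> hom G H" and h1: "h \<one> = \<one>\<^bsub>H\<^esub>" and f: "f \<in> A \<rightarrow> carrier G"
  shows "h (finprod G f A) = finprod H (\<lambda>i. h (f i)) A"
proof -
  interpret H: comm_monoid H by fact
  show ?thesis
    using f
  proof (induction A rule: infinite_finite_induct)
    case (insert x A)
    then have f: "f \<in> A \<rightarrow> carrier G" "f x \<in> carrier G" by auto
    then have hf: "(\<lambda>i. h (f i)) \<in> A \<rightarrow> carrier H" "h (f x) \<in> carrier H"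
      using hom_in_carrier[OF h] by auto
    show ?case
      using insert f hf hom_mult[OF h] by simp
  qed (auto simp: h1)
qed

context ring
begin

lemma additive_finsum:
  assumes h: "h \<in> carrier R \<rightarrow> carrier R"
    and add: "\<And>x y. x \<in> carrier R \<Longrightarrow> y \<in> carrier R \<Longrightarrow> h (x \<oplus> y) = h x \<oplus> h y"
    and f: "f \<in> A \<rightarrow> carrier R"
  shows "h (\<Oplus>i\<in>A. f i) = (\<Oplus>i\<in>A. h (f i))"
proof -
  have "h \<zero> = h \<zero> \<oplus> h \<zero>" using add[of \<zero> \<zero>] by simp
  then have h0: "h \<zero> = \<zero>" using h by (metis Pi_mem add.r_cancel_one' zero_closed)
  show ?thesis
    using f
  proof (induction A rule: infinite_finite_induct)
    case (insert x A)
    then have f: "f \<in> A \<rightarrow> carrier R" "f x \<in> carrier R" by auto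
    then have hf: "(\<lambda>i. h (f i)) \<in> A \<rightarrow> carrier R" "h (f x) \<in> carrier R"
      using h by auto
    show ?case using insert f hf by (simp add: add)
  qed (auto simp: h0)
qed

lemma finsum_swap:
  assumes "finite A" "finite B" "\<And>i j. i \<in> A \<Longrightarrow> j \<in> B \<Longrightarrow> f i j \<in> carrier R"
  shows "(\<Oplus>i\<in>A. \<Oplus>j\<in>B. f i j) = (\<Oplus>j\<in>B. \<Oplus>i\<in>A. f i j)"
  using assms(1,3)
proof (induction A)
  case empty
  then show ?case by simp
next
  case (insert x A)
  have c: "(\<lambda>j. f x j) \<in> B \<rightarrow> carrier R" "(\<lambda>j. \<Oplus>i\<in>A. f i j) \<in> B \<rightarrow> carrier R"
    "(\<lambda>i. \<Oplus>j\<in>B. f i j) \<in> A \<rightarrow> carrier R" "(\<Oplus>j\<in>B. f x j) \<in> carrier R"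
    using insert.prems by (auto intro!: finsum_closed)
  have "(\<Oplus>j\<in>B. \<Oplus>i\<in>insert x A. f i j) = (\<Oplus>j\<in>B. f x j \<oplus> (\<Oplus>i\<in>A. f i j))"
    using insert by (intro finsum_cong') (auto intro!: finsum_insert)
  also have "\<dots> = (\<Oplus>j\<in>B. f x j) \<oplus> (\<Oplus>j\<in>B. \<Oplus>i\<in>A. f i j)"
    using c by (intro finsum_addf)
  finally show ?case using insert c by simp
qed

lemma finsum_Times:
  assumes "finite A" "finite B" "\<And>i j. i \<in> A \<Longrightarrow> j \<in> B \<Longrightarrow> f (i, j) \<in> carrier R"
  shows "(\<Oplus>p\<in>A \<times> B. f p) = (\<Oplus>i\<in>A. \<Oplus>j\<in>B. f (i, j))"
  using assms(1,3)
proof (induction A)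
  case empty
  then show ?case by simp
next
  case (insert x A)
  have c: "f \<in> A \<times> B \<rightarrow> carrier R" "f \<in> {x} \<times> B \<rightarrow> carrier R" "(\<lambda>j. f (x, j)) \<in> B \<rightarrow> carrier R"
    "(\<lambda>i. \<Oplus>j\<in>B. f (i, j)) \<in> A \<rightarrow> carrier R"
    using insert.prems by (auto intro!: finsum_closed)
  have "(\<Oplus>p\<in>insert x A \<times> B. f p) = (\<Oplus>p\<in>({x} \<times> B) \<union> (A \<times> B). f p)"
    by (rule arg_cong[where f = "finsum R f"]) auto
  also have "\<dots> = (\<Oplus>p\<in>{x} \<times> B. f p) \<oplus> (\<Oplus>p\<in>A \<times> B. f p)"
    using c insert assms(2) by (intro finsum_Un_disjoint) auto
  also have "(\<Oplus>p\<in>{x} \<times> B. f p) = (\<Oplus>j\<in>B. f (x, j))"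
  proof -
    have "{x} \<times> B = (\<lambda>j. (x, j)) ` B" by auto
    then show ?thesis
      using finsum_reindex[of f "\<lambda>j. (x, j)" B] c by (simp add: inj_on_def)
  qed
  finally show ?case using insert c by (simp add: finsum_insert)
qed

lemma finsum_ring_cong:
  assumes "\<And>i. i \<in> A \<Longrightarrow> g i \<in> carrier R" "\<And>i. i \<in> A \<Longrightarrow> f i = g i"
  shows "finsum R f A = finsum R g A"
  using assms by (intro finsum_cong') auto

lemma finsum_sub:
  assumes "f \<in> A \<rightarrow> carrier R" "g \<in> A \<rightarrow> carrier R"
  shows "(\<Oplus>i\<in>A. f i \<ominus> g i) = (\<Oplus>i\<in>A. f i) \<ominus> (\<Oplus>i\<in>A. g i)"
proof -
  have "(\<Oplus>i\<in>A. f i \<ominus> g i) \<oplus> (\<Oplus>i\<in>A. g i) = (\<Oplus>i\<in>A. (f i \<ominus> g i) \<oplus> g i)"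
    using assms by (intro finsum_addf[symmetric]) auto
  also have "\<dots> = (\<Oplus>i\<in>A. f i)"
    using assms by (intro finsum_ring_cong) (auto simp: Pi_iff a_minus_def a_assoc l_neg)
  finally have *: "(\<Oplus>i\<in>A. f i) = (\<Oplus>i\<in>A. f i \<ominus> g i) \<oplus> (\<Oplus>i\<in>A. g i)" ..
  have c: "(\<Oplus>i\<in>A. f i \<ominus> g i) \<in> carrier R" "(\<Oplus>i\<in>A. g i) \<in> carrier R"
    using assms by (auto intro!: finsum_closed)
  show ?thesis unfolding * using c by (simp add: a_minus_def a_assoc r_neg)
qed

text \<open>Zorn's lemma for two-sided ideals. Properness is expressed as not containing
  \<open>\<one>\<close>, a condition that visibly survives unions of chains.\<close>

lemma exists_maximalideal:
  assumes J: "ideal J R" "\<one> \<notin> J"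
  shows "\<exists>I. maximalideal I R \<and> J \<subseteq> I"
proof -
  define \<A> where "\<A> = {I. ideal I R \<and> \<one> \<notin> I \<and> J \<subseteq> I}"
  have A_iff: "I \<in> \<A> \<longleftrightarrow> ideal I R \<and> \<one> \<notin> I \<and> J \<subseteq> I" for I
    unfolding \<A>_def by (rule mem_Collect_eq)
  have "\<exists>M\<in>\<A>. \<forall>Y\<in>\<A>. M \<subseteq> Y \<longrightarrow> Y = M"
  proof (rule subset_Zorn_nonempty)
    have "J \<in> \<A>" unfolding A_iff using J by blast
    then show "\<A> \<noteq> {}" by (metis empty_iff)
    fix \<C> assume ne: "\<C> \<noteq> {}" and ch: "subset.chain \<A> \<C>"
    have "\<C> \<subseteq> \<A>" using ch unfolding subset.chain_def by (rule conjunct1)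
    then have mem: "ideal I R \<and> \<one> \<notin> I \<and> J \<subseteq> I" if "I \<in> \<C>" for I
      using that A_iff by blast
    have tot: "I \<subseteq> I' \<or> I' \<subseteq> I" if "I \<in> \<C>" "I' \<in> \<C>" for I I'
      using ch that subset_chain_def by metis
    have grp: "subgroup I (add_monoid R)" if "I \<in> \<C>" for I
      using mem[OF that] by (simp add: additive_subgroup.a_subgroup ideal.axioms(1))
    obtain I0 where I0: "I0 \<in> \<C>" using ne by blast
    have "subgroup (\<Union>\<C>) (add_monoid R)"
    proof (rule subgroup.intro)
      show "\<Union>\<C> \<subseteq> carrier (add_monoid R)"
        using subgroup.subset[OF grp] by blast
      show "\<one>\<^bsub>add_monoid R\<^esub> \<in> \<Union>\<C>"
        using subgroup.one_closed[OF grp[OF I0]] I0 by blast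
      show "inv\<^bsub>add_monoid R\<^esub> x \<in> \<Union>\<C>" if "x \<in> \<Union>\<C>" for x
        using that subgroup.m_inv_closed[OF grp] by blast
      show "x \<otimes>\<^bsub>add_monoid R\<^esub> y \<in> \<Union>\<C>" if xy: "x \<in> \<Union>\<C>" "y \<in> \<Union>\<C>" for x y
      proof -
        obtain I I' where "I \<in> \<C>" "I' \<in> \<C>" "x \<in> I" "y \<in> I'" using xy by blast
        then obtain I where I: "I \<in> \<C>" "x \<in> I" "y \<in> I" using tot by blast
        then show ?thesis
          using subgroup.m_closed[OF grp[OF I(1)] I(2,3)] by blast
      qed
    qed
    moreover have "x \<otimes> a \<in> \<Union>\<C>" "a \<otimes> x \<in> \<Union>\<C>" if "a \<in> \<Union>\<C>" "x \<in> carrier R" for a x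
    proof -
      obtain I where I: "I \<in> \<C>" "a \<in> I" using \<open>a \<in> \<Union>\<C>\<close> by blast
      then have "ideal I R" using mem by blast
      then show "x \<otimes> a \<in> \<Union>\<C>" "a \<otimes> x \<in> \<Union>\<C>"
        using I ideal.I_l_closed[of I R a x] ideal.I_r_closed[of I R a x] \<open>x \<in> carrier R\<close> by blast+
    qed
    ultimately have "ideal (\<Union>\<C>) R"
      using ring_axioms by (intro idealI)
    moreover have "\<one> \<notin> \<Union>\<C>" using mem by blast
    moreover have "J \<subseteq> \<Union>\<C>" using ne mem by blast
    ultimately show "\<Union>\<C> \<in> \<A>" unfolding A_iff by blast
  qed
  then obtain M where "M \<in> \<A>" and mx: "\<forall>Y\<in>\<A>. M \<subseteq> Y \<longrightarrow> Y = M" ..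
  then have M: "ideal M R" "\<one> \<notin> M" "J \<subseteq> M" unfolding A_iff by blast+
  have "maximalideal M R"
  proof (rule maximalidealI)
    show "ideal M R" by fact
    show "carrier R \<noteq> M" using M by blast
    show "Y = M \<or> Y = carrier R" if "ideal Y R" "M \<subseteq> Y" "Y \<subseteq> carrier R" for Y
    proof (cases "\<one> \<in> Y")
      case True
      then show ?thesis using that(1) ideal.one_imp_carrier by blast
    next
      case False
      then have "Y \<in> \<A>" unfolding A_iff using that M(3) by blast
      then show ?thesis using mx that(2) by blast
    qed
  qed
  then show ?thesis using M by blast
qed

section \<open>Arithmetic of the centre of a noncommutative ring\<close>

lemma center_closed: "c \<in> ring_center R \<Longrightarrow> c \<in> carrier R"
  by (simp add: ring_center_def)

lemma center_comm: "c \<in> ring_center R \<Longrightarrow> r \<in> carrier R \<Longrightarrow> c \<otimes> r = r \<otimes> c"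
  unfolding ring_center_def by blast

lemma center_memI:
  "c \<in> carrier R \<Longrightarrow> (\<And>r. r \<in> carrier R \<Longrightarrow> c \<otimes> r = r \<otimes> c) \<Longrightarrow> c \<in> ring_center R"
  unfolding ring_center_def by blast

lemma center_lcomm:
  assumes "c \<in> ring_center R" "x \<in> carrier R" "y \<in> carrier R"
  shows "x \<otimes> (c \<otimes> y) = c \<otimes> (x \<otimes> y)"
proof -
  have c: "c \<in> carrier R" using assms(1) by (rule center_closed)
  have "x \<otimes> (c \<otimes> y) = (x \<otimes> c) \<otimes> y" using assms c by (simp only: m_assoc)
  also have "x \<otimes> c = c \<otimes> x" using center_comm[OF assms(1,2)] by (rule sym)
  finally show ?thesis using assms c by (simp only: m_assoc)
qed

lemma center_one: "\<one> \<in> ring_center R" and center_zero: "\<zero> \<in> ring_center R"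
  by (rule center_memI; simp)+

lemma center_add:
  assumes "c \<in> ring_center R" "d \<in> ring_center R"
  shows "c \<oplus> d \<in> ring_center R"
proof (rule center_memI)
  show "(c \<oplus> d) \<otimes> r = r \<otimes> (c \<oplus> d)" if "r \<in> carrier R" for r
    using that assms
    by (simp only: l_distr r_distr center_closed center_comm[OF assms(1) that] center_comm[OF assms(2) that])
qed (use assms center_closed in simp)

lemma center_mult:
  assumes "c \<in> ring_center R" "d \<in> ring_center R"
  shows "c \<otimes> d \<in> ring_center R"
proof (rule center_memI)
  fix r assume r: "r \<in> carrier R"
  have "(c \<otimes> d) \<otimes> r = c \<otimes> (r \<otimes> d)"
    using assms r by (simp only: m_assoc center_closed center_comm[OF assms(2) r])
  also have "\<dots> = r \<otimes> (c \<otimes> d)"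
    using assms r by (simp only: center_lcomm center_closed)
  finally show "(c \<otimes> d) \<otimes> r = r \<otimes> (c \<otimes> d)" .
qed (use assms center_closed in simp)

lemma center_uminus:
  assumes "c \<in> ring_center R"
  shows "\<ominus> c \<in> ring_center R"
proof (rule center_memI)
  show "\<ominus> c \<otimes> r = r \<otimes> \<ominus> c" if "r \<in> carrier R" for r
    using that assms by (simp only: l_minus r_minus center_closed center_comm[OF assms that])
qed (use assms center_closed in simp)

lemma center_minus:
  assumes "c \<in> ring_center R" "d \<in> ring_center R"
  shows "c \<ominus> d \<in> ring_center R"
  unfolding a_minus_def using assms by (intro center_add center_uminus)

end

section \<open>Congruences modulo a two-sided ideal\<close>

lemma (in additive_subgroup) uminus_mem:
  "ring G \<Longrightarrow> x \<in> H \<Longrightarrow> \<ominus>\<^bsub>G\<^esub> x \<in> H"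
  using subgroup.m_inv_closed[OF a_subgroup] by (simp add: a_inv_def)

context ideal
begin

lemmas add_mem = additive_subgroup.a_closed[OF is_additive_subgroup]

lemma minus_mem: "x \<in> I \<Longrightarrow> y \<in> I \<Longrightarrow> x \<ominus> y \<in> I"
  using uminus_mem[OF ring_axioms] by (simp add: a_minus_def add_mem)

lemma finsum_mem: "f \<in> A \<rightarrow> I \<Longrightarrow> (\<Oplus>i\<in>A. f i) \<in> I"
proof (induction A rule: infinite_finite_induct)
  case (insert x A)
  then have "f \<in> A \<rightarrow> I" "f x \<in> I" by auto
  moreover from this have "f \<in> A \<rightarrow> carrier R" "f x \<in> carrier R"
    by (auto simp: Pi_iff intro: Icarr)
  ultimately show ?case using insert by (simp add: add_mem)
qed auto

lemma mem_cong: "x \<ominus> y \<in> I \<Longrightarrow> x \<in> carrier R \<Longrightarrow> y \<in> carrier R \<Longrightarrow> x \<in> I \<longleftrightarrow> y \<in> I"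
proof -
  assume *: "x \<ominus> y \<in> I" "x \<in> carrier R" "y \<in> carrier R"
  have "x = (x \<ominus> y) \<oplus> y" "y = x \<ominus> (x \<ominus> y)" using * by algebra+
  then show ?thesis using * minus_mem add_mem by metis
qed

end

section \<open>Relations modulo a maximal ideal\<close>

context maximalideal
begin

text \<open>The leading coefficients that occur in such relations form a two-sided ideal
  \<open>Z\<close>: a left factor is multiplied onto the whole relation, a right factor
  \<open>a\<close> is produced by substituting \<open>a \<otimes> x\<close> for \<open>x\<close>.
  Since \<open>Z\<close> contains \<open>I\<close> and also \<open>v\<close>, maximality puts
  \<open>\<one>\<close> into it.\<close>

lemma relation_one_leading:
  assumes F: "finite F" and w0: "w0 \<in> carrier R" and w: "w \<in> F \<rightarrow> carrier R"
    and u: "u \<in> F \<rightarrow> carrier R" and v: "v \<in> carrier R" "v \<notin> I"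
    and rel: "\<And>x. x \<in> carrier R \<Longrightarrow> v \<otimes> x \<otimes> w0 \<oplus> (\<Oplus>k\<in>F. u k \<otimes> x \<otimes> w k) \<in> I"
  shows "\<exists>u'\<in>F \<rightarrow> carrier R. \<forall>x\<in>carrier R. x \<otimes> w0 \<oplus> (\<Oplus>k\<in>F. u' k \<otimes> x \<otimes> w k) \<in> I"
proof -
  define Z where "Z = {z \<in> carrier R. \<exists>u'\<in>F \<rightarrow> carrier R. \<forall>x\<in>carrier R.
    z \<otimes> x \<otimes> w0 \<oplus> (\<Oplus>k\<in>F. u' k \<otimes> x \<otimes> w k) \<in> I}"
  have wk: "w k \<in> carrier R" if "k \<in> F" for k using w that by blast
  have ZI: "z \<in> Z" if "z \<in> carrier R" "q \<in> F \<rightarrow> carrier R"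
    "\<And>x. x \<in> carrier R \<Longrightarrow> z \<otimes> x \<otimes> w0 \<oplus> (\<Oplus>k\<in>F. q k \<otimes> x \<otimes> w k) \<in> I" for z q
    unfolding Z_def using that by blast
  have ZE: "\<exists>u'. u' \<in> F \<rightarrow> carrier R \<and> (\<forall>x\<in>carrier R. z \<otimes> x \<otimes> w0 \<oplus> (\<Oplus>k\<in>F. u' k \<otimes> x \<otimes> w k) \<in> I)"
    "z \<in> carrier R" if "z \<in> Z" for z
    using that unfolding Z_def by blast+
  have IZ: "I \<subseteq> Z"
  proof
    fix z assume z: "z \<in> I"
    show "z \<in> Z"
    proof (rule ZI[of _ "\<lambda>_. \<zero>"])
      fix x assume x: "x \<in> carrier R"
      have "(\<Oplus>k\<in>F. \<zero> \<otimes> x \<otimes> w k) = (\<Oplus>k\<in>F. \<zero>)"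
        using x wk by (intro finsum_ring_cong) auto
      then show "z \<otimes> x \<otimes> w0 \<oplus> (\<Oplus>k\<in>F. \<zero> \<otimes> x \<otimes> w k) \<in> I"
        using x z w0 by (simp add: Icarr I_r_closed)
    qed (use z Icarr in auto)
  qed
  have add: "z \<oplus> z' \<in> Z" if zz: "z \<in> Z" "z' \<in> Z" for z z'
  proof -
    obtain u1 where u1: "u1 \<in> F \<rightarrow> carrier R"
      "\<forall>x\<in>carrier R. z \<otimes> x \<otimes> w0 \<oplus> (\<Oplus>k\<in>F. u1 k \<otimes> x \<otimes> w k) \<in> I" using ZE zz(1) by blast
    obtain u2 where u2: "u2 \<in> F \<rightarrow> carrier R"
      "\<forall>x\<in>carrier R. z' \<otimes> x \<otimes> w0 \<oplus> (\<Oplus>k\<in>F. u2 k \<otimes> x \<otimes> w k) \<in> I" using ZE zz(2) by blast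
    have c: "z \<in> carrier R" "z' \<in> carrier R" using zz ZE by auto
    show ?thesis
    proof (rule ZI[of _ "\<lambda>k. u1 k \<oplus> u2 k"])
      fix x assume x: "x \<in> carrier R"
      let ?s1 = "\<Oplus>k\<in>F. u1 k \<otimes> x \<otimes> w k" and ?s2 = "\<Oplus>k\<in>F. u2 k \<otimes> x \<otimes> w k"
      have s: "?s1 \<in> carrier R" "?s2 \<in> carrier R"
        using u1(1) u2(1) wk x by (auto intro!: finsum_closed)
      have "(\<Oplus>k\<in>F. (u1 k \<oplus> u2 k) \<otimes> x \<otimes> w k) = (\<Oplus>k\<in>F. u1 k \<otimes> x \<otimes> w k \<oplus> u2 k \<otimes> x \<otimes> w k)"
        using u1(1) u2(1) wk x by (intro finsum_ring_cong) (auto simp: Pi_iff l_distr)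
      also have "\<dots> = ?s1 \<oplus> ?s2"
        using u1(1) u2(1) wk x by (intro finsum_addf) (auto simp: Pi_iff)
      finally have "(z \<oplus> z') \<otimes> x \<otimes> w0 \<oplus> (\<Oplus>k\<in>F. (u1 k \<oplus> u2 k) \<otimes> x \<otimes> w k)
        = (z \<otimes> x \<otimes> w0 \<oplus> ?s1) \<oplus> (z' \<otimes> x \<otimes> w0 \<oplus> ?s2)"
        using c x w0 s by (simp add: l_distr a_ac)
      then show "(z \<oplus> z') \<otimes> x \<otimes> w0 \<oplus> (\<Oplus>k\<in>F. (u1 k \<oplus> u2 k) \<otimes> x \<otimes> w k) \<in> I"
        using u1(2) u2(2) x add_mem by simp
    qed (use c u1 u2 in auto)
  qed
  have lmult: "a \<otimes> z \<in> Z" if z: "z \<in> Z" and a: "a \<in> carrier R" for z a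
  proof -
    obtain u1 where u1: "u1 \<in> F \<rightarrow> carrier R"
      "\<forall>x\<in>carrier R. z \<otimes> x \<otimes> w0 \<oplus> (\<Oplus>k\<in>F. u1 k \<otimes> x \<otimes> w k) \<in> I" using ZE z by blast
    have c: "z \<in> carrier R" using z ZE by auto
    show ?thesis
    proof (rule ZI[of _ "\<lambda>k. a \<otimes> u1 k"])
      fix x assume x: "x \<in> carrier R"
      let ?s1 = "\<Oplus>k\<in>F. u1 k \<otimes> x \<otimes> w k"
      have s: "?s1 \<in> carrier R"
        using u1(1) wk x by (auto intro!: finsum_closed)
      have "(\<Oplus>k\<in>F. (a \<otimes> u1 k) \<otimes> x \<otimes> w k) = (\<Oplus>k\<in>F. a \<otimes> (u1 k \<otimes> x \<otimes> w k))"
        using u1(1) wk x a by (intro finsum_ring_cong) (auto simp: Pi_iff m_assoc)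
      also have "\<dots> = a \<otimes> ?s1"
        using u1(1) wk x a F by (intro finsum_rdistr[symmetric]) (auto simp: Pi_iff)
      finally have "(a \<otimes> z) \<otimes> x \<otimes> w0 \<oplus> (\<Oplus>k\<in>F. (a \<otimes> u1 k) \<otimes> x \<otimes> w k) = a \<otimes> (z \<otimes> x \<otimes> w0 \<oplus> ?s1)"
        using c x w0 s a by (simp add: r_distr m_assoc)
      then show "(a \<otimes> z) \<otimes> x \<otimes> w0 \<oplus> (\<Oplus>k\<in>F. (a \<otimes> u1 k) \<otimes> x \<otimes> w k) \<in> I"
        using u1(2) x a I_l_closed by simp
    qed (use c u1 a in auto)
  qed
  have rmult: "z \<otimes> a \<in> Z" if z: "z \<in> Z" and a: "a \<in> carrier R" for z a
  proof -
    obtain u1 where u1: "u1 \<in> F \<rightarrow> carrier R"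
      "\<forall>x\<in>carrier R. z \<otimes> x \<otimes> w0 \<oplus> (\<Oplus>k\<in>F. u1 k \<otimes> x \<otimes> w k) \<in> I" using ZE z by blast
    have c: "z \<in> carrier R" using z ZE by auto
    show ?thesis
    proof (rule ZI[of _ "\<lambda>k. u1 k \<otimes> a"])
      fix x assume x: "x \<in> carrier R"
      have "(\<Oplus>k\<in>F. (u1 k \<otimes> a) \<otimes> x \<otimes> w k) = (\<Oplus>k\<in>F. u1 k \<otimes> (a \<otimes> x) \<otimes> w k)"
        using u1(1) wk x a by (intro finsum_ring_cong) (auto simp: Pi_iff m_assoc)
      then have "(z \<otimes> a) \<otimes> x \<otimes> w0 \<oplus> (\<Oplus>k\<in>F. (u1 k \<otimes> a) \<otimes> x \<otimes> w k)
        = z \<otimes> (a \<otimes> x) \<otimes> w0 \<oplus> (\<Oplus>k\<in>F. u1 k \<otimes> (a \<otimes> x) \<otimes> w k)"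
        using c x w0 a by (simp add: m_assoc)
      then show "(z \<otimes> a) \<otimes> x \<otimes> w0 \<oplus> (\<Oplus>k\<in>F. (u1 k \<otimes> a) \<otimes> x \<otimes> w k) \<in> I"
        using u1(2) x a by simp
    qed (use c u1 a in auto)
  qed
  have "ideal Z R"
  proof (rule idealI)
    show "subgroup Z (add_monoid R)"
    proof (rule subgroup.intro)
      show "inv\<^bsub>add_monoid R\<^esub> z \<in> Z" if "z \<in> Z" for z
      proof -
        have "(\<ominus> \<one>) \<otimes> z \<in> Z" using that by (intro lmult) auto
        moreover have "(\<ominus> \<one>) \<otimes> z = \<ominus> z" using ZE(2)[OF that] by (simp add: l_minus)
        ultimately show ?thesis by (simp add: a_inv_def)
      qed
      show "\<one>\<^bsub>add_monoid R\<^esub> \<in> Z"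
        using IZ additive_subgroup.zero_closed[OF is_additive_subgroup] by auto
    qed (use add ZE in auto)
  qed (use lmult rmult ring_axioms in auto)
  moreover have "v \<in> Z" using v u rel by (intro ZI) auto
  moreover have "Z \<subseteq> carrier R" using ZE(2) by blast
  ultimately have "Z = carrier R"
    using I_maximal[of Z] IZ v by blast
  then have "\<one> \<in> Z" by simp
  then obtain u' where u': "u' \<in> F \<rightarrow> carrier R"
    "\<forall>x\<in>carrier R. \<one> \<otimes> x \<otimes> w0 \<oplus> (\<Oplus>k\<in>F. u' k \<otimes> x \<otimes> w k) \<in> I" using ZE by blast
  then show ?thesis using w0 by auto
qed

end

text \<open>The condition says that the centre of the simple ring \<open>R / I\<close> is the image of the centre of \<open>R\<close>,
  as the density argument requires.\<close>

locale central_maximalideal = maximalideal +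
  assumes central_mod: "\<lbrakk>z \<in> carrier R; \<And>s. s \<in> carrier R \<Longrightarrow> s \<otimes> z \<ominus> z \<otimes> s \<in> I\<rbrakk>
    \<Longrightarrow> \<exists>c\<in>ring_center R. z \<ominus> c \<in> I"
begin

text \<open>This is Martindale's lemma on identities \<open>\<Sum> a x b = 0\<close> for the simple
  ring \<open>R / I\<close>. In the induction the coefficient at \<open>l\<close> is either central
  modulo \<open>I\<close>, and then its term merges with that of \<open>w0\<close>, or some
  commutator yields a shorter relation that expresses \<open>w l\<close> by the remaining
  \<open>w k\<close>.\<close>

lemma relation_imp_span:
  assumes "finite F" "w0 \<in> carrier R" "w \<in> F \<rightarrow> carrier R" "u \<in> F \<rightarrow> carrier R"
    and "\<And>x. x \<in> carrier R \<Longrightarrow> x \<otimes> w0 \<oplus> (\<Oplus>k\<in>F. u k \<otimes> x \<otimes> w k) \<in> I"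
  shows "\<exists>c\<in>F \<rightarrow> ring_center R. w0 \<ominus> (\<Oplus>k\<in>F. c k \<otimes> w k) \<in> I"
  using assms
proof (induction F arbitrary: w0 u rule: finite_induct)
  case empty
  then have "\<one> \<otimes> w0 \<oplus> \<zero> \<in> I" using empty(4)[of \<one>] by simp
  then show ?case using empty by (auto simp: a_minus_def)
next
  case (insert l F)
  note rel = insert.prems(4)
  have w0: "w0 \<in> carrier R" by fact
  have wl: "w l \<in> carrier R" and wF: "w \<in> F \<rightarrow> carrier R"
    and ul: "u l \<in> carrier R" and uF: "u \<in> F \<rightarrow> carrier R" using insert.prems by auto
  have wk: "w k \<in> carrier R" if "k \<in> F" for k using wF that by blast
  have uk: "u k \<in> carrier R" if "k \<in> F" for k using uF that by blast
  define S where "S u x = (\<Oplus>k\<in>F. u k \<otimes> x \<otimes> w k)" for u x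
  have S_closed: "S u x \<in> carrier R" if "u \<in> F \<rightarrow> carrier R" "x \<in> carrier R" for u x
    unfolding S_def using that wk by (auto intro!: finsum_closed simp: Pi_iff)
  have split: "(\<Oplus>k\<in>insert l F. u k \<otimes> x \<otimes> w k) = u l \<otimes> x \<otimes> w l \<oplus> S u x"
    if "x \<in> carrier R" for x
    unfolding S_def using that insert.hyps wk uk wl ul by (subst finsum_insert) auto
  have rel': "x \<otimes> w0 \<oplus> (u l \<otimes> x \<otimes> w l \<oplus> S u x) \<in> I" if "x \<in> carrier R" for x
    using rel[OF that] split[OF that] by simp
  \<comment> \<open>a coefficient that is central modulo \<open>I\<close> can be absorbed into \<open>w0\<close>\<close>
  have extend: ?case if c: "c \<in> ring_center R" "c' \<in> F \<rightarrow> ring_center R"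
    and m: "(w0 \<oplus> c \<otimes> w l) \<ominus> (\<Oplus>k\<in>F. c' k \<otimes> w k) \<in> I" for c c'
  proof
    let ?c = "\<lambda>k. if k = l then \<ominus> c else c' k"
    show "?c \<in> insert l F \<rightarrow> ring_center R" using c center_uminus by auto
    have cF: "c' k \<in> carrier R" if "k \<in> F" for k using c(2) that center_closed by blast
    have "(\<Oplus>k\<in>insert l F. ?c k \<otimes> w k) = ?c l \<otimes> w l \<oplus> (\<Oplus>k\<in>F. ?c k \<otimes> w k)"
      using insert.hyps c cF wk wl center_closed by (intro finsum_insert) auto
    also have "(\<Oplus>k\<in>F. ?c k \<otimes> w k) = (\<Oplus>k\<in>F. c' k \<otimes> w k)"
      using insert.hyps cF wk by (intro finsum_ring_cong) auto
    finally have "(\<Oplus>k\<in>insert l F. ?c k \<otimes> w k) = (\<ominus> c) \<otimes> w l \<oplus> (\<Oplus>k\<in>F. c' k \<otimes> w k)" by simp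
    moreover have "w0 \<ominus> ((\<ominus> c) \<otimes> w l \<oplus> s) = (w0 \<oplus> c \<otimes> w l) \<ominus> s" if "s \<in> carrier R" for s
      using that w0 wl center_closed[OF c(1)] by algebra
    moreover have "(\<Oplus>k\<in>F. c' k \<otimes> w k) \<in> carrier R" using cF wk by (auto intro!: finsum_closed)
    ultimately show "w0 \<ominus> (\<Oplus>k\<in>insert l F. ?c k \<otimes> w k) \<in> I" using m by simp
  qed
  show ?case
  proof (cases "\<forall>a\<in>carrier R. a \<otimes> u l \<ominus> u l \<otimes> a \<in> I")
    case True
    then obtain c where c: "c \<in> ring_center R" "u l \<ominus> c \<in> I" using central_mod[OF ul] by blast
    have cc: "c \<in> carrier R" using c(1) by (rule center_closed)
    have "x \<otimes> (w0 \<oplus> c \<otimes> w l) \<oplus> S u x \<in> I" if x: "x \<in> carrier R" for x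
    proof -
      have Sx: "S u x \<in> carrier R" using S_closed uF x .
      have "x \<otimes> (w0 \<oplus> c \<otimes> w l) \<oplus> S u x
        = (x \<otimes> w0 \<oplus> (u l \<otimes> x \<otimes> w l \<oplus> S u x)) \<ominus> (u l \<ominus> c) \<otimes> x \<otimes> w l"
      proof -
        have "x \<otimes> (w0 \<oplus> c \<otimes> w l) = x \<otimes> w0 \<oplus> c \<otimes> x \<otimes> w l"
          using x w0 wl cc center_lcomm[OF c(1) x wl] by (simp add: r_distr m_assoc)
        then show ?thesis using x w0 wl cc ul Sx by algebra
      qed
      then show ?thesis
        using rel'[OF x] c(2) x wl by (simp add: minus_mem I_r_closed)
    qed
    then obtain c' where "c' \<in> F \<rightarrow> ring_center R" "(w0 \<oplus> c \<otimes> w l) \<ominus> (\<Oplus>k\<in>F. c' k \<otimes> w k) \<in> I"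
      using insert.IH[of "w0 \<oplus> c \<otimes> w l" u] w0 wl cc wF uF unfolding S_def by auto
    then show ?thesis using extend c by blast
  next
    case False
    then obtain a where a: "a \<in> carrier R" "a \<otimes> u l \<ominus> u l \<otimes> a \<notin> I" by blast
    \<comment> \<open>the commutator with \<open>a\<close> removes \<open>w0\<close> from the relation\<close>
    define u1 where "u1 k = a \<otimes> u k \<ominus> u k \<otimes> a" for k
    have u1: "u1 \<in> F \<rightarrow> carrier R" "u1 l \<in> carrier R" using a uk ul by (auto simp: u1_def)
    have "u1 l \<otimes> x \<otimes> w l \<oplus> (\<Oplus>k\<in>F. u1 k \<otimes> x \<otimes> w k) \<in> I" if x: "x \<in> carrier R" for x
    proof -
      have cl: "S u x \<in> carrier R" "S u (a \<otimes> x) \<in> carrier R" using S_closed uF x a by auto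
      have "(\<Oplus>k\<in>F. u1 k \<otimes> x \<otimes> w k) = (\<Oplus>k\<in>F. a \<otimes> (u k \<otimes> x \<otimes> w k) \<ominus> u k \<otimes> (a \<otimes> x) \<otimes> w k)"
      proof (rule finsum_ring_cong)
        fix k assume k: "k \<in> F"
        show "u1 k \<otimes> x \<otimes> w k = a \<otimes> (u k \<otimes> x \<otimes> w k) \<ominus> u k \<otimes> (a \<otimes> x) \<otimes> w k"
          unfolding u1_def using a(1) x uk[OF k] wk[OF k] by algebra
      qed (use a x uk wk in auto)
      also have "\<dots> = (\<Oplus>k\<in>F. a \<otimes> (u k \<otimes> x \<otimes> w k)) \<ominus> S u (a \<otimes> x)"
        unfolding S_def using a x uk wk by (intro finsum_sub) auto
      also have "(\<Oplus>k\<in>F. a \<otimes> (u k \<otimes> x \<otimes> w k)) = a \<otimes> S u x"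
        unfolding S_def using a x uk wk insert.hyps by (intro finsum_rdistr[symmetric]) auto
      finally have *: "(\<Oplus>k\<in>F. u1 k \<otimes> x \<otimes> w k) = a \<otimes> S u x \<ominus> S u (a \<otimes> x)" .
      have "u1 l \<otimes> x \<otimes> w l \<oplus> (\<Oplus>k\<in>F. u1 k \<otimes> x \<otimes> w k)
        = a \<otimes> (x \<otimes> w0 \<oplus> (u l \<otimes> x \<otimes> w l \<oplus> S u x))
          \<ominus> ((a \<otimes> x) \<otimes> w0 \<oplus> (u l \<otimes> (a \<otimes> x) \<otimes> w l \<oplus> S u (a \<otimes> x)))"
        unfolding * unfolding u1_def using a(1) x ul wl w0 cl by algebra
      then show ?thesis
        using rel'[OF x] rel'[of "a \<otimes> x"] a(1) x by (simp add: minus_mem I_l_closed)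
    qed
    then obtain u2 where u2: "u2 \<in> F \<rightarrow> carrier R"
      "\<forall>x\<in>carrier R. x \<otimes> w l \<oplus> (\<Oplus>k\<in>F. u2 k \<otimes> x \<otimes> w k) \<in> I"
      using relation_one_leading[OF insert.hyps(1) wl wF u1(1) u1(2)] a(2) unfolding u1_def by blast
    then obtain c where c: "c \<in> F \<rightarrow> ring_center R" "w l \<ominus> (\<Oplus>k\<in>F. c k \<otimes> w k) \<in> I"
      using insert.IH[of "w l" u2] wl wF by blast
    have ck: "c k \<in> carrier R" if "k \<in> F" for k using c(1) that center_closed by blast
    define d where "d = (\<Oplus>k\<in>F. c k \<otimes> w k)"
    have d: "d \<in> carrier R" unfolding d_def using ck wk by (auto intro!: finsum_closed)
    \<comment> \<open>Modulo \<open>I\<close>, \<open>w l\<close> equals the central combination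
      \<open>d\<close> of the other elements, so its term is distributed over theirs. The relation
      keeps its leading element and loses the index \<open>l\<close>.\<close>
    have "x \<otimes> w0 \<oplus> (\<Oplus>k\<in>F. (u k \<oplus> u l \<otimes> c k) \<otimes> x \<otimes> w k) \<in> I" if x: "x \<in> carrier R" for x
    proof -
      have cl: "S u x \<in> carrier R" using S_closed uF x .
      have "(\<Oplus>k\<in>F. (u k \<oplus> u l \<otimes> c k) \<otimes> x \<otimes> w k)
        = (\<Oplus>k\<in>F. u k \<otimes> x \<otimes> w k \<oplus> (u l \<otimes> x) \<otimes> (c k \<otimes> w k))"
      proof (rule finsum_ring_cong)
        fix k assume k: "k \<in> F"
        have ckk: "c k \<in> ring_center R" using c(1) k by blast
        show "(u k \<oplus> u l \<otimes> c k) \<otimes> x \<otimes> w k = u k \<otimes> x \<otimes> w k \<oplus> (u l \<otimes> x) \<otimes> (c k \<otimes> w k)"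
          using x uk[OF k] wk[OF k] ck[OF k] ul center_comm[OF ckk x] center_lcomm[OF ckk x wk[OF k]]
          by (simp add: l_distr m_assoc)
      qed (use x uk wk ck ul in auto)
      also have "\<dots> = S u x \<oplus> (\<Oplus>k\<in>F. (u l \<otimes> x) \<otimes> (c k \<otimes> w k))"
        unfolding S_def using x uk wk ck ul by (intro finsum_addf) auto
      also have "(\<Oplus>k\<in>F. (u l \<otimes> x) \<otimes> (c k \<otimes> w k)) = (u l \<otimes> x) \<otimes> d"
        unfolding d_def using x uk wk ck ul insert.hyps by (intro finsum_rdistr[symmetric]) auto
      finally have "x \<otimes> w0 \<oplus> (\<Oplus>k\<in>F. (u k \<oplus> u l \<otimes> c k) \<otimes> x \<otimes> w k)
        = x \<otimes> w0 \<oplus> (S u x \<oplus> (u l \<otimes> x) \<otimes> d)" by simp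
      also have "\<dots> = (x \<otimes> w0 \<oplus> (u l \<otimes> x \<otimes> w l \<oplus> S u x)) \<ominus> (u l \<otimes> x) \<otimes> (w l \<ominus> d)"
        using x ul wl w0 cl d by algebra
      finally show ?thesis
        using rel'[OF x] c(2) ul x unfolding d_def[symmetric] by (simp add: minus_mem I_l_closed)
    qed
    moreover have "(\<lambda>k. u k \<oplus> u l \<otimes> c k) \<in> F \<rightarrow> carrier R" using uk ul ck by auto
    ultimately obtain c' where c': "c' \<in> F \<rightarrow> ring_center R" "w0 \<ominus> (\<Oplus>k\<in>F. c' k \<otimes> w k) \<in> I"
      using insert.IH[of w0 "\<lambda>k. u k \<oplus> u l \<otimes> c k"] w0 wF by blast
    then have "(w0 \<oplus> \<zero> \<otimes> w l) \<ominus> (\<Oplus>k\<in>F. c' k \<otimes> w k) \<in> I" using w0 wl by simp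
    then show ?thesis using extend[OF center_zero c'(1)] by blast
  qed
qed

text \<open>Over the centre of the simple quotient, the hypothesis on all \<open>x\<close> says that
  the tensor \<open>\<Sum> u k \<otimes> w k\<close> vanishes, so a map linear over the centre may
  be applied to its right factors. Linearity is demanded only modulo \<open>I\<close>, because this
  is all that an element of the inertia group satisfies.\<close>

lemma relation_transport:
  assumes "finite F" "w \<in> F \<rightarrow> carrier R" "u \<in> F \<rightarrow> carrier R"
    and "\<And>x. x \<in> carrier R \<Longrightarrow> (\<Oplus>k\<in>F. u k \<otimes> x \<otimes> w k) \<in> I"
    and f: "f \<in> carrier R \<rightarrow> carrier R"
    and f_add: "\<And>x y. x \<in> carrier R \<Longrightarrow> y \<in> carrier R \<Longrightarrow> f (x \<oplus> y) = f x \<oplus> f y"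
    and f_I: "\<And>x. x \<in> I \<Longrightarrow> f x \<in> I"
    and f_lin: "\<And>c x. c \<in> ring_center R \<Longrightarrow> x \<in> carrier R \<Longrightarrow> f (c \<otimes> x) \<ominus> c \<otimes> f x \<in> I"
  shows "(\<Oplus>k\<in>F. u k \<otimes> f (w k)) \<in> I"
  using assms(1-4)
proof (induction F arbitrary: u rule: finite_induct)
  case empty
  then show ?case by simp
next
  case (insert l F)
  note rel = insert.prems(3)
  have wl: "w l \<in> carrier R" and wF: "w \<in> F \<rightarrow> carrier R"
    and ul: "u l \<in> carrier R" and uF: "u \<in> F \<rightarrow> carrier R" using insert.prems by auto
  have wk: "w k \<in> carrier R" if "k \<in> F" for k using wF that by blast
  have uk: "u k \<in> carrier R" if "k \<in> F" for k using uF that by blast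
  have fc: "f x \<in> carrier R" if "x \<in> carrier R" for x using f that by blast
  define S where "S x = (\<Oplus>k\<in>F. u k \<otimes> x \<otimes> w k)" for x
  have S_closed: "S x \<in> carrier R" if "x \<in> carrier R" for x
    unfolding S_def using that wk uk by (auto intro!: finsum_closed simp: Pi_iff)
  have rel': "u l \<otimes> x \<otimes> w l \<oplus> S x \<in> I" if "x \<in> carrier R" for x
    using rel[OF that] insert.hyps wk uk wl ul that unfolding S_def
    by (subst (asm) finsum_insert) auto
  have goal: "(\<Oplus>k\<in>insert l F. u k \<otimes> f (w k)) = u l \<otimes> f (w l) \<oplus> (\<Oplus>k\<in>F. u k \<otimes> f (w k))"
    using insert.hyps wk uk wl ul fc by (intro finsum_insert) auto
  show ?case
  proof (cases "u l \<in> I")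
    case True
    have "S x \<in> I" if x: "x \<in> carrier R" for x
    proof -
      have "S x = (u l \<otimes> x \<otimes> w l \<oplus> S x) \<ominus> u l \<otimes> x \<otimes> w l"
        using S_closed[OF x] ul x wl by algebra
      then show ?thesis using rel'[OF x] True x wl by (metis minus_mem I_r_closed)
    qed
    then have "(\<Oplus>k\<in>F. u k \<otimes> f (w k)) \<in> I" using insert.IH wF uF unfolding S_def by blast
    then show ?thesis unfolding goal using True wl fc by (simp add: add_mem I_r_closed)
  next
    case False
    \<comment> \<open>A coefficient outside \<open>I\<close> makes \<open>w l\<close> a central
      combination \<open>d\<close> of the other elements modulo \<open>I\<close>. Redistributing its
      term is legitimate both before and after applying \<open>f\<close>, as \<open>f\<close> is
      linear over the centre modulo \<open>I\<close>; the induction hypothesis therefore applies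
      with coefficients \<open>u k \<oplus> u l \<otimes> c k\<close>.\<close>
    obtain u2 where u2: "u2 \<in> F \<rightarrow> carrier R"
      "\<forall>x\<in>carrier R. x \<otimes> w l \<oplus> (\<Oplus>k\<in>F. u2 k \<otimes> x \<otimes> w k) \<in> I"
      using relation_one_leading[OF insert.hyps(1) wl wF uF ul False] rel' unfolding S_def by blast
    then obtain c where c: "c \<in> F \<rightarrow> ring_center R" "w l \<ominus> (\<Oplus>k\<in>F. c k \<otimes> w k) \<in> I"
      using relation_imp_span[OF insert.hyps(1) wl wF] by blast
    have ck: "c k \<in> carrier R" if "k \<in> F" for k using c(1) that center_closed by blast
    define d where "d = (\<Oplus>k\<in>F. c k \<otimes> w k)"
    have d: "d \<in> carrier R" unfolding d_def using ck wk by (auto intro!: finsum_closed)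
    have "(\<Oplus>k\<in>F. (u k \<oplus> u l \<otimes> c k) \<otimes> x \<otimes> w k) \<in> I" if x: "x \<in> carrier R" for x
    proof -
      have "(\<Oplus>k\<in>F. (u k \<oplus> u l \<otimes> c k) \<otimes> x \<otimes> w k)
        = (\<Oplus>k\<in>F. u k \<otimes> x \<otimes> w k \<oplus> (u l \<otimes> x) \<otimes> (c k \<otimes> w k))"
      proof (rule finsum_ring_cong)
        fix k assume k: "k \<in> F"
        have ckk: "c k \<in> ring_center R" using c(1) k by blast
        show "(u k \<oplus> u l \<otimes> c k) \<otimes> x \<otimes> w k = u k \<otimes> x \<otimes> w k \<oplus> (u l \<otimes> x) \<otimes> (c k \<otimes> w k)"
          using x uk[OF k] wk[OF k] ck[OF k] ul center_comm[OF ckk x] center_lcomm[OF ckk x wk[OF k]]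
          by (simp add: l_distr m_assoc)
      qed (use x uk wk ck ul in auto)
      also have "\<dots> = S x \<oplus> (\<Oplus>k\<in>F. (u l \<otimes> x) \<otimes> (c k \<otimes> w k))"
        unfolding S_def using x uk wk ck ul by (intro finsum_addf) auto
      also have "(\<Oplus>k\<in>F. (u l \<otimes> x) \<otimes> (c k \<otimes> w k)) = (u l \<otimes> x) \<otimes> d"
        unfolding d_def using x uk wk ck ul insert.hyps by (intro finsum_rdistr[symmetric]) auto
      also have "S x \<oplus> (u l \<otimes> x) \<otimes> d = (u l \<otimes> x \<otimes> w l \<oplus> S x) \<ominus> (u l \<otimes> x) \<otimes> (w l \<ominus> d)"
        using x ul wl S_closed[OF x] d by algebra
      finally show ?thesis
        using rel'[OF x] c(2) ul x unfolding d_def[symmetric] by (simp add: minus_mem I_l_closed)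
    qed
    moreover have "(\<lambda>k. u k \<oplus> u l \<otimes> c k) \<in> F \<rightarrow> carrier R" using uk ul ck by auto
    ultimately have *: "(\<Oplus>k\<in>F. (u k \<oplus> u l \<otimes> c k) \<otimes> f (w k)) \<in> I"
      using insert.IH wF by blast
    let ?t = "\<Oplus>k\<in>F. u k \<otimes> f (w k)" and ?s = "\<Oplus>k\<in>F. c k \<otimes> f (w k)"
    have ts: "?t \<in> carrier R" "?s \<in> carrier R" using uk wk fc ck by (auto intro!: finsum_closed)
    have "(\<Oplus>k\<in>F. (u k \<oplus> u l \<otimes> c k) \<otimes> f (w k)) = (\<Oplus>k\<in>F. u k \<otimes> f (w k) \<oplus> u l \<otimes> (c k \<otimes> f (w k)))"
      using uk wk fc ck ul by (intro finsum_ring_cong) (auto simp: l_distr m_assoc)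
    also have "\<dots> = ?t \<oplus> (\<Oplus>k\<in>F. u l \<otimes> (c k \<otimes> f (w k)))"
      using uk wk fc ck ul by (intro finsum_addf) auto
    also have "(\<Oplus>k\<in>F. u l \<otimes> (c k \<otimes> f (w k))) = u l \<otimes> ?s"
      using wk fc ck ul insert.hyps by (intro finsum_rdistr[symmetric]) auto
    finally have **: "?t \<oplus> u l \<otimes> ?s \<in> I" using * by simp
    have fd: "f d = (\<Oplus>k\<in>F. f (c k \<otimes> w k))"
      unfolding d_def using f f_add ck wk by (intro additive_finsum) auto
    have "f d \<ominus> ?s = (\<Oplus>k\<in>F. f (c k \<otimes> w k) \<ominus> c k \<otimes> f (w k))"
      unfolding fd using ck wk fc by (intro finsum_sub[symmetric]) auto
    also have "\<dots> \<in> I" using c(1) wk f_lin by (intro finsum_mem) auto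
    finally have ds: "f d \<ominus> ?s \<in> I" .
    have "f (w l) = f ((w l \<ominus> d) \<oplus> d)" using wl d by (intro arg_cong[where f = f]) algebra
    also have "\<dots> = f (w l \<ominus> d) \<oplus> f d" using wl d by (intro f_add) auto
    finally have fwl: "f (w l) = f (w l \<ominus> d) \<oplus> f d" .
    have "f (w l) \<ominus> ?s = f (w l \<ominus> d) \<oplus> (f d \<ominus> ?s)"
      unfolding fwl using fc[of "w l \<ominus> d"] fc[OF d] wl d ts(2) by (simp add: a_minus_def a_assoc)
    also have "\<dots> \<in> I" using ds f_I c(2) unfolding d_def[symmetric] by (simp add: add_mem)
    finally have fs: "f (w l) \<ominus> ?s \<in> I" .
    have "a \<otimes> b \<oplus> t = a \<otimes> (b \<ominus> s) \<oplus> (t \<oplus> a \<otimes> s)"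
      if "a \<in> carrier R" "b \<in> carrier R" "t \<in> carrier R" "s \<in> carrier R" for a b t s
      using that by algebra
    from this[OF ul fc[OF wl] ts]
    have "u l \<otimes> f (w l) \<oplus> ?t = u l \<otimes> (f (w l) \<ominus> ?s) \<oplus> (?t \<oplus> u l \<otimes> ?s)" .
    also have "\<dots> \<in> I" using ** fs ul by (simp add: add_mem I_l_closed)
    finally show ?thesis unfolding goal .
  qed
qed

end

section \<open>Groupoids and actions extended to the whole ring\<close>

context groupoid
begin

lemma dom_in_objects: "g \<in> carrier G \<Longrightarrow> gdom G g \<in> gobjects G"
  by (simp add: gobjects_def)

lemma rng_in_objects: "g \<in> carrier G \<Longrightarrow> grng G g \<in> gobjects G"
  unfolding gobjects_def using dom_rng rng_closed by (metis imageI)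

lemma object_closed: "e \<in> gobjects G \<Longrightarrow> e \<in> carrier G"
  and dom_object: "e \<in> gobjects G \<Longrightarrow> gdom G e = e"
  and rng_object: "e \<in> gobjects G \<Longrightarrow> grng G e = e"
  by (auto simp: gobjects_def dom_closed dom_dom rng_dom)

lemma ginverse_unique:
  assumes "g \<in> carrier G" "is_ginverse G g h" "is_ginverse G g k"
  shows "h = k"
proof -
  have h: "h \<in> carrier G" "gdom G h = grng G g" "grng G h = gdom G g" "gcomp G h g = gdom G g"
    and k: "k \<in> carrier G" "gdom G k = grng G g" "grng G k = gdom G g" "gcomp G g k = grng G g"
    using assms unfolding is_ginverse_def by auto
  have "h = gcomp G h (gcomp G g k)" using comp_dom[OF h(1)] h k by simp
  also have "\<dots> = gcomp G (gcomp G h g) k" using comp_assoc[of h g k] h k assms(1) by simp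
  also have "\<dots> = k" using rng_comp_left[OF k(1)] h k by simp
  finally show ?thesis .
qed

lemma ginv_is_ginverse:
  assumes "g \<in> carrier G"
  shows "is_ginverse G g (ginv G g)"
proof -
  have "\<exists>!h. is_ginverse G g h" using ex_inverse[OF assms] ginverse_unique[OF assms] by blast
  then show ?thesis unfolding ginv_def by (rule theI')
qed

lemma
  assumes "g \<in> carrier G"
  shows ginv_closed: "ginv G g \<in> carrier G"
    and dom_ginv: "gdom G (ginv G g) = grng G g"
    and rng_ginv: "grng G (ginv G g) = gdom G g"
    and comp_ginv: "gcomp G g (ginv G g) = grng G g"
    and ginv_comp: "gcomp G (ginv G g) g = gdom G g"
  using ginv_is_ginverse[OF assms] by (auto simp: is_ginverse_def)

lemma ginv_ginv: "g \<in> carrier G \<Longrightarrow> ginv G (ginv G g) = g"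
proof -
  assume g: "g \<in> carrier G"
  have "is_ginverse G (ginv G g) g"
    using g dom_ginv rng_ginv comp_ginv ginv_comp by (simp add: is_ginverse_def)
  then show ?thesis using ginverse_unique[OF ginv_closed[OF g] ginv_is_ginverse[OF ginv_closed[OF g]]] by blast
qed

lemma ginv_object: "e \<in> gobjects G \<Longrightarrow> ginv G e = e"
proof -
  assume e: "e \<in> gobjects G"
  have c: "e \<in> carrier G" using e by (rule object_closed)
  have "is_ginverse G e e"
    using c dom_object[OF e] rng_object[OF e] comp_dom[OF c] by (simp add: is_ginverse_def)
  then show ?thesis using ginverse_unique[OF c ginv_is_ginverse[OF c]] by blast
qed

lemma ginv_object_iff: "g \<in> carrier G \<Longrightarrow> ginv G g \<in> gobjects G \<longleftrightarrow> g \<in> gobjects G"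
  using ginv_object ginv_ginv by metis

lemma ginv_cancel:
  assumes "g \<in> carrier G" "k \<in> carrier G" "gdom G g = grng G k"
  shows "gcomp G (ginv G g) (gcomp G g k) = k"
  using comp_assoc[of "ginv G g" g k] assms ginv_closed dom_ginv ginv_comp rng_comp_left by simp

lemma ginv_cancel':
  assumes "g \<in> carrier G" "k \<in> carrier G" "grng G g = grng G k"
  shows "gcomp G g (gcomp G (ginv G g) k) = k"
  using comp_assoc[of g "ginv G g" k] assms ginv_closed dom_ginv rng_ginv comp_ginv rng_comp_left by simp

lemma
  assumes "H \<in> wide_subgroupoids G"
  shows wide_subset: "H \<subseteq> carrier G"
    and wide_comp: "g \<in> H \<Longrightarrow> h \<in> H \<Longrightarrow> gdom G g = grng G h \<Longrightarrow> gcomp G g h \<in> H"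
    and wide_ginv: "h \<in> H \<Longrightarrow> ginv G h \<in> H"
    and wide_objects: "gobjects G \<subseteq> H"
proof -
  have H: "subgroupoid G H" "gdom G ` H = gobjects G"
    using assms by (auto simp: wide_subgroupoids_def gobjects_def)
  show sub: "H \<subseteq> carrier G"
    and comp: "g \<in> H \<Longrightarrow> h \<in> H \<Longrightarrow> gdom G g = grng G h \<Longrightarrow> gcomp G g h \<in> H"
    and inv: "h \<in> H \<Longrightarrow> ginv G h \<in> H" for g h
    using H(1) by (auto simp: subgroupoid_def)
  show "gobjects G \<subseteq> H"
  proof
    fix e assume "e \<in> gobjects G"
    \<comment> \<open>Wideness only says that \<open>e\<close> is the domain of some
      \<open>h\<close> in \<open>H\<close>; that \<open>e\<close> itself lies in \<open>H\<close>
      follows because it is the product of the inverse of \<open>h\<close> with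
      \<open>h\<close>.\<close>
    then obtain h where h: "h \<in> H" "e = gdom G h" using H(2) by blast
    then have "h \<in> carrier G" using sub by blast
    then show "e \<in> H" using comp[of "ginv G h" h] inv h dom_ginv ginv_comp by simp
  qed
qed

end

text \<open>The maps \<open>\<beta> g (_ 1\<^sub>g\<^sup>-\<^sup>1)\<close> are defined on the whole ring; they and the
  identities of the ideals carry all the information about a unital action.\<close>

locale total_action = groupoid G + ring R
  for G :: "('g, 'x) groupoid_scheme" and R :: "('a, 'm) ring_scheme" (structure) +
  fixes \<epsilon> :: "'g \<Rightarrow> 'a" and B :: "'g \<Rightarrow> 'a \<Rightarrow> 'a"
  assumes finite_carrier: "finite (carrier G)"
    and \<epsilon>_center: "e \<in> gobjects G \<Longrightarrow> \<epsilon> e \<in> ring_center R"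
    and \<epsilon>_idem: "e \<in> gobjects G \<Longrightarrow> \<epsilon> e \<otimes> \<epsilon> e = \<epsilon> e"
    and \<epsilon>_orth: "\<lbrakk>e \<in> gobjects G; f \<in> gobjects G; e \<noteq> f\<rbrakk> \<Longrightarrow> \<epsilon> e \<otimes> \<epsilon> f = \<zero>"
    and \<epsilon>_sum: "(\<Oplus>e\<in>gobjects G. \<epsilon> e) = \<one>"
    and B_closed: "\<lbrakk>g \<in> carrier G; x \<in> carrier R\<rbrakk> \<Longrightarrow> B g x \<in> carrier R"
    and B_add: "\<lbrakk>g \<in> carrier G; x \<in> carrier R; y \<in> carrier R\<rbrakk> \<Longrightarrow> B g (x \<oplus> y) = B g x \<oplus> B g y"
    and B_mult: "\<lbrakk>g \<in> carrier G; x \<in> carrier R; y \<in> carrier R\<rbrakk> \<Longrightarrow> B g (x \<otimes> y) = B g x \<otimes> B g y"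
    and B_one: "g \<in> carrier G \<Longrightarrow> B g \<one> = \<epsilon> (grng G g)"
    and B_comp: "\<lbrakk>g \<in> carrier G; h \<in> carrier G; gdom G g = grng G h; x \<in> carrier R\<rbrakk>
      \<Longrightarrow> B g (B h x) = B (gcomp G g h) x"
    and B_object: "\<lbrakk>e \<in> gobjects G; x \<in> carrier R\<rbrakk> \<Longrightarrow> B e x = x \<otimes> \<epsilon> e"
begin

definition invariants :: "'g set \<Rightarrow> 'a set" where
  "invariants H = {r \<in> carrier R. \<forall>h\<in>H. B h r = r \<otimes> \<epsilon> (grng G h)}"

lemma \<epsilon>_closed: "e \<in> gobjects G \<Longrightarrow> \<epsilon> e \<in> carrier R"
  using \<epsilon>_center center_closed by blast

lemma \<epsilon>_dom_closed: "g \<in> carrier G \<Longrightarrow> \<epsilon> (gdom G g) \<in> carrier R"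
  and \<epsilon>_rng_closed: "g \<in> carrier G \<Longrightarrow> \<epsilon> (grng G g) \<in> carrier R"
  by (simp_all add: \<epsilon>_closed dom_in_objects rng_in_objects)

lemma finite_objects: "finite (gobjects G)"
  using finite_carrier by (simp add: gobjects_def)

lemma B_dom: "g \<in> carrier G \<Longrightarrow> x \<in> carrier R \<Longrightarrow> B g (x \<otimes> \<epsilon> (gdom G g)) = B g x"
  using B_comp[of g "gdom G g" x] B_object[OF dom_in_objects, of g x] dom_closed rng_dom comp_dom
  by simp

lemma B_rng: "g \<in> carrier G \<Longrightarrow> x \<in> carrier R \<Longrightarrow> B g x \<otimes> \<epsilon> (grng G g) = B g x"
  using B_comp[of "grng G g" g x] B_object[OF rng_in_objects, of g "B g x"] B_closed
    rng_closed dom_rng rng_comp_left by simp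

lemma B_rng': "g \<in> carrier G \<Longrightarrow> x \<in> carrier R \<Longrightarrow> \<epsilon> (grng G g) \<otimes> B g x = B g x"
  using center_comm[OF \<epsilon>_center[OF rng_in_objects] B_closed] B_rng by simp

lemma B_zero: "g \<in> carrier G \<Longrightarrow> B g \<zero> = \<zero>"
  using B_add[of g \<zero> \<zero>] B_closed[of g \<zero>] by (metis add.r_cancel_one' l_zero zero_closed)

lemma B_uminus: "g \<in> carrier G \<Longrightarrow> x \<in> carrier R \<Longrightarrow> B g (\<ominus> x) = \<ominus> B g x"
  using B_add[of g "\<ominus> x" x] B_zero[of g] B_closed[of g x] B_closed[of g "\<ominus> x"]
  by (metis a_inv_closed l_neg minus_equality)

lemma B_finsum: "g \<in> carrier G \<Longrightarrow> f \<in> A \<rightarrow> carrier R \<Longrightarrow> B g (\<Oplus>i\<in>A. f i) = (\<Oplus>i\<in>A. B g (f i))"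
  by (rule additive_finsum) (auto simp: B_closed B_add)

lemma B_\<epsilon>_dom: "g \<in> carrier G \<Longrightarrow> B g (\<epsilon> (gdom G g)) = \<epsilon> (grng G g)"
  using B_dom[of g \<one>] B_one \<epsilon>_dom_closed by simp

lemma B_\<epsilon>_other: "g \<in> carrier G \<Longrightarrow> e \<in> gobjects G \<Longrightarrow> e \<noteq> gdom G g \<Longrightarrow> B g (\<epsilon> e) = \<zero>"
  using B_dom[of g "\<epsilon> e"] \<epsilon>_orth[of e "gdom G g"] \<epsilon>_closed dom_in_objects B_zero by simp

lemma B_noncomp:
  assumes "g \<in> carrier G" "e \<in> gobjects G" "x \<in> carrier R" "x \<otimes> \<epsilon> e = x" "e \<noteq> gdom G g"
  shows "B g x = \<zero>"
  using B_mult[of g x "\<epsilon> e"] B_\<epsilon>_other assms \<epsilon>_closed B_closed by simp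

lemma B_ginv_B: "g \<in> carrier G \<Longrightarrow> x \<in> carrier R \<Longrightarrow> B (ginv G g) (B g x) = x \<otimes> \<epsilon> (gdom G g)"
  using B_comp[of "ginv G g" g x] B_object[OF dom_in_objects] ginv_closed dom_ginv ginv_comp by simp

lemma B_B_ginv: "g \<in> carrier G \<Longrightarrow> x \<in> carrier R \<Longrightarrow> B g (B (ginv G g) x) = x \<otimes> \<epsilon> (grng G g)"
  using B_comp[of g "ginv G g" x] B_object[OF rng_in_objects] ginv_closed rng_ginv comp_ginv by simp

text \<open>Since \<open>B g c\<close> lives in the component at \<open>grng G g\<close>, only that
  component of \<open>r\<close> matters, and it is the image of \<open>B (ginv G g) r\<close>.
  Commuting with \<open>r\<close> is thereby pulled back to the centrality of
  \<open>c\<close>.\<close>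

lemma B_center:
  assumes g: "g \<in> carrier G" and c: "c \<in> ring_center R"
  shows "B g c \<in> ring_center R"
proof (rule center_memI)
  have cc: "c \<in> carrier R" using c by (rule center_closed)
  show "B g c \<in> carrier R" using g cc by (rule B_closed)
  fix r assume r: "r \<in> carrier R"
  let ?r = "B (ginv G g) r"
  have rc: "?r \<in> carrier R" using B_closed ginv_closed g r by simp
  have \<epsilon>: "\<epsilon> (grng G g) \<in> ring_center R" using g by (simp add: \<epsilon>_center rng_in_objects)
  note ec = center_closed[OF \<epsilon>]
  have "B g c \<otimes> r = (\<epsilon> (grng G g) \<otimes> B g c) \<otimes> r" using g cc B_rng' by simp
  also have "\<dots> = B g c \<otimes> (r \<otimes> \<epsilon> (grng G g))"
    using center_comm[OF \<epsilon>, of "B g c \<otimes> r"] B_closed[OF g cc] r ec by (simp add: m_assoc)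
  also have "\<dots> = B g (c \<otimes> ?r)" using B_mult[OF g cc rc] B_B_ginv g r by simp
  also have "c \<otimes> ?r = ?r \<otimes> c" using center_comm[OF c rc] .
  also have "B g (?r \<otimes> c) = (r \<otimes> \<epsilon> (grng G g)) \<otimes> B g c" using B_mult[OF g rc cc] B_B_ginv g r by simp
  also have "\<dots> = r \<otimes> B g c" using B_rng' g cc B_closed r ec by (simp add: m_assoc)
  finally show "B g c \<otimes> r = r \<otimes> B g c" .
qed

lemma sum_components:
  assumes "x \<in> carrier R"
  shows "(\<Oplus>e\<in>gobjects G. x \<otimes> \<epsilon> e) = x"
  using finsum_rdistr[of "gobjects G" x \<epsilon>] finite_objects assms \<epsilon>_closed \<epsilon>_sum by (simp add: Pi_iff)

lemma invariants_closed: "r \<in> invariants H \<Longrightarrow> r \<in> carrier R"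
  and invariantsD: "r \<in> invariants H \<Longrightarrow> h \<in> H \<Longrightarrow> B h r = r \<otimes> \<epsilon> (grng G h)"
  by (simp_all add: invariants_def)

text \<open>Common core of the full trace and of the reduced trace. Applying \<open>B k\<close>
  kills the terms outside the component \<open>gdom G k\<close> and moves the others bijectively
  onto the terms with range \<open>grng G k\<close>, which are exactly those that survive
  multiplication by \<open>\<epsilon> (grng G k)\<close>. Any bijection of these fibres will do, so
  \<phi> may be composition followed by a choice of representative.\<close>

lemma orbit_sum_invariant:
  assumes H: "H \<subseteq> carrier G" and T: "finite T" and y: "y \<in> T \<rightarrow> carrier R"
    and \<rho>: "\<And>t. t \<in> T \<Longrightarrow> \<rho> t \<in> gobjects G" "\<And>t. t \<in> T \<Longrightarrow> y t \<otimes> \<epsilon> (\<rho> t) = y t"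
    and \<phi>: "\<And>k. k \<in> H \<Longrightarrow> bij_betw (\<phi> k) {t \<in> T. \<rho> t = gdom G k} {t \<in> T. \<rho> t = grng G k}"
      "\<And>k t. k \<in> H \<Longrightarrow> t \<in> T \<Longrightarrow> \<rho> t = gdom G k \<Longrightarrow> B k (y t) = y (\<phi> k t)"
  shows "(\<Oplus>t\<in>T. y t) \<in> invariants H"
  unfolding invariants_def
proof (intro CollectI conjI ballI)
  show "(\<Oplus>t\<in>T. y t) \<in> carrier R" using y by (rule finsum_closed)
  fix k assume k: "k \<in> H"
  then have kG: "k \<in> carrier G" using H by blast
  let ?D = "{t \<in> T. \<rho> t = gdom G k}" and ?E = "{t \<in> T. \<rho> t = grng G k}"
  have yc: "y t \<in> carrier R" if "t \<in> T" for t using y that by blast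
  have "B k (\<Oplus>t\<in>T. y t) = (\<Oplus>t\<in>T. B k (y t))" using kG y by (rule B_finsum)
  also have "\<dots> = (\<Oplus>t\<in>?D. B k (y t))"
  proof (rule add.finprod_mono_neutral_cong_left[symmetric])
    show "B k (y t) = \<zero>" if "t \<in> T - ?D" for t
      using that B_noncomp[OF kG \<rho>(1)[of t] yc[of t] \<rho>(2)[of t]] by auto
  qed (use T yc kG B_closed in auto)
  also have "\<dots> = (\<Oplus>t\<in>?D. y (\<phi> k t))"
    using \<phi>(2)[OF k] bij_betwE[OF \<phi>(1)[OF k]] yc by (intro finsum_ring_cong) auto
  also have "\<dots> = (\<Oplus>t\<in>\<phi> k ` ?D. y t)"
    using \<phi>(1)[OF k] yc by (intro finsum_reindex[symmetric]) (auto simp: bij_betw_def)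
  also have "\<phi> k ` ?D = ?E" using \<phi>(1)[OF k] by (simp add: bij_betw_def)
  also have "(\<Oplus>t\<in>?E. y t) = (\<Oplus>t\<in>T. y t \<otimes> \<epsilon> (grng G k))"
  proof (rule add.finprod_mono_neutral_cong_left)
    show "y t \<otimes> \<epsilon> (grng G k) = \<zero>" if t: "t \<in> T - ?E" for t
    proof -
      from t have tT: "t \<in> T" and ne: "\<rho> t \<noteq> grng G k" by auto
      have "y t \<otimes> \<epsilon> (grng G k) = y t \<otimes> (\<epsilon> (\<rho> t) \<otimes> \<epsilon> (grng G k))"
        using \<rho>[OF tT] yc[OF tT] \<epsilon>_closed \<epsilon>_rng_closed[OF kG] by (metis m_assoc)
      also have "\<epsilon> (\<rho> t) \<otimes> \<epsilon> (grng G k) = \<zero>" using \<epsilon>_orth[OF \<rho>(1)[OF tT] rng_in_objects[OF kG] ne] .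
      finally show "y t \<otimes> \<epsilon> (grng G k) = \<zero>" using yc tT by simp
    qed
  next
    fix t assume t: "t \<in> ?E"
    then show "y t = y t \<otimes> \<epsilon> (grng G k)" using \<rho>(2)[of t] by auto
  qed (use T yc \<epsilon>_rng_closed[OF kG] in auto)
  also have "\<dots> = (\<Oplus>t\<in>T. y t) \<otimes> \<epsilon> (grng G k)"
    using T \<epsilon>_rng_closed[OF kG] y by (rule finsum_ldistr[symmetric])
  finally show "B k (\<Oplus>t\<in>T. y t) = (\<Oplus>t\<in>T. y t) \<otimes> \<epsilon> (grng G k)" .
qed

definition tr :: "'a \<Rightarrow> 'a" where
  "tr x = (\<Oplus>g\<in>carrier G. B g x)"

lemma tr_closed: "x \<in> carrier R \<Longrightarrow> tr x \<in> carrier R"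
  unfolding tr_def by (intro finsum_closed) (auto simp: B_closed)

lemma tr_invariant:
  assumes "x \<in> carrier R"
  shows "tr x \<in> invariants (carrier G)"
  unfolding tr_def
proof (rule orbit_sum_invariant[where \<rho> = "grng G" and \<phi> = "gcomp G"])
  fix k assume k: "k \<in> carrier G"
  show "bij_betw (gcomp G k) {t \<in> carrier G. grng G t = gdom G k} {t \<in> carrier G. grng G t = grng G k}"
    by (rule bij_betw_byWitness[where f' = "gcomp G (ginv G k)"])
      (use k in \<open>auto simp: ginv_cancel ginv_cancel' comp_closed rng_comp ginv_closed dom_ginv rng_ginv\<close>)
qed (use assms finite_carrier B_closed rng_in_objects B_rng B_comp in auto)

end

text \<open>The form in which the Galois and the separability hypotheses enter the double
  centralizer argument. The sum in \<open>uv_twist\<close> intertwines the identity with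
  \<open>B h\<close>; at an object it is a component of a central element.\<close>

locale separable_action = total_action G R \<epsilon> B
  for G :: "('g, 'x) groupoid_scheme" and R :: "('a, 'm) ring_scheme" (structure)
    and \<epsilon> :: "'g \<Rightarrow> 'a" and B :: "'g \<Rightarrow> 'a \<Rightarrow> 'a" +
  fixes K :: "'i set" and u v :: "'i \<Rightarrow> 'a"
  assumes K: "finite K" "u \<in> K \<rightarrow> carrier R" "v \<in> K \<rightarrow> carrier R"
    and uv_one: "(\<Oplus>k\<in>K. u k \<otimes> v k) = \<one>"
    and uv_twist: "\<lbrakk>h \<in> carrier G; n \<in> carrier R; s \<in> carrier R\<rbrakk> \<Longrightarrow>
      s \<otimes> (\<Oplus>k\<in>K. u k \<otimes> n \<otimes> B h (v k)) = (\<Oplus>k\<in>K. u k \<otimes> n \<otimes> B h (v k)) \<otimes> B h s"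

section \<open>The separability element of a Galois extension\<close>

text \<open>The assumption \<open>ab_comm\<close> is what remains of separability after inserting
  \<open>r\<close> between the two tensor factors, which is possible because the ground ring of the
  tensor product is central in \<open>R\<close>.\<close>

locale galois_separable_action = total_action G R \<epsilon> B
  for G :: "('g, 'x) groupoid_scheme" and R :: "('a, 'm) ring_scheme" (structure)
    and \<epsilon> :: "'g \<Rightarrow> 'a" and B :: "'g \<Rightarrow> 'a \<Rightarrow> 'a" +
  fixes m n :: nat and x y a b :: "nat \<Rightarrow> 'a"
  assumes x: "x \<in> {1..m} \<rightarrow> carrier R" and y: "y \<in> {1..m} \<rightarrow> carrier R"
    and galois: "g \<in> carrier G \<Longrightarrow> (\<Oplus>i\<in>{1..m}. x i \<otimes> B g (y i)) = (if g \<in> gobjects G then \<epsilon> g else \<zero>)"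
    and a: "a \<in> {1..n} \<rightarrow> invariants (carrier G)" and b: "b \<in> {1..n} \<rightarrow> invariants (carrier G)"
    and ab_one: "(\<Oplus>i\<in>{1..n}. a i \<otimes> b i) = \<one>"
    and ab_comm: "\<lbrakk>s \<in> invariants (carrier G); r \<in> carrier R\<rbrakk> \<Longrightarrow>
      s \<otimes> (\<Oplus>i\<in>{1..n}. a i \<otimes> r \<otimes> b i) = (\<Oplus>i\<in>{1..n}. a i \<otimes> r \<otimes> b i) \<otimes> s"
begin

lemma xc: "i \<in> {1..m} \<Longrightarrow> x i \<in> carrier R" and yc: "i \<in> {1..m} \<Longrightarrow> y i \<in> carrier R"
  and ac: "j \<in> {1..n} \<Longrightarrow> a j \<in> carrier R" and bc: "j \<in> {1..n} \<Longrightarrow> b j \<in> carrier R"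
  using x y a b invariants_closed by blast+

text \<open>Mirror image of the Galois condition, obtained by applying \<open>B g\<close> to the
  condition for \<open>ginv G g\<close>.\<close>

lemma galois': 
  assumes g: "g \<in> carrier G"
  shows "(\<Oplus>i\<in>{1..m}. B g (x i) \<otimes> y i) = (if g \<in> gobjects G then \<epsilon> g else \<zero>)"
proof -
  have g': "ginv G g \<in> carrier G" using g by (rule ginv_closed)
  have "(\<Oplus>i\<in>{1..m}. B g (x i) \<otimes> y i) = (\<Oplus>i\<in>{1..m}. B g (x i \<otimes> B (ginv G g) (y i)))"
  proof (rule finsum_ring_cong)
    fix i assume i: "i \<in> {1..m}"
    have "B g (x i) \<otimes> y i = \<epsilon> (grng G g) \<otimes> B g (x i) \<otimes> y i"
      using B_rng' g xc[OF i] by simp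
    also have "\<dots> = B g (x i) \<otimes> (y i \<otimes> \<epsilon> (grng G g))"
      using center_comm[OF \<epsilon>_center[OF rng_in_objects[OF g]], of "B g (x i) \<otimes> y i"]
        B_closed[OF g xc[OF i]] yc[OF i] \<epsilon>_rng_closed[OF g] by (simp add: m_assoc)
    also have "\<dots> = B g (x i \<otimes> B (ginv G g) (y i))"
      using B_mult[OF g xc[OF i] B_closed[OF g' yc[OF i]]] B_B_ginv[OF g yc[OF i]] by simp
    finally show "B g (x i) \<otimes> y i = B g (x i \<otimes> B (ginv G g) (y i))" .
  qed (use B_closed g g' xc yc in auto)
  also have "\<dots> = B g (\<Oplus>i\<in>{1..m}. x i \<otimes> B (ginv G g) (y i))"
    using B_closed g g' xc yc by (intro B_finsum[symmetric]) auto
  also have "\<dots> = B g (if g \<in> gobjects G then \<epsilon> g else \<zero>)"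
    using galois[OF g'] ginv_object_iff[OF g] ginv_object[of g] by auto
  also have "\<dots> = (if g \<in> gobjects G then \<epsilon> g else \<zero>)"
    using B_zero[OF g] B_object[of g] \<epsilon>_closed \<epsilon>_idem by auto
  finally show ?thesis .
qed

lemma sum_delta:
  assumes F: "\<And>g. g \<in> carrier G \<Longrightarrow> F g = (if g \<in> gobjects G then z \<otimes> \<epsilon> g else \<zero>)" and z: "z \<in> carrier R"
  shows "(\<Oplus>g\<in>carrier G. F g) = z"
proof -
  have "(\<Oplus>g\<in>gobjects G. z \<otimes> \<epsilon> g) = (\<Oplus>g\<in>carrier G. F g)"
    using finite_carrier F object_closed z \<epsilon>_closed
    by (intro add.finprod_mono_neutral_cong_left) auto
  then show ?thesis using sum_components[OF z] by simp
qed

text \<open>The elements \<open>x i\<close> with the functionals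
  \<open>z \<mapsto> tr (y i \<otimes> z)\<close> form a dual basis of \<open>R\<close> as a right
  module over the invariants: after exchanging the sums the Galois condition leaves only the terms
  at objects, which are the components of \<open>z\<close>.\<close>

lemma dual_basis_left:
  assumes z: "z \<in> carrier R"
  shows "(\<Oplus>i\<in>{1..m}. x i \<otimes> tr (y i \<otimes> z)) = z"
proof -
  have "(\<Oplus>i\<in>{1..m}. x i \<otimes> tr (y i \<otimes> z)) = (\<Oplus>i\<in>{1..m}. \<Oplus>g\<in>carrier G. x i \<otimes> B g (y i) \<otimes> B g z)"
  proof (rule finsum_ring_cong)
    fix i assume i: "i \<in> {1..m}"
    have "x i \<otimes> tr (y i \<otimes> z) = (\<Oplus>g\<in>carrier G. x i \<otimes> B g (y i \<otimes> z))"
      unfolding tr_def using i xc yc z B_closed finite_carrier by (intro finsum_rdistr) auto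
    also have "\<dots> = (\<Oplus>g\<in>carrier G. x i \<otimes> B g (y i) \<otimes> B g z)"
      using i xc yc z B_closed B_mult by (intro finsum_ring_cong) (auto simp: m_assoc)
    finally show "x i \<otimes> tr (y i \<otimes> z) = (\<Oplus>g\<in>carrier G. x i \<otimes> B g (y i) \<otimes> B g z)" .
  qed (use xc yc z B_closed in \<open>auto intro!: finsum_closed\<close>)
  also have "\<dots> = (\<Oplus>g\<in>carrier G. \<Oplus>i\<in>{1..m}. x i \<otimes> B g (y i) \<otimes> B g z)"
    using finite_carrier xc yc z B_closed by (intro finsum_swap) auto
  also have "\<dots> = z"
  proof (rule sum_delta[OF _ z])
    fix g assume g: "g \<in> carrier G"
    have "(\<Oplus>i\<in>{1..m}. x i \<otimes> B g (y i) \<otimes> B g z) = (\<Oplus>i\<in>{1..m}. x i \<otimes> B g (y i)) \<otimes> B g z"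
      using g xc yc z B_closed by (intro finsum_ldistr[symmetric]) auto
    also have "\<dots> = (if g \<in> gobjects G then z \<otimes> \<epsilon> g else \<zero>)"
      using galois[OF g] B_closed[OF g z] B_object[OF _ z, of g] B_rng'[OF g z] rng_object[of g] by auto
    finally show "(\<Oplus>i\<in>{1..m}. x i \<otimes> B g (y i) \<otimes> B g z) = (if g \<in> gobjects G then z \<otimes> \<epsilon> g else \<zero>)" .
  qed
  finally show ?thesis .
qed

text \<open>The corresponding dual basis of \<open>R\<close> as a left module over the invariants;
  here the mirrored condition \<open>galois'\<close> removes the terms off the objects.\<close>

lemma dual_basis_right:
  assumes z: "z \<in> carrier R"
  shows "(\<Oplus>i\<in>{1..m}. tr (z \<otimes> x i) \<otimes> y i) = z"
proof -
  have "(\<Oplus>i\<in>{1..m}. tr (z \<otimes> x i) \<otimes> y i) = (\<Oplus>i\<in>{1..m}. \<Oplus>g\<in>carrier G. B g z \<otimes> (B g (x i) \<otimes> y i))"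
  proof (rule finsum_ring_cong)
    fix i assume i: "i \<in> {1..m}"
    have "tr (z \<otimes> x i) \<otimes> y i = (\<Oplus>g\<in>carrier G. B g (z \<otimes> x i) \<otimes> y i)"
      unfolding tr_def using i xc yc z B_closed finite_carrier by (intro finsum_ldistr) auto
    also have "\<dots> = (\<Oplus>g\<in>carrier G. B g z \<otimes> (B g (x i) \<otimes> y i))"
      using i xc yc z B_closed B_mult by (intro finsum_ring_cong) (auto simp: m_assoc)
    finally show "tr (z \<otimes> x i) \<otimes> y i = (\<Oplus>g\<in>carrier G. B g z \<otimes> (B g (x i) \<otimes> y i))" .
  qed (use xc yc z B_closed in \<open>auto intro!: finsum_closed\<close>)
  also have "\<dots> = (\<Oplus>g\<in>carrier G. \<Oplus>i\<in>{1..m}. B g z \<otimes> (B g (x i) \<otimes> y i))"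
    using finite_carrier xc yc z B_closed by (intro finsum_swap) auto
  also have "\<dots> = z"
  proof (rule sum_delta[OF _ z])
    fix g assume g: "g \<in> carrier G"
    have "(\<Oplus>i\<in>{1..m}. B g z \<otimes> (B g (x i) \<otimes> y i)) = B g z \<otimes> (\<Oplus>i\<in>{1..m}. B g (x i) \<otimes> y i)"
      using g xc yc z B_closed by (intro finsum_rdistr[symmetric]) auto
    also have "\<dots> = (if g \<in> gobjects G then z \<otimes> \<epsilon> g else \<zero>)"
      using galois'[OF g] B_closed[OF g z] B_object[OF _ z, of g] B_rng[OF g z] rng_object[of g] by auto
    finally show "(\<Oplus>i\<in>{1..m}. B g z \<otimes> (B g (x i) \<otimes> y i)) = (if g \<in> gobjects G then z \<otimes> \<epsilon> g else \<zero>)" .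
  qed
  finally show ?thesis .
qed

lemma xy_one: "(\<Oplus>i\<in>{1..m}. x i \<otimes> y i) = \<one>"
proof -
  let ?s = "\<Oplus>i\<in>{1..m}. x i \<otimes> y i"
  have s: "?s \<in> carrier R" using xc yc by (auto intro!: finsum_closed)
  have "?s \<otimes> \<epsilon> e = \<epsilon> e" if e: "e \<in> gobjects G" for e
  proof -
    have "?s \<otimes> \<epsilon> e = (\<Oplus>i\<in>{1..m}. x i \<otimes> y i \<otimes> \<epsilon> e)"
      using xc yc \<epsilon>_closed e by (intro finsum_ldistr) auto
    also have "\<dots> = (\<Oplus>i\<in>{1..m}. x i \<otimes> B e (y i))"
      using xc yc \<epsilon>_closed e B_object by (intro finsum_ring_cong) (auto simp: m_assoc)
    finally show ?thesis using galois[of e] object_closed e by simp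
  qed
  then have "(\<Oplus>e\<in>gobjects G. ?s \<otimes> \<epsilon> e) = (\<Oplus>e\<in>gobjects G. \<epsilon> e)"
    using \<epsilon>_closed by (intro finsum_ring_cong) auto
  then show ?thesis using sum_components[OF s] \<epsilon>_sum by simp
qed

text \<open>In effect \<open>\<Sum> x j \<otimes> y j\<close> commutes with \<open>R\<close> in the
  tensor square over the invariants. Expand \<open>s \<otimes> x j\<close> in the left dual basis,
  move the resulting traces through \<open>w\<close> and into the argument of \<open>B h\<close>,
  and collapse the inner sum by the right dual basis. The traces pass because they are invariant and
  \<open>w\<close> commutes with invariants.\<close>

lemma galois_twist:
  assumes h: "h \<in> carrier G" and w: "w \<in> carrier R" and s: "s \<in> carrier R"
    and w_comm: "\<And>r. r \<in> invariants (carrier G) \<Longrightarrow> r \<otimes> w = w \<otimes> r"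
  shows "s \<otimes> (\<Oplus>j\<in>{1..m}. x j \<otimes> w \<otimes> B h (y j)) = (\<Oplus>j\<in>{1..m}. x j \<otimes> w \<otimes> B h (y j \<otimes> s))"
proof -
  have t: "tr (y l \<otimes> (s \<otimes> x j)) \<in> carrier R" if "l \<in> {1..m}" "j \<in> {1..m}" for l j
    using that xc yc s tr_closed by auto
  have "s \<otimes> (\<Oplus>j\<in>{1..m}. x j \<otimes> w \<otimes> B h (y j)) = (\<Oplus>j\<in>{1..m}. s \<otimes> (x j \<otimes> w \<otimes> B h (y j)))"
    using s xc yc w h B_closed by (intro finsum_rdistr) auto
  also have "\<dots> = (\<Oplus>j\<in>{1..m}. \<Oplus>l\<in>{1..m}. x l \<otimes> w \<otimes> (tr (y l \<otimes> (s \<otimes> x j)) \<otimes> B h (y j)))"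
  proof (rule finsum_ring_cong)
    fix j assume j: "j \<in> {1..m}"
    have wy: "w \<otimes> B h (y j) \<in> carrier R" using w h B_closed yc j by simp
    have "s \<otimes> (x j \<otimes> w \<otimes> B h (y j)) = (s \<otimes> x j) \<otimes> (w \<otimes> B h (y j))"
      using s xc yc w h B_closed j by (simp add: m_assoc)
    also have "\<dots> = (\<Oplus>l\<in>{1..m}. x l \<otimes> tr (y l \<otimes> (s \<otimes> x j))) \<otimes> (w \<otimes> B h (y j))"
      using dual_basis_left[of "s \<otimes> x j"] s xc j by simp
    also have "\<dots> = (\<Oplus>l\<in>{1..m}. x l \<otimes> tr (y l \<otimes> (s \<otimes> x j)) \<otimes> (w \<otimes> B h (y j)))"
      using wy xc t j by (intro finsum_ldistr) auto
    also have "\<dots> = (\<Oplus>l\<in>{1..m}. x l \<otimes> w \<otimes> (tr (y l \<otimes> (s \<otimes> x j)) \<otimes> B h (y j)))"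
    proof (rule finsum_ring_cong)
      fix l assume l: "l \<in> {1..m}"
      let ?t = "tr (y l \<otimes> (s \<otimes> x j))"
      have "?t \<otimes> w = w \<otimes> ?t" using w_comm[OF tr_invariant] s xc yc l j by simp
      then have "?t \<otimes> (w \<otimes> B h (y j)) = w \<otimes> (?t \<otimes> B h (y j))"
        using t[OF l j] w B_closed[OF h yc[OF j]] by (simp add: m_assoc[symmetric])
      then show "x l \<otimes> ?t \<otimes> (w \<otimes> B h (y j)) = x l \<otimes> w \<otimes> (?t \<otimes> B h (y j))"
        using t[OF l j] w B_closed[OF h yc[OF j]] xc[OF l] by (simp add: m_assoc)
    qed (use w B_closed h yc xc t j in auto)
    finally show "s \<otimes> (x j \<otimes> w \<otimes> B h (y j))
      = (\<Oplus>l\<in>{1..m}. x l \<otimes> w \<otimes> (tr (y l \<otimes> (s \<otimes> x j)) \<otimes> B h (y j)))" .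
  qed (use w B_closed h yc xc t in \<open>auto intro!: finsum_closed\<close>)
  also have "\<dots> = (\<Oplus>l\<in>{1..m}. \<Oplus>j\<in>{1..m}. x l \<otimes> w \<otimes> (tr (y l \<otimes> (s \<otimes> x j)) \<otimes> B h (y j)))"
    using w B_closed h yc xc t by (intro finsum_swap) auto
  also have "\<dots> = (\<Oplus>l\<in>{1..m}. x l \<otimes> w \<otimes> B h (y l \<otimes> s))"
  proof (rule finsum_ring_cong)
    fix l assume l: "l \<in> {1..m}"
    have inv: "tr (y l \<otimes> (s \<otimes> x j)) \<otimes> B h (y j) = B h (tr (y l \<otimes> (s \<otimes> x j)) \<otimes> y j)" if j: "j \<in> {1..m}" for j
    proof -
      let ?t = "tr (y l \<otimes> (s \<otimes> x j))"
      have "B h (?t \<otimes> y j) = (?t \<otimes> \<epsilon> (grng G h)) \<otimes> B h (y j)"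
        using B_mult[OF h t[OF l j] yc[OF j]] invariantsD[OF tr_invariant h] s xc yc l j by simp
      also have "\<dots> = ?t \<otimes> B h (y j)"
        using B_rng'[OF h yc[OF j]] t[OF l j] \<epsilon>_rng_closed[OF h] B_closed[OF h yc[OF j]] by (simp add: m_assoc)
      finally show ?thesis ..
    qed
    have "(\<Oplus>j\<in>{1..m}. x l \<otimes> w \<otimes> (tr (y l \<otimes> (s \<otimes> x j)) \<otimes> B h (y j)))
      = (\<Oplus>j\<in>{1..m}. x l \<otimes> w \<otimes> B h (tr (y l \<otimes> (s \<otimes> x j)) \<otimes> y j))"
      using inv w B_closed h yc xc t l by (intro finsum_ring_cong) auto
    also have "\<dots> = x l \<otimes> w \<otimes> (\<Oplus>j\<in>{1..m}. B h (tr (y l \<otimes> (s \<otimes> x j)) \<otimes> y j))"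
      using w B_closed h yc xc t l by (intro finsum_rdistr[symmetric]) auto
    also have "(\<Oplus>j\<in>{1..m}. B h (tr (y l \<otimes> (s \<otimes> x j)) \<otimes> y j))
      = B h (\<Oplus>j\<in>{1..m}. tr (y l \<otimes> (s \<otimes> x j)) \<otimes> y j)"
      using h yc t l by (intro B_finsum[symmetric]) auto
    also have "(\<Oplus>j\<in>{1..m}. tr (y l \<otimes> (s \<otimes> x j)) \<otimes> y j) = (\<Oplus>j\<in>{1..m}. tr ((y l \<otimes> s) \<otimes> x j) \<otimes> y j)"
      using yc xc s l tr_closed by (intro finsum_ring_cong) (auto simp: m_assoc)
    also have "\<dots> = y l \<otimes> s" using dual_basis_right yc[OF l] s by simp
    finally show "(\<Oplus>j\<in>{1..m}. x l \<otimes> w \<otimes> (tr (y l \<otimes> (s \<otimes> x j)) \<otimes> B h (y j))) = x l \<otimes> w \<otimes> B h (y l \<otimes> s)" .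
  qed (use w B_closed h yc xc s in auto)
  finally show ?thesis .
qed

text \<open>Transitivity of separability: the two elements compose to
  \<open>\<Sum> x j a i \<otimes> b i y j\<close>. The inner sum \<open>p r\<close> commutes with
  all invariants, hence is an admissible \<open>w\<close> in \<open>galois_twist\<close>, and the
  \<open>b i\<close> leave \<open>B h\<close> unchanged because they are invariant
  themselves.\<close>

lemma separable_action:
  "separable_action G R \<epsilon> B ({1..m} \<times> {1..n}) (\<lambda>(j, i). x j \<otimes> a i) (\<lambda>(j, i). b i \<otimes> y j)"
proof
  show "finite ({1..m} \<times> {1..n})" by simp
  show "(\<lambda>(j, i). x j \<otimes> a i) \<in> {1..m} \<times> {1..n} \<rightarrow> carrier R"
    and "(\<lambda>(j, i). b i \<otimes> y j) \<in> {1..m} \<times> {1..n} \<rightarrow> carrier R"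
    using xc yc ac bc by auto
  define p where "p r = (\<Oplus>i\<in>{1..n}. a i \<otimes> r \<otimes> b i)" for r
  have p_closed: "p r \<in> carrier R" if "r \<in> carrier R" for r
    unfolding p_def using that ac bc by (auto intro!: finsum_closed)
  have sum_uv: "(\<Oplus>k\<in>{1..m} \<times> {1..n}. (\<lambda>(j, i). x j \<otimes> a i) k \<otimes> r \<otimes> B h ((\<lambda>(j, i). b i \<otimes> y j) k))
    = (\<Oplus>j\<in>{1..m}. x j \<otimes> p r \<otimes> B h (y j))"
    if h: "h \<in> carrier G" and r: "r \<in> carrier R" for h r
  proof -
    have "(\<Oplus>k\<in>{1..m} \<times> {1..n}. (\<lambda>(j, i). x j \<otimes> a i) k \<otimes> r \<otimes> B h ((\<lambda>(j, i). b i \<otimes> y j) k))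
      = (\<Oplus>j\<in>{1..m}. \<Oplus>i\<in>{1..n}. x j \<otimes> a i \<otimes> r \<otimes> B h (b i \<otimes> y j))"
      using xc yc ac bc B_closed h r by (subst finsum_Times) auto
    also have "\<dots> = (\<Oplus>j\<in>{1..m}. x j \<otimes> p r \<otimes> B h (y j))"
    proof (rule finsum_ring_cong)
      fix j assume j: "j \<in> {1..m}"
      have "(\<Oplus>i\<in>{1..n}. x j \<otimes> a i \<otimes> r \<otimes> B h (b i \<otimes> y j))
        = (\<Oplus>i\<in>{1..n}. x j \<otimes> (a i \<otimes> r \<otimes> b i \<otimes> B h (y j)))"
      proof (rule finsum_ring_cong)
        fix i assume i: "i \<in> {1..n}"
        have bi: "b i \<in> invariants (carrier G)" using b i by blast
        have "B h (b i \<otimes> y j) = b i \<otimes> (\<epsilon> (grng G h) \<otimes> B h (y j))"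
          using B_mult[OF h bc[OF i] yc[OF j]] invariantsD[OF bi h] bc[OF i] \<epsilon>_rng_closed[OF h]
            B_closed[OF h yc[OF j]] by (simp add: m_assoc)
        also have "\<dots> = b i \<otimes> B h (y j)" using B_rng'[OF h yc[OF j]] by simp
        finally show "x j \<otimes> a i \<otimes> r \<otimes> B h (b i \<otimes> y j) = x j \<otimes> (a i \<otimes> r \<otimes> b i \<otimes> B h (y j))"
          using xc[OF j] ac[OF i] bc[OF i] r B_closed[OF h yc[OF j]] by (simp add: m_assoc)
      qed (use xc yc ac bc B_closed h r j in auto)
      also have "\<dots> = x j \<otimes> (\<Oplus>i\<in>{1..n}. a i \<otimes> r \<otimes> b i \<otimes> B h (y j))"
        using xc yc ac bc B_closed h r j by (intro finsum_rdistr[symmetric]) auto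
      also have "(\<Oplus>i\<in>{1..n}. a i \<otimes> r \<otimes> b i \<otimes> B h (y j)) = p r \<otimes> B h (y j)"
        unfolding p_def using xc yc ac bc B_closed h r j by (intro finsum_ldistr[symmetric]) auto
      finally show "(\<Oplus>i\<in>{1..n}. x j \<otimes> a i \<otimes> r \<otimes> B h (b i \<otimes> y j)) = x j \<otimes> p r \<otimes> B h (y j)"
        using xc[OF j] p_closed[OF r] B_closed[OF h yc[OF j]] by (simp add: m_assoc)
    qed (use xc yc p_closed B_closed h r in auto)
    finally show ?thesis .
  qed
  show "s \<otimes> (\<Oplus>k\<in>{1..m} \<times> {1..n}. (\<lambda>(j, i). x j \<otimes> a i) k \<otimes> r \<otimes> B h ((\<lambda>(j, i). b i \<otimes> y j) k))
    = (\<Oplus>k\<in>{1..m} \<times> {1..n}. (\<lambda>(j, i). x j \<otimes> a i) k \<otimes> r \<otimes> B h ((\<lambda>(j, i). b i \<otimes> y j) k)) \<otimes> B h s"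
    if h: "h \<in> carrier G" and r: "r \<in> carrier R" and s: "s \<in> carrier R" for h r s
  proof -
    have "q \<otimes> p r = p r \<otimes> q" if "q \<in> invariants (carrier G)" for q
      using ab_comm[OF that r] by (simp add: p_def)
    then have "s \<otimes> (\<Oplus>j\<in>{1..m}. x j \<otimes> p r \<otimes> B h (y j)) = (\<Oplus>j\<in>{1..m}. x j \<otimes> p r \<otimes> B h (y j \<otimes> s))"
      using galois_twist[OF h p_closed[OF r] s] by simp
    also have "\<dots> = (\<Oplus>j\<in>{1..m}. x j \<otimes> p r \<otimes> B h (y j) \<otimes> B h s)"
      using B_mult[OF h] B_closed h p_closed[OF r] s xc yc by (intro finsum_ring_cong) (auto simp: m_assoc)
    also have "\<dots> = (\<Oplus>j\<in>{1..m}. x j \<otimes> p r \<otimes> B h (y j)) \<otimes> B h s"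
      using B_closed h p_closed[OF r] s xc yc by (intro finsum_ldistr[symmetric]) auto
    finally show ?thesis unfolding sum_uv[OF h r] .
  qed
  have "(\<Oplus>k\<in>{1..m} \<times> {1..n}. (\<lambda>(j, i). x j \<otimes> a i) k \<otimes> (\<lambda>(j, i). b i \<otimes> y j) k)
    = (\<Oplus>j\<in>{1..m}. \<Oplus>i\<in>{1..n}. x j \<otimes> a i \<otimes> (b i \<otimes> y j))"
    using xc yc ac bc by (subst finsum_Times) auto
  also have "\<dots> = (\<Oplus>j\<in>{1..m}. x j \<otimes> y j)"
  proof (rule finsum_ring_cong)
    fix j assume j: "j \<in> {1..m}"
    have "(\<Oplus>i\<in>{1..n}. x j \<otimes> a i \<otimes> (b i \<otimes> y j)) = (\<Oplus>i\<in>{1..n}. x j \<otimes> (a i \<otimes> b i \<otimes> y j))"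
      using xc yc ac bc j by (intro finsum_ring_cong) (auto simp: m_assoc)
    also have "\<dots> = x j \<otimes> (\<Oplus>i\<in>{1..n}. a i \<otimes> b i \<otimes> y j)"
      using xc yc ac bc j by (intro finsum_rdistr[symmetric]) auto
    also have "(\<Oplus>i\<in>{1..n}. a i \<otimes> b i \<otimes> y j) = (\<Oplus>i\<in>{1..n}. a i \<otimes> b i) \<otimes> y j"
      using xc yc ac bc j by (intro finsum_ldistr[symmetric]) auto
    finally show "(\<Oplus>i\<in>{1..n}. x j \<otimes> a i \<otimes> (b i \<otimes> y j)) = x j \<otimes> y j"
      using ab_one yc[OF j] by simp
  qed (use xc yc in auto)
  finally show "(\<Oplus>k\<in>{1..m} \<times> {1..n}. (\<lambda>(j, i). x j \<otimes> a i) k \<otimes> (\<lambda>(j, i). b i \<otimes> y j) k) = \<one>"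
    using xy_one by simp
qed

end

section \<open>Bicentralizers and sums of products\<close>

context ring
begin

lemma sums_of_productsI:
  fixes n :: nat
  assumes "s \<in> {1..n} \<rightarrow> S" "t \<in> {1..n} \<rightarrow> T" "x = (\<Oplus>i\<in>{1..n}. s i \<otimes> t i)"
  shows "x \<in> sums_of_products R S T"
  unfolding sums_of_products_def mem_Collect_eq
  by (intro exI[of _ n] exI[of _ s] exI[of _ t] conjI assms)

lemma sums_of_products_closed:
  assumes "S \<subseteq> carrier R" "T \<subseteq> carrier R" "x \<in> sums_of_products R S T"
  shows "x \<in> carrier R"
proof -
  obtain n s t where x: "x = (\<Oplus>i\<in>{1..n::nat}. s i \<otimes> t i)" "s \<in> {1..n} \<rightarrow> S" "t \<in> {1..n} \<rightarrow> T"
    using assms(3) unfolding sums_of_products_def by blast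
  have "s i \<in> carrier R" "t i \<in> carrier R" if "i \<in> {1..n}" for i
    using x(2,3) assms(1,2) that by blast+
  then show ?thesis unfolding x(1) by (intro finsum_closed) simp
qed

lemma sums_of_products_incl:
  assumes "s \<in> S" "t \<in> T" "s \<in> carrier R" "t \<in> carrier R"
  shows "s \<otimes> t \<in> sums_of_products R S T"
proof (rule sums_of_productsI)
  show "(\<lambda>_. s) \<in> {1..1} \<rightarrow> S" "(\<lambda>_. t) \<in> {1..1} \<rightarrow> T" using assms by simp_all
  have "{1..1::nat} = insert 1 {}" by simp
  then show "s \<otimes> t = (\<Oplus>i\<in>{1..1::nat}. s \<otimes> t)"
    using assms(3,4) by (simp only: finsum_insert finite.emptyI empty_iff finsum_empty) simp
qed

lemma sums_of_products_add:
  assumes ST: "S \<subseteq> carrier R" "T \<subseteq> carrier R"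
    and x: "x \<in> sums_of_products R S T" and y: "y \<in> sums_of_products R S T"
  shows "x \<oplus> y \<in> sums_of_products R S T"
proof -
  obtain n s t where x: "x = (\<Oplus>i\<in>{1..n::nat}. s i \<otimes> t i)" "s \<in> {1..n} \<rightarrow> S" "t \<in> {1..n} \<rightarrow> T"
    using x unfolding sums_of_products_def by blast
  obtain m s' t' where y: "y = (\<Oplus>i\<in>{1..m::nat}. s' i \<otimes> t' i)" "s' \<in> {1..m} \<rightarrow> S" "t' \<in> {1..m} \<rightarrow> T"
    using y unfolding sums_of_products_def by blast
  define f where "f i = (if i \<le> n then s i else s' (i - n))" for i
  define g where "g i = (if i \<le> n then t i else t' (i - n))" for i
  have "f i \<in> S \<and> g i \<in> T" if i: "i \<in> {1..n + m}" for i
  proof (cases "i \<le> n")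
    case True
    then have "i \<in> {1..n}" using i by simp
    then show ?thesis using x(2,3) True by (auto simp: f_def g_def)
  next
    case False
    then have "i - n \<in> {1..m}" using i by auto
    then show ?thesis using y(2,3) False by (auto simp: f_def g_def)
  qed
  then have fS: "f \<in> {1..n + m} \<rightarrow> S" and gT: "g \<in> {1..n + m} \<rightarrow> T" by blast+
  have fgc: "f i \<otimes> g i \<in> carrier R" if "i \<in> {1..n + m}" for i
    using fS gT ST that by blast
  have "(\<Oplus>i\<in>{1..n + m}. f i \<otimes> g i) = (\<Oplus>i\<in>{1..n} \<union> {n + 1..n + m}. f i \<otimes> g i)"
    by (rule arg_cong[where f = "finsum R _"]) auto
  also have "\<dots> = (\<Oplus>i\<in>{1..n}. f i \<otimes> g i) \<oplus> (\<Oplus>i\<in>{n + 1..n + m}. f i \<otimes> g i)"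
    using fgc by (intro finsum_Un_disjoint) auto
  also have "(\<Oplus>i\<in>{1..n}. f i \<otimes> g i) = x"
    unfolding x(1) using x(2,3) ST by (intro finsum_ring_cong) (auto simp: f_def g_def Pi_iff subset_iff)
  also have "(\<Oplus>i\<in>{n + 1..n + m}. f i \<otimes> g i) = (\<Oplus>i\<in>{1..m}. f (n + i) \<otimes> g (n + i))"
  proof -
    have im: "{n + 1..n + m} = (\<lambda>i. n + i) ` {1..m}" using image_add_atLeastAtMost[of n 1 m] by simp
    show ?thesis unfolding im using fgc by (intro finsum_reindex) (auto simp: im[symmetric])
  qed
  also have "\<dots> = y"
    unfolding y(1) using y(2,3) ST by (intro finsum_ring_cong) (auto simp: f_def g_def Pi_iff subset_iff)
  finally show ?thesis using fS gT by (intro sums_of_productsI[of f "n + m" S g T]) simp_all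
qed

lemma sums_of_products_smult:
  assumes S: "S \<subseteq> carrier R" and c: "c \<in> ring_center R"
    and x: "x \<in> sums_of_products R S (ring_center R)"
  shows "c \<otimes> x \<in> sums_of_products R S (ring_center R)"
proof -
  obtain n s t where x: "x = (\<Oplus>i\<in>{1..n::nat}. s i \<otimes> t i)" "s \<in> {1..n} \<rightarrow> S" "t \<in> {1..n} \<rightarrow> ring_center R"
    using x unfolding sums_of_products_def by blast
  have cl: "s i \<in> carrier R" "t i \<in> carrier R" if "i \<in> {1..n}" for i
    using x(2,3) S center_closed that by blast+
  note cc = center_closed[OF c]
  have "c \<otimes> x = (\<Oplus>i\<in>{1..n}. c \<otimes> (s i \<otimes> t i))"
    unfolding x(1) using cl cc by (intro finsum_rdistr) auto
  also have "\<dots> = (\<Oplus>i\<in>{1..n}. s i \<otimes> (c \<otimes> t i))"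
    using cl cc center_lcomm[OF c] by (intro finsum_ring_cong) auto
  finally show ?thesis
    using x(2,3) center_mult[OF c]
    by (intro sums_of_productsI[of s n S "\<lambda>i. c \<otimes> t i"]) (simp_all add: Pi_iff)
qed

lemma sums_of_products_minus:
  assumes S: "S \<subseteq> carrier R"
    and x: "x \<in> sums_of_products R S (ring_center R)" and y: "y \<in> sums_of_products R S (ring_center R)"
  shows "x \<ominus> y \<in> sums_of_products R S (ring_center R)"
proof -
  have C: "ring_center R \<subseteq> carrier R" using center_closed by blast
  have "(\<ominus> \<one>) \<otimes> y \<in> sums_of_products R S (ring_center R)"
    using sums_of_products_smult[OF S center_uminus[OF center_one] y] .
  then show ?thesis
    using sums_of_products_add[OF S C x] sums_of_products_closed[OF S C y] by (simp add: a_minus_def l_minus)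
qed

text \<open>Central factors impose no commutation condition, and \<open>\<one>\<close> is among
  them. So the second map of the equivalence always factors through the first; the Galois and
  separability assumptions serve the converse.\<close>

lemma centralizer_sums_of_products:
  assumes S: "S \<subseteq> carrier R"
  shows "ring_centralizer R (sums_of_products R S (ring_center R)) = ring_centralizer R S"
proof
  show "ring_centralizer R (sums_of_products R S (ring_center R)) \<subseteq> ring_centralizer R S"
  proof
    fix r assume r: "r \<in> ring_centralizer R (sums_of_products R S (ring_center R))"
    have "s \<in> sums_of_products R S (ring_center R)" if "s \<in> S" for s
      using sums_of_products_incl[of s S \<one> "ring_center R"] that S center_one by auto
    then show "r \<in> ring_centralizer R S" using r unfolding ring_centralizer_def by blast
  qed
  show "ring_centralizer R S \<subseteq> ring_centralizer R (sums_of_products R S (ring_center R))"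
  proof
    fix r assume "r \<in> ring_centralizer R S"
    then have r: "r \<in> carrier R" and rs: "\<And>s. s \<in> S \<Longrightarrow> r \<otimes> s = s \<otimes> r"
      unfolding ring_centralizer_def by blast+
    have "r \<otimes> x = x \<otimes> r" if x: "x \<in> sums_of_products R S (ring_center R)" for x
    proof -
      obtain n s t where x: "x = (\<Oplus>i\<in>{1..n::nat}. s i \<otimes> t i)" "s \<in> {1..n} \<rightarrow> S" "t \<in> {1..n} \<rightarrow> ring_center R"
        using x unfolding sums_of_products_def by blast
      have cl: "s i \<in> carrier R" "t i \<in> carrier R" if "i \<in> {1..n}" for i
        using x(2,3) S center_closed that by blast+
      have "r \<otimes> x = (\<Oplus>i\<in>{1..n}. r \<otimes> (s i \<otimes> t i))"
        unfolding x(1) using cl r by (intro finsum_rdistr) auto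
      also have "\<dots> = (\<Oplus>i\<in>{1..n}. (s i \<otimes> t i) \<otimes> r)"
      proof (rule finsum_ring_cong)
        fix i assume i: "i \<in> {1..n}"
        have si: "s i \<in> S" and ti: "t i \<in> ring_center R" using x i by blast+
        show "r \<otimes> (s i \<otimes> t i) = (s i \<otimes> t i) \<otimes> r"
          using rs[OF si] center_comm[OF ti r] r cl[OF i] by (metis m_assoc)
      qed (use cl r in auto)
      also have "\<dots> = x \<otimes> r"
        unfolding x(1) using cl r by (intro finsum_ldistr[symmetric]) auto
      finally show ?thesis .
    qed
    then show "r \<in> ring_centralizer R (sums_of_products R S (ring_center R))"
      using r unfolding ring_centralizer_def by blast
  qed
qed

abbreviation bicentralizer :: "'a set \<Rightarrow> 'a set" where
  "bicentralizer S \<equiv> ring_centralizer R (ring_centralizer R S)"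

text \<open>Needed since the inertia argument has to apply to all central multiples of an element of
  the double centralizer, not just to the element.\<close>

lemma center_bicentralizer_mult:
  assumes "c \<in> ring_center R" "s \<in> bicentralizer S"
  shows "c \<otimes> s \<in> bicentralizer S"
proof -
  note cc = center_closed[OF assms(1)]
  have s: "s \<in> carrier R" "\<And>w. w \<in> ring_centralizer R S \<Longrightarrow> s \<otimes> w = w \<otimes> s"
    using assms(2) unfolding ring_centralizer_def by auto
  have "(c \<otimes> s) \<otimes> w = w \<otimes> (c \<otimes> s)" if w: "w \<in> ring_centralizer R S" for w
  proof -
    have wc: "w \<in> carrier R" using w unfolding ring_centralizer_def by simp
    show ?thesis using s(2)[OF w] center_lcomm[OF assms(1) wc s(1)] s(1) wc cc by (simp add: m_assoc)
  qed
  then show ?thesis using s cc unfolding ring_centralizer_def[of R "ring_centralizer R S"] by auto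
qed

end

context ideal
begin

lemma uminus_mem_ideal: "x \<in> I \<Longrightarrow> \<ominus> x \<in> I"
  using uminus_mem ring_axioms by blast

lemma cong_sym: "x \<ominus> y \<in> I \<Longrightarrow> x \<in> carrier R \<Longrightarrow> y \<in> carrier R \<Longrightarrow> y \<ominus> x \<in> I"
proof -
  assume *: "x \<ominus> y \<in> I" "x \<in> carrier R" "y \<in> carrier R"
  have "y \<ominus> x = \<ominus> (x \<ominus> y)" using * by algebra
  then show ?thesis using * uminus_mem_ideal by simp
qed

lemma cong_trans:
  "x \<ominus> y \<in> I \<Longrightarrow> y \<ominus> z \<in> I \<Longrightarrow> x \<in> carrier R \<Longrightarrow> y \<in> carrier R \<Longrightarrow> z \<in> carrier R \<Longrightarrow> x \<ominus> z \<in> I"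
proof -
  assume *: "x \<ominus> y \<in> I" "y \<ominus> z \<in> I" "x \<in> carrier R" "y \<in> carrier R" "z \<in> carrier R"
  have "x \<ominus> z = (x \<ominus> y) \<oplus> (y \<ominus> z)" using * by algebra
  then show ?thesis using * add_mem by simp
qed

end

lemma (in maximalideal) one_notin: "\<one> \<notin> I"
  using I_notcarr one_imp_carrier by blast

text \<open>As \<open>c\<close> is central, the elements that \<open>c\<close> multiplies into
  \<open>I\<close> form a two-sided ideal containing \<open>I\<close>; by maximality it is
  \<open>I\<close> or everything, and in the latter case it contains \<open>\<one>\<close>.
  Consequently central elements outside \<open>I\<close> can be cancelled modulo \<open>I\<close>
  and multiplied with each other.\<close>

lemma (in maximalideal) central_prime:
  assumes c: "c \<in> ring_center R" and d: "d \<in> carrier R" and cd: "c \<otimes> d \<in> I"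
  shows "c \<in> I \<or> d \<in> I"
proof -
  note cc = center_closed[OF c]
  let ?J = "{x \<in> carrier R. c \<otimes> x \<in> I}"
  have "ideal ?J R"
  proof (rule idealI)
    show "subgroup ?J (add_monoid R)"
      by (rule subgroup.intro)
        (use cc add_mem uminus_mem_ideal in \<open>auto simp: r_distr r_minus a_inv_def[symmetric] additive_subgroup.zero_closed[OF is_additive_subgroup]\<close>)
  next
    fix a x assume a: "a \<in> ?J" and x: "x \<in> carrier R"
    show "x \<otimes> a \<in> ?J" using a x center_lcomm[OF c x, of a] I_l_closed[of "c \<otimes> a" x] by auto
    show "a \<otimes> x \<in> ?J" using a x cc I_r_closed[of "c \<otimes> a" x] by (auto simp: m_assoc)
  qed (rule ring_axioms)
  moreover have "I \<subseteq> ?J" using cc I_l_closed Icarr by auto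
  ultimately have "?J = I \<or> ?J = carrier R" by (intro I_maximal) auto
  then show ?thesis
  proof
    assume "?J = carrier R"
    then have "\<one> \<in> ?J" by simp
    then show ?thesis using cc by simp
  next
    assume "?J = I"
    then show ?thesis using d cd by blast
  qed
qed

context separable_action
begin

lemma uc: "k \<in> K \<Longrightarrow> u k \<in> carrier R" and vc: "k \<in> K \<Longrightarrow> v k \<in> carrier R"
  using K by blast+

definition twist :: "'g \<Rightarrow> 'a \<Rightarrow> 'a" where
  "twist h n = (\<Oplus>k\<in>K. u k \<otimes> n \<otimes> B h (v k))"

text \<open>The projection of \<open>R\<close> onto its centre that comes from separability. Its
  component at an object \<open>e\<close> is \<open>twist e n\<close>.\<close>

definition P :: "'a \<Rightarrow> 'a" where
  "P n = (\<Oplus>k\<in>K. u k \<otimes> n \<otimes> v k)"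

end

section \<open>The inertia group\<close>

context separable_action
begin

lemma twist_closed: "h \<in> carrier G \<Longrightarrow> n \<in> carrier R \<Longrightarrow> twist h n \<in> carrier R"
  unfolding twist_def using uc vc B_closed by (auto intro!: finsum_closed)

lemma twist_comm: "h \<in> carrier G \<Longrightarrow> n \<in> carrier R \<Longrightarrow> s \<in> carrier R \<Longrightarrow> s \<otimes> twist h n = twist h n \<otimes> B h s"
  unfolding twist_def by (rule uv_twist)

lemma twist_rng:
  assumes "h \<in> carrier G" "n \<in> carrier R"
  shows "twist h n \<otimes> \<epsilon> (grng G h) = twist h n"
proof -
  have "twist h n \<otimes> \<epsilon> (grng G h) = (\<Oplus>k\<in>K. u k \<otimes> n \<otimes> B h (v k) \<otimes> \<epsilon> (grng G h))"
    unfolding twist_def using K(1) uc vc B_closed assms \<epsilon>_rng_closed by (intro finsum_ldistr) auto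
  also have "\<dots> = twist h n"
    unfolding twist_def using uc vc B_closed B_rng assms \<epsilon>_rng_closed
    by (intro finsum_ring_cong) (auto simp: m_assoc)
  finally show ?thesis .
qed

lemma P_closed: "n \<in> carrier R \<Longrightarrow> P n \<in> carrier R"
  unfolding P_def using uc vc by (auto intro!: finsum_closed)

lemma P_one: "P \<one> = \<one>"
  using uv_one uc vc finsum_ring_cong[of K "\<lambda>k. u k \<otimes> v k" "\<lambda>k. u k \<otimes> \<one> \<otimes> v k"] by (simp add: P_def)

lemma P_add:
  assumes "x \<in> carrier R" "y \<in> carrier R"
  shows "P (x \<oplus> y) = P x \<oplus> P y"
proof -
  have "P (x \<oplus> y) = (\<Oplus>k\<in>K. u k \<otimes> x \<otimes> v k \<oplus> u k \<otimes> y \<otimes> v k)"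
    unfolding P_def using uc vc assms by (intro finsum_ring_cong) (auto simp: l_distr r_distr)
  also have "\<dots> = P x \<oplus> P y"
    unfolding P_def using uc vc assms by (intro finsum_addf) auto
  finally show ?thesis .
qed

lemma P_smult:
  assumes c: "c \<in> ring_center R" and x: "x \<in> carrier R"
  shows "P (c \<otimes> x) = c \<otimes> P x"
proof -
  note cc = center_closed[OF c]
  have "P (c \<otimes> x) = (\<Oplus>k\<in>K. c \<otimes> (u k \<otimes> x \<otimes> v k))"
    unfolding P_def using uc vc x cc center_lcomm[OF c] by (intro finsum_ring_cong) (auto simp: m_assoc)
  also have "\<dots> = c \<otimes> P x"
    unfolding P_def using uc vc x cc K(1) by (intro finsum_rdistr[symmetric]) auto
  finally show ?thesis .
qed

lemma P_object:
  assumes e: "e \<in> gobjects G" and n: "n \<in> carrier R"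
  shows "twist e n = P n \<otimes> \<epsilon> e"
proof -
  have "P n \<otimes> \<epsilon> e = (\<Oplus>k\<in>K. u k \<otimes> n \<otimes> v k \<otimes> \<epsilon> e)"
    unfolding P_def using uc vc n K(1) \<epsilon>_closed[OF e] by (intro finsum_ldistr) auto
  also have "\<dots> = twist e n"
    unfolding twist_def using uc vc n \<epsilon>_closed[OF e] B_object[OF e]
    by (intro finsum_ring_cong) (auto simp: m_assoc)
  finally show ?thesis ..
qed

text \<open>On the component at \<open>e\<close> the twisted commutation rule loses its twist,
  because \<open>B e\<close> is multiplication by \<open>\<epsilon> e\<close>; the components then
  add up.\<close>

lemma P_center:
  assumes n: "n \<in> carrier R"
  shows "P n \<in> ring_center R"
proof (rule center_memI)
  show "P n \<in> carrier R" using n by (rule P_closed)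
  fix r assume r: "r \<in> carrier R"
  have Pn: "P n \<in> carrier R" using n by (rule P_closed)
  have "(r \<otimes> P n) \<otimes> \<epsilon> e = (P n \<otimes> r) \<otimes> \<epsilon> e" if e: "e \<in> gobjects G" for e
  proof -
    note ec = \<epsilon>_closed[OF e]
    have "(r \<otimes> P n) \<otimes> \<epsilon> e = r \<otimes> twist e n" using P_object[OF e n] r Pn ec by (simp add: m_assoc)
    also have "\<dots> = (P n \<otimes> \<epsilon> e) \<otimes> (r \<otimes> \<epsilon> e)"
      using twist_comm[OF object_closed[OF e] n r] P_object[OF e n] B_object[OF e r] by simp
    also have "\<dots> = P n \<otimes> (r \<otimes> (\<epsilon> e \<otimes> \<epsilon> e))"
      using r Pn ec center_lcomm[OF \<epsilon>_center[OF e] r ec] by (simp add: m_assoc)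
    also have "\<dots> = (P n \<otimes> r) \<otimes> \<epsilon> e" using \<epsilon>_idem[OF e] r Pn ec by (simp add: m_assoc)
    finally show ?thesis .
  qed
  then have "(\<Oplus>e\<in>gobjects G. (r \<otimes> P n) \<otimes> \<epsilon> e) = (\<Oplus>e\<in>gobjects G. (P n \<otimes> r) \<otimes> \<epsilon> e)"
    using r Pn \<epsilon>_closed by (intro finsum_ring_cong) auto
  then show "P n \<otimes> r = r \<otimes> P n" using sum_components r Pn by simp
qed

lemma P_ideal: "ideal J R \<Longrightarrow> x \<in> J \<Longrightarrow> P x \<in> J"
  unfolding P_def using uc vc by (intro ideal.finsum_mem) (auto simp: ideal.I_l_closed ideal.I_r_closed)

text \<open>A central lift of \<open>z\<close> is \<open>P z\<close>: writing \<open>z\<close> as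
  \<open>\<Sum> u k * v k * z\<close>, the difference from \<open>P z\<close> consists of the terms
  \<open>u k * (v k * z - z * v k)\<close>, which lie in \<open>I\<close>.\<close>

lemma maximalideal_central:
  assumes "maximalideal I R"
  shows "central_maximalideal I R"
proof -
  interpret maximalideal I R by fact
  show ?thesis
  proof
    fix z assume z: "z \<in> carrier R" and *: "\<And>s. s \<in> carrier R \<Longrightarrow> s \<otimes> z \<ominus> z \<otimes> s \<in> I"
    have "z = (\<Oplus>k\<in>K. u k \<otimes> v k) \<otimes> z" using uv_one z by simp
    also have "\<dots> = (\<Oplus>k\<in>K. u k \<otimes> v k \<otimes> z)"
      using uc vc z K(1) by (intro finsum_ldistr) auto
    finally have zz: "z = (\<Oplus>k\<in>K. u k \<otimes> v k \<otimes> z)" .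
    have "(\<Oplus>k\<in>K. u k \<otimes> v k \<otimes> z) \<ominus> P z = (\<Oplus>k\<in>K. u k \<otimes> v k \<otimes> z \<ominus> u k \<otimes> z \<otimes> v k)"
      unfolding P_def using uc vc z by (intro finsum_sub[symmetric]) auto
    also have "\<dots> = (\<Oplus>k\<in>K. u k \<otimes> (v k \<otimes> z \<ominus> z \<otimes> v k))"
      using uc vc z by (intro finsum_ring_cong) (auto simp: a_minus_def r_distr r_minus m_assoc)
    also have "\<dots> \<in> I" using * uc vc by (intro finsum_mem) (auto simp: I_l_closed)
    finally have "z \<ominus> P z \<in> I" using zz by simp
    then show "\<exists>c\<in>ring_center R. z \<ominus> c \<in> I" using P_center[OF z] by blast
  qed
qed

end

section \<open>The action near a maximal ideal, and its inertia group\<close>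

locale action_at_ideal =
  separable_action G R \<epsilon> B K u v + central_maximalideal I R
  for G :: "('g, 'x) groupoid_scheme" and R :: "('a, 'm) ring_scheme" (structure)
    and \<epsilon> :: "'g \<Rightarrow> 'a" and B :: "'g \<Rightarrow> 'a \<Rightarrow> 'a" and K :: "'i set" and u v :: "'i \<Rightarrow> 'a"
    and I :: "'a set" +
  fixes H :: "'g set" and e :: 'g
  assumes H: "H \<in> wide_subgroupoids G" and e: "e \<in> gobjects G" and \<epsilon>_notin: "\<epsilon> e \<notin> I"
begin

lemma HG: "h \<in> H \<Longrightarrow> h \<in> carrier G"
  using wide_subset[OF H] by blast

lemma eH: "e \<in> H"
  using wide_objects[OF H] e by auto

lemmas ec = \<epsilon>_closed[OF e]

text \<open>The difference is killed by \<open>\<epsilon> e\<close>, a central element outside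
  \<open>I\<close>. So modulo \<open>I\<close> the idempotent \<open>\<epsilon> e\<close> becomes
  the identity and only the component at \<open>e\<close> is visible.\<close>

lemma \<epsilon>_mod: "x \<in> carrier R \<Longrightarrow> x \<otimes> \<epsilon> e \<ominus> x \<in> I"
proof -
  assume x: "x \<in> carrier R"
  have "\<epsilon> e \<otimes> (x \<otimes> \<epsilon> e \<ominus> x) = x \<otimes> (\<epsilon> e \<otimes> \<epsilon> e) \<ominus> x \<otimes> \<epsilon> e"
    using x ec center_comm[OF \<epsilon>_center[OF e], of "x \<otimes> \<epsilon> e"] center_comm[OF \<epsilon>_center[OF e], of x]
    by (simp add: a_minus_def r_distr r_minus m_assoc)
  also have "\<dots> = \<zero>" using \<epsilon>_idem[OF e] x ec by (simp add: a_minus_def r_neg)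
  finally show ?thesis
    using central_prime[OF \<epsilon>_center[OF e], of "x \<otimes> \<epsilon> e \<ominus> x"] x ec \<epsilon>_notin
      additive_subgroup.zero_closed[OF is_additive_subgroup] by auto
qed

text \<open>The part of the inertia group of \<open>I\<close> inside \<open>H\<close>; its elements automatically have range \<open>e\<close>.\<close>

definition N :: "'g set" where
  "N = {h \<in> H. gdom G h = e \<and> (\<forall>c\<in>ring_center R. B h c \<ominus> c \<in> I)}"

lemma N_H: "h \<in> N \<Longrightarrow> h \<in> H" and N_carrier: "h \<in> N \<Longrightarrow> h \<in> carrier G" and N_dom: "h \<in> N \<Longrightarrow> gdom G h = e"
  and N_cong: "h \<in> N \<Longrightarrow> c \<in> ring_center R \<Longrightarrow> B h c \<ominus> c \<in> I"
  using HG by (auto simp: N_def)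

lemma finite_N: "finite N"
  using finite_carrier N_carrier by (meson finite_subset subsetI)

text \<open>\<open>B h\<close> takes \<open>\<epsilon> e\<close> to the idempotent of the range, and
  both are congruent modulo \<open>I\<close>. If they were orthogonal, primeness would put the
  second one into \<open>I\<close>, and then also \<open>\<epsilon> e\<close>.\<close>

lemma N_rng: "h \<in> N \<Longrightarrow> grng G h = e"
proof (rule ccontr)
  assume h: "h \<in> N" and ne: "grng G h \<noteq> e"
  have r: "grng G h \<in> gobjects G" using rng_in_objects N_carrier h by blast
  have "\<epsilon> e \<otimes> \<epsilon> (grng G h) = \<zero>" using \<epsilon>_orth[OF e r] ne by simp
  then have "\<epsilon> (grng G h) \<in> I"
    using central_prime[OF \<epsilon>_center[OF e] \<epsilon>_closed[OF r]] \<epsilon>_notin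
      additive_subgroup.zero_closed[OF is_additive_subgroup] by auto
  moreover have "\<epsilon> (grng G h) \<ominus> \<epsilon> e \<in> I"
    using N_cong[OF h \<epsilon>_center[OF e]] B_\<epsilon>_dom[OF N_carrier[OF h]] N_dom[OF h] by simp
  ultimately show False using mem_cong[OF _ \<epsilon>_closed[OF r] ec] \<epsilon>_notin by simp
qed

lemma N_e: "e \<in> N"
  using eH dom_object[OF e] B_object[OF e] \<epsilon>_mod center_closed by (auto simp: N_def)

lemma N_comp: "g \<in> N \<Longrightarrow> h \<in> N \<Longrightarrow> gcomp G g h \<in> N"
proof -
  assume g: "g \<in> N" and h: "h \<in> N"
  note gG = N_carrier[OF g] and hG = N_carrier[OF h]
  have gh: "gdom G g = grng G h" using N_dom[OF g] N_rng[OF h] by simp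
  have "B (gcomp G g h) c \<ominus> c \<in> I" if c: "c \<in> ring_center R" for c
  proof -
    note cc = center_closed[OF c]
    have "B g (B h c) \<ominus> c \<in> I"
      using cong_trans[OF N_cong[OF g B_center[OF hG c]] N_cong[OF h c]] B_closed gG hG cc by simp
    then show ?thesis using B_comp[OF gG hG gh cc] by simp
  qed
  then show ?thesis
    using wide_comp[OF H N_H[OF g] N_H[OF h] gh] dom_comp[OF gG hG gh] N_dom[OF h] by (simp add: N_def)
qed

lemma N_ginv: "h \<in> N \<Longrightarrow> ginv G h \<in> N"
proof -
  assume h: "h \<in> N"
  note hG = N_carrier[OF h]
  have "B (ginv G h) c \<ominus> c \<in> I" if c: "c \<in> ring_center R" for c
  proof -
    note cc = center_closed[OF c]
    have c': "B (ginv G h) c \<in> ring_center R" using B_center[OF ginv_closed[OF hG] c] .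
    \<comment> \<open>The congruence for \<open>h\<close> is used at the central element
      \<open>B (ginv G h) c\<close>, whose image under \<open>B h\<close> is
      \<open>c \<otimes> \<epsilon> e\<close>.\<close>
    have "c \<otimes> \<epsilon> e \<ominus> B (ginv G h) c \<in> I"
      using N_cong[OF h c'] B_B_ginv[OF hG cc] N_rng[OF h] by simp
    then show ?thesis
      using cong_trans[OF cong_sym \<epsilon>_mod[OF cc]] cc ec center_closed[OF c'] by simp
  qed
  then show ?thesis
    using wide_ginv[OF H N_H[OF h]] dom_ginv[OF hG] N_rng[OF h] by (simp add: N_def)
qed

text \<open>The inertia condition concerns the centre only, so \<open>P\<close> has to transfer it
  to \<open>I\<close>. Were \<open>B h i\<close> outside \<open>I\<close>, then \<open>I\<close> and
  the preimage \<open>J\<close> of \<open>I\<close> under \<open>B (ginv G h)\<close> would span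
  \<open>R\<close>. Applying \<open>P\<close> to a decomposition of \<open>\<one>\<close> makes both
  parts central; the part in \<open>J\<close> then lies in \<open>I\<close> by the inertia
  condition, and so would \<open>\<one>\<close>.\<close>

lemma N_stable:
  assumes h: "h \<in> N" and i: "i \<in> I"
  shows "B h i \<in> I"
proof (rule ccontr)
  assume notin: "B h i \<notin> I"
  note hG = N_carrier[OF h]
  define h' where "h' = ginv G h"
  have h': "h' \<in> N" "h' \<in> carrier G" using N_ginv[OF h] ginv_closed[OF hG] by (simp_all add: h'_def)
  define J where "J = {x \<in> carrier R. B h' x \<in> I}"
  have J: "ideal J R"
  proof (rule idealI)
    show "subgroup J (add_monoid R)"
      by (rule subgroup.intro)
        (use h' add_mem uminus_mem_ideal in \<open>auto simp: J_def B_add B_uminus B_zero a_inv_def[symmetric]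
          additive_subgroup.zero_closed[OF is_additive_subgroup]\<close>)
  next
    fix a x assume a: "a \<in> J" and x: "x \<in> carrier R"
    show "x \<otimes> a \<in> J" "a \<otimes> x \<in> J"
      using a x h' by (auto simp: J_def B_mult B_closed I_l_closed I_r_closed)
  qed (rule ring_axioms)
  have "B h i \<in> J"
    using B_ginv_B[OF hG Icarr[OF i]] B_closed[OF hG Icarr[OF i]] N_dom[OF h] i ec
    by (simp add: J_def h'_def I_r_closed)
  have sum: "ideal (I <+>\<^bsub>R\<^esub> J) R" using ideal_axioms J by (rule add_ideals)
  have "I \<subseteq> I <+>\<^bsub>R\<^esub> J"
    using Icarr additive_subgroup.zero_closed[OF ideal.axioms(1)[OF J]]
    by (force simp: set_add_def' intro: r_zero[symmetric])
  moreover have "B h i \<in> I <+>\<^bsub>R\<^esub> J"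
    using \<open>B h i \<in> J\<close> additive_subgroup.zero_closed[OF is_additive_subgroup] B_closed[OF hG Icarr[OF i]]
    by (force simp: set_add_def' intro: l_zero[symmetric])
  ultimately have "I <+>\<^bsub>R\<^esub> J = carrier R"
    using I_maximal[OF sum] notin ideal.Icarr[OF sum] by blast
  then have "\<one> \<in> I <+>\<^bsub>R\<^esub> J" by simp
  then obtain j j' where j: "j \<in> I" "j' \<in> J" "\<one> = j \<oplus> j'" by (auto simp: set_add_def')
  have jc: "j \<in> carrier R" "j' \<in> carrier R" using j Icarr by (auto simp: J_def)
  have "P j' \<in> J" using P_ideal[OF J j(2)] .
  then have "B h' (P j') \<in> I" by (simp add: J_def)
  then have "P j' \<in> I"
    using N_cong[OF h'(1) P_center[OF jc(2)]] mem_cong B_closed[OF h'(2)] P_closed[OF jc(2)] by blast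
  moreover have "P j \<in> I" using P_ideal[OF ideal_axioms j(1)] .
  ultimately show False using P_one P_add[OF jc] j(3) add_mem one_notin by metis
qed

text \<open>Otherwise \<open>\<Sum> u k * n * B h (v k)\<close> would lie in \<open>I\<close> for
  all \<open>n\<close>, and \<open>relation_transport\<close> would allow undoing \<open>B h\<close>
  in the right factors by the inverse of \<open>h\<close>. What is left is
  \<open>\<Sum> u k * v k * \<epsilon> e\<close>, which equals \<open>\<epsilon> e\<close> and is
  not in \<open>I\<close>.\<close>

lemma twist_notin:
  assumes h: "h \<in> N"
  shows "\<exists>n\<in>carrier R. twist h n \<notin> I"
proof (rule ccontr)
  assume "\<not> ?thesis"
  then have tw: "twist h n \<in> I" if "n \<in> carrier R" for n using that by blast
  note hG = N_carrier[OF h]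
  define h' where "h' = ginv G h"
  have h': "h' \<in> N" "h' \<in> carrier G" using N_ginv[OF h] ginv_closed[OF hG] by (simp_all add: h'_def)
  have "(\<Oplus>k\<in>K. u k \<otimes> B h' (B h (v k))) \<in> I"
  proof (rule relation_transport[where f = "B h'" and w = "\<lambda>k. B h (v k)"])
    show "(\<Oplus>k\<in>K. u k \<otimes> n \<otimes> B h (v k)) \<in> I" if "n \<in> carrier R" for n
      using tw[OF that] by (simp add: twist_def)
    show "B h' (c \<otimes> x) \<ominus> c \<otimes> B h' x \<in> I" if c: "c \<in> ring_center R" and x: "x \<in> carrier R" for c x
    proof -
      have "B h' (c \<otimes> x) \<ominus> c \<otimes> B h' x = (B h' c \<ominus> c) \<otimes> B h' x"
        using B_mult[OF h'(2)] B_closed[OF h'(2)] center_closed[OF c] x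
        by (simp add: a_minus_def l_distr l_minus)
      then show ?thesis using N_cong[OF h'(1) c] B_closed[OF h'(2) x] by (simp add: I_r_closed)
    qed
  qed (use K uc vc B_closed B_add N_stable hG h' in auto)
  also have "(\<Oplus>k\<in>K. u k \<otimes> B h' (B h (v k))) = (\<Oplus>k\<in>K. u k \<otimes> v k \<otimes> \<epsilon> e)"
    using uc vc B_ginv_B[OF hG] N_dom[OF h] ec by (intro finsum_ring_cong) (auto simp: h'_def m_assoc)
  also have "\<dots> = \<epsilon> e"
    using finsum_ldistr[of K "\<epsilon> e" "\<lambda>k. u k \<otimes> v k"] uv_one K(1) uc vc ec by (simp add: Pi_iff)
  finally show False using \<epsilon>_notin by contradiction
qed

abbreviation D :: "'a set" where
  "D \<equiv> bicentralizer (invariants H)"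

lemma D_closed: "s \<in> D \<Longrightarrow> s \<in> carrier R"
  by (simp add: ring_centralizer_def)

text \<open>A twist \<open>w\<close> outside \<open>I\<close> already annihilates all
  \<open>B h s \<ominus> s\<close>, because it commutes both with the invariants and with the
  elements of \<open>D\<close>. It remains to trade it for a central annihilator, by applying
  \<open>P\<close> to a left multiple of \<open>w\<close> that is congruent to
  \<open>\<one>\<close>.\<close>

lemma inertia_annihilator:
  assumes h: "h \<in> N"
  shows "\<exists>f\<in>ring_center R. f \<notin> I \<and> (\<forall>s\<in>D. f \<otimes> (B h s \<ominus> s) = \<zero>)"
proof -
  note hG = N_carrier[OF h]
  obtain n where n: "n \<in> carrier R" "twist h n \<notin> I" using twist_notin[OF h] by blast
  define w where "w = twist h n"
  have w: "w \<in> carrier R" "w \<notin> I" "w \<otimes> \<epsilon> e = w"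
    and w_comm: "\<And>s. s \<in> carrier R \<Longrightarrow> s \<otimes> w = w \<otimes> B h s"
    using twist_closed[OF hG n(1)] n twist_rng[OF hG n(1)] N_rng[OF h] twist_comm[OF hG n(1)]
    by (simp_all add: w_def)
  have wV: "w \<in> ring_centralizer R (invariants H)"
  proof -
    have "w \<otimes> q = q \<otimes> w" if q: "q \<in> invariants H" for q
    proof -
      note qc = invariants_closed[OF q]
      have "q \<otimes> w = w \<otimes> (q \<otimes> \<epsilon> e)"
        using w_comm[OF qc] invariantsD[OF q N_H[OF h]] N_rng[OF h] by simp
      also have "\<dots> = (w \<otimes> \<epsilon> e) \<otimes> q"
        using center_comm[OF \<epsilon>_center[OF e] qc] w(1) qc ec by (simp add: m_assoc)
      finally show ?thesis using w(3) by simp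
    qed
    then show ?thesis using w(1) by (simp add: ring_centralizer_def)
  qed
  have w_kill: "w \<otimes> (B h s \<ominus> s) = \<zero>" if s: "s \<in> D" for s
  proof -
    have sc: "s \<in> carrier R" using s by (rule D_closed)
    have "s \<otimes> w = w \<otimes> s" using s wV unfolding ring_centralizer_def[of R "ring_centralizer R _"] by blast
    then show ?thesis
      using w_comm[OF sc] w(1) sc B_closed[OF hG sc] by (simp add: a_minus_def r_distr r_minus r_neg)
  qed
  have w_move: "w \<otimes> y = B (ginv G h) y \<otimes> w" if y: "y \<in> carrier R" for y
  proof -
    have "B (ginv G h) y \<otimes> w = w \<otimes> (y \<otimes> \<epsilon> e)"
      using w_comm[OF B_closed[OF ginv_closed[OF hG] y]] B_B_ginv[OF hG y] N_rng[OF h] by simp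
    also have "\<dots> = (w \<otimes> \<epsilon> e) \<otimes> y"
      using center_comm[OF \<epsilon>_center[OF e] y] w(1) y ec by (simp add: m_assoc)
    finally show ?thesis using w(3) by simp
  qed
  have h'c: "B (ginv G h) y \<in> carrier R" if "y \<in> carrier R" for y
    using that B_closed ginv_closed hG by blast
  \<comment> \<open>This is \<open>R w + I\<close>. It is a two-sided ideal because
    \<open>w_move\<close> turns right factors of \<open>w\<close> into left ones, and it is strictly
    larger than \<open>I\<close>.\<close>
  define Z where "Z = {z \<in> carrier R. \<exists>x\<in>carrier R. z \<ominus> x \<otimes> w \<in> I}"
  have ZI: "z \<in> Z" if "z \<in> carrier R" "x \<in> carrier R" "z \<ominus> x \<otimes> w \<in> I" for z x
    using that unfolding Z_def by blast
  have "ideal Z R"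
  proof (rule idealI)
    show "subgroup Z (add_monoid R)"
    proof (rule subgroup.intro)
      show "Z \<subseteq> carrier (add_monoid R)" by (auto simp: Z_def)
      have "\<zero> \<ominus> \<zero> \<otimes> w \<in> I"
        using w(1) additive_subgroup.zero_closed[OF is_additive_subgroup] by (simp add: a_minus_def)
      then show "\<one>\<^bsub>add_monoid R\<^esub> \<in> Z" unfolding Z_def by auto
      fix z assume "z \<in> Z"
      then obtain x where x: "x \<in> carrier R" "z \<ominus> x \<otimes> w \<in> I" and z: "z \<in> carrier R" by (auto simp: Z_def)
      have "\<ominus> z \<ominus> (\<ominus> x) \<otimes> w = \<ominus> (z \<ominus> x \<otimes> w)" using x z w(1) by algebra
      then have "\<ominus> z \<in> Z" using uminus_mem_ideal[OF x(2)] x(1) z by (intro ZI[of _ "\<ominus> x"]) simp_all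
      then show "inv\<^bsub>add_monoid R\<^esub> z \<in> Z" by (simp add: a_inv_def)
      fix z' assume "z' \<in> Z"
      then obtain x' where x': "x' \<in> carrier R" "z' \<ominus> x' \<otimes> w \<in> I" and z': "z' \<in> carrier R" by (auto simp: Z_def)
      have "(z \<oplus> z') \<ominus> (x \<oplus> x') \<otimes> w = (z \<ominus> x \<otimes> w) \<oplus> (z' \<ominus> x' \<otimes> w)" using x(1) z x'(1) z' w(1) by algebra
      then have "z \<oplus> z' \<in> Z" using add_mem[OF x(2) x'(2)] x(1) z x'(1) z' by (intro ZI[of _ "x \<oplus> x'"]) simp_all
      then show "z \<otimes>\<^bsub>add_monoid R\<^esub> z' \<in> Z" by simp
    qed
  next
    fix z y assume "z \<in> Z" and y: "y \<in> carrier R"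
    then obtain x where x: "x \<in> carrier R" "z \<ominus> x \<otimes> w \<in> I" and z: "z \<in> carrier R" by (auto simp: Z_def)
    have "y \<otimes> z \<ominus> (y \<otimes> x) \<otimes> w = y \<otimes> (z \<ominus> x \<otimes> w)" using x(1) z y w(1) by algebra
    then show "y \<otimes> z \<in> Z" using I_l_closed[OF x(2) y] x(1) z y by (intro ZI[of _ "y \<otimes> x"]) simp_all
    have "z \<otimes> y \<ominus> (x \<otimes> B (ginv G h) y) \<otimes> w = (z \<ominus> x \<otimes> w) \<otimes> y"
      using x(1) z y w(1) h'c[OF y] w_move[OF y]
      by (simp add: a_minus_def l_distr l_minus m_assoc)
    then show "z \<otimes> y \<in> Z" using I_r_closed[OF x(2) y] x(1) z y h'c[OF y]
      by (intro ZI[of _ "x \<otimes> B (ginv G h) y"]) simp_all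
  qed (rule ring_axioms)
  moreover have "I \<subseteq> Z"
  proof
    fix i assume i: "i \<in> I"
    then have "i \<ominus> \<zero> \<otimes> w \<in> I" using w(1) Icarr by (simp add: a_minus_def)
    then show "i \<in> Z" using i Icarr unfolding Z_def by blast
  qed
  moreover have "w \<in> Z"
  proof -
    have "w \<ominus> \<one> \<otimes> w \<in> I"
      using w(1) additive_subgroup.zero_closed[OF is_additive_subgroup] by (simp add: a_minus_def r_neg)
    then show ?thesis using w(1) unfolding Z_def by blast
  qed
  moreover have "Z \<subseteq> carrier R" by (auto simp: Z_def)
  ultimately have "Z = carrier R" using I_maximal[of Z] w(2) by blast
  then have "\<one> \<in> Z" by simp
  then obtain x where x: "x \<in> carrier R" "\<one> \<ominus> x \<otimes> w \<in> I" by (auto simp: Z_def)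
  \<comment> \<open>Modulo \<open>I\<close> this is \<open>P \<one>\<close>, that is
    \<open>\<one>\<close>. It inherits the annihilation because in each summand \<open>w\<close> can
    be moved past \<open>v k\<close> to the right.\<close>
  define f where "f = P (x \<otimes> w)"
  have fC: "f \<in> ring_center R" unfolding f_def using x w by (intro P_center) simp
  have "f \<notin> I"
  proof
    assume "f \<in> I"
    moreover have "P (\<one> \<ominus> x \<otimes> w) \<in> I" using P_ideal[OF ideal_axioms x(2)] .
    moreover have "P (\<one> \<ominus> x \<otimes> w) \<oplus> f = P ((\<one> \<ominus> x \<otimes> w) \<oplus> x \<otimes> w)"
      unfolding f_def using x w by (intro P_add[symmetric]) auto
    moreover have "(\<one> \<ominus> x \<otimes> w) \<oplus> x \<otimes> w = \<one>" using x w(1) by algebra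
    ultimately show False using add_mem one_notin P_one by metis
  qed
  moreover have "f \<otimes> (B h s \<ominus> s) = \<zero>" if s: "s \<in> D" for s
  proof -
    have sc: "s \<in> carrier R" using s by (rule D_closed)
    let ?t = "B h s \<ominus> s"
    have t: "?t \<in> carrier R" using B_closed[OF hG sc] sc by simp
    have "f \<otimes> ?t = (\<Oplus>k\<in>K. u k \<otimes> (x \<otimes> w) \<otimes> v k \<otimes> ?t)"
      unfolding f_def P_def using uc vc x w t K(1) by (intro finsum_ldistr) auto
    also have "\<dots> = (\<Oplus>k\<in>K. \<zero>)"
    proof (rule finsum_ring_cong)
      fix k assume k: "k \<in> K"
      have "u k \<otimes> (x \<otimes> w) \<otimes> v k \<otimes> ?t = u k \<otimes> x \<otimes> (w \<otimes> v k) \<otimes> ?t"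
        using uc[OF k] vc[OF k] x(1) w(1) t by (simp add: m_assoc)
      also have "\<dots> = u k \<otimes> x \<otimes> B (ginv G h) (v k) \<otimes> (w \<otimes> ?t)"
        unfolding w_move[OF vc[OF k]] using uc[OF k] h'c[OF vc[OF k]] x(1) w(1) t by (simp add: m_assoc)
      also have "\<dots> = \<zero>" using w_kill[OF s] uc[OF k] h'c[OF vc[OF k]] x(1) by simp
      finally show "u k \<otimes> (x \<otimes> w) \<otimes> v k \<otimes> ?t = \<zero>" .
    qed simp
    finally show ?thesis by simp
  qed
  ultimately show ?thesis using fC by blast
qed

lemma inertia_common_annihilator:
  "\<exists>a\<in>ring_center R. a \<notin> I \<and> (\<forall>h\<in>N. \<forall>s\<in>D. a \<otimes> (B h s \<ominus> s) = \<zero>)"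
proof -
  have "\<exists>a\<in>ring_center R. a \<notin> I \<and> (\<forall>h\<in>F. \<forall>s\<in>D. a \<otimes> (B h s \<ominus> s) = \<zero>)"
    if "finite F" "F \<subseteq> N" for F
    using that
  proof (induction F)
    case empty
    then show ?case using center_one one_notin by blast
  next
    case (insert g F)
    then obtain a where a: "a \<in> ring_center R" "a \<notin> I" "\<And>h s. h \<in> F \<Longrightarrow> s \<in> D \<Longrightarrow> a \<otimes> (B h s \<ominus> s) = \<zero>"
      by blast
    obtain f where f: "f \<in> ring_center R" "f \<notin> I" "\<And>s. s \<in> D \<Longrightarrow> f \<otimes> (B g s \<ominus> s) = \<zero>"
      using inertia_annihilator[of g] insert.prems by blast
    have "a \<otimes> f \<notin> I" using central_prime[OF a(1) center_closed[OF f(1)]] a(2) f(2) by blast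
    moreover have "(a \<otimes> f) \<otimes> (B h s \<ominus> s) = \<zero>" if h: "h \<in> insert g F" and s: "s \<in> D" for h s
    proof -
      have t: "B h s \<ominus> s \<in> carrier R"
        using h insert.prems N_carrier B_closed D_closed[OF s] by blast
      have "(a \<otimes> f) \<otimes> (B h s \<ominus> s) = a \<otimes> (f \<otimes> (B h s \<ominus> s))"
        "(a \<otimes> f) \<otimes> (B h s \<ominus> s) = f \<otimes> (a \<otimes> (B h s \<ominus> s))"
        using center_closed[OF a(1)] center_closed[OF f(1)] t center_lcomm[OF f(1) _ t, of a]
        by (simp_all add: m_assoc)
      then show ?thesis using h a(3)[OF _ s] f(3)[OF s] center_closed[OF a(1)] center_closed[OF f(1)] by auto
    qed
    ultimately show ?case using center_mult[OF a(1) f(1)] by blast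
  qed
  then show ?thesis using finite_N by blast
qed

end

section \<open>The reduced trace and the double centralizer\<close>

context action_at_ideal
begin

text \<open>Taking the norm over the inertia group makes the annihilator invariant under that group.\<close>

lemma inertia_invariant_annihilator:
  "\<exists>a\<in>ring_center R. a \<notin> I \<and> a \<otimes> \<epsilon> e = a \<and>
     (\<forall>h\<in>N. B h a = a \<and> (\<forall>s\<in>D. a \<otimes> (B h s \<ominus> s) = \<zero>))"
proof -
  obtain a0 where a0: "a0 \<in> ring_center R" "a0 \<notin> I"
    and kill0: "\<And>h s. h \<in> N \<Longrightarrow> s \<in> D \<Longrightarrow> a0 \<otimes> (B h s \<ominus> s) = \<zero>"
    using inertia_common_annihilator by blast
  \<comment> \<open>Cutting down to the component at \<open>e\<close> puts all conjugates of the
    annihilator into one component on which the inertia group acts by automorphisms.\<close>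
  define a1 where "a1 = a0 \<otimes> \<epsilon> e"
  have a0c: "a0 \<in> carrier R" using a0(1) by (rule center_closed)
  have a1: "a1 \<in> ring_center R" unfolding a1_def using center_mult[OF a0(1) \<epsilon>_center[OF e]] .
  have a1c: "a1 \<in> carrier R" using a1 by (rule center_closed)
  have a1e: "a1 \<otimes> \<epsilon> e = a1" unfolding a1_def using \<epsilon>_idem[OF e] a0c ec by (simp add: m_assoc)
  have a1_notin: "a1 \<notin> I" unfolding a1_def using central_prime[OF a0(1) ec] a0(2) \<epsilon>_notin by blast
  have kill1: "a1 \<otimes> (B h s \<ominus> s) = \<zero>" if "h \<in> N" "s \<in> D" for h s
  proof -
    have t: "B h s \<ominus> s \<in> carrier R" using that N_carrier B_closed D_closed by blast
    have "a1 \<otimes> (B h s \<ominus> s) = \<epsilon> e \<otimes> (a0 \<otimes> (B h s \<ominus> s))"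
      unfolding a1_def using center_comm[OF a0(1) ec] a0c ec t by (simp add: m_assoc)
    then show ?thesis using kill0[OF that] ec by simp
  qed
  \<comment> \<open>The norm is formed in this commutative monoid. Its unit has to be
    \<open>\<epsilon> e\<close>, which the inertia group fixes, whereas \<open>B h\<close> sends
    \<open>\<one>\<close> to \<open>\<epsilon> e\<close>.\<close>
  define M where "M = \<lparr>carrier = {c \<in> ring_center R. c \<otimes> \<epsilon> e = c}, monoid.mult = (\<otimes>), one = \<epsilon> e\<rparr>"
  have Mc: "c \<in> carrier M \<longleftrightarrow> c \<in> ring_center R \<and> c \<otimes> \<epsilon> e = c" for c by (simp add: M_def)
  have Mm: "x \<otimes>\<^bsub>M\<^esub> y = x \<otimes> y" "\<one>\<^bsub>M\<^esub> = \<epsilon> e" for x y by (simp_all add: M_def)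
  interpret M: comm_monoid M
  proof (rule comm_monoidI)
    fix x y z assume "x \<in> carrier M" "y \<in> carrier M" "z \<in> carrier M"
    then have x: "x \<in> ring_center R" "x \<in> carrier R" "x \<otimes> \<epsilon> e = x"
      and y: "y \<in> ring_center R" "y \<in> carrier R" "y \<otimes> \<epsilon> e = y" and z: "z \<in> carrier R"
      using center_closed by (simp_all add: Mc)
    show "x \<otimes>\<^bsub>M\<^esub> y \<in> carrier M"
      using center_mult[OF x(1) y(1)] x(2) y(2,3) ec by (simp add: Mc Mm m_assoc)
    show "x \<otimes>\<^bsub>M\<^esub> y \<otimes>\<^bsub>M\<^esub> z = x \<otimes>\<^bsub>M\<^esub> (y \<otimes>\<^bsub>M\<^esub> z)" using x(2) y(2) z by (simp add: Mm m_assoc)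
    show "x \<otimes>\<^bsub>M\<^esub> y = y \<otimes>\<^bsub>M\<^esub> x" using center_comm[OF x(1) y(2)] by (simp add: Mm)
    show "\<one>\<^bsub>M\<^esub> \<otimes>\<^bsub>M\<^esub> x = x" using center_comm[OF \<epsilon>_center[OF e] x(2)] x(3) by (simp add: Mm)
  next
    show "\<one>\<^bsub>M\<^esub> \<in> carrier M" using \<epsilon>_center[OF e] \<epsilon>_idem[OF e] by (simp add: Mc Mm)
  qed
  have BM: "B h c \<in> carrier M" if "h \<in> N" "c \<in> ring_center R" for h c
    using B_center[OF N_carrier[OF that(1)] that(2)] B_rng[OF N_carrier[OF that(1)] center_closed[OF that(2)]]
      N_rng[OF that(1)] by (simp add: Mc)
  have B_hom: "B h \<in> hom M M" if "h \<in> N" for h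
    using BM[OF that] B_mult[OF N_carrier[OF that]] center_closed by (intro homI) (auto simp: Mc Mm)
  have B_M_one: "B h \<one>\<^bsub>M\<^esub> = \<one>\<^bsub>M\<^esub>" if "h \<in> N" for h
    using B_\<epsilon>_dom[OF N_carrier[OF that]] N_dom[OF that] N_rng[OF that] by (simp add: Mm)
  have fM: "(\<lambda>h. B h a1) \<in> F \<rightarrow> carrier M" if "F \<subseteq> N" for F using BM a1 that by blast
  define a where "a = finprod M (\<lambda>h. B h a1) N"
  have aM: "a \<in> carrier M" unfolding a_def using fM[OF order_refl] by (rule M.finprod_closed)
  have "B n a = a" if n: "n \<in> N" for n
  proof -
    have nG: "n \<in> carrier G" and n': "ginv G n \<in> N" using n N_carrier N_ginv by auto
    have bij: "bij_betw (gcomp G n) N N"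
      by (rule bij_betw_byWitness[where f' = "gcomp G (ginv G n)"])
        (use n n' nG N_comp N_carrier N_dom N_rng in \<open>auto simp: ginv_cancel ginv_cancel'\<close>)
    have "B n a = finprod M (\<lambda>h. B n (B h a1)) N"
      unfolding a_def using M.comm_monoid_axioms B_hom[OF n] B_M_one[OF n] fM[OF order_refl] by (rule M.hom_finprod)
    also have "\<dots> = finprod M (\<lambda>h. B (gcomp G n h) a1) N"
      using B_comp[OF nG N_carrier _ a1c] N_dom[OF n] N_rng BM[OF N_comp[OF n] a1]
      by (intro M.finprod_cong') auto
    also have "\<dots> = finprod M (\<lambda>h. B h a1) (gcomp G n ` N)"
      using bij fM[OF order_refl] by (intro M.finprod_reindex[symmetric]) (auto simp: bij_betw_def)
    also have "gcomp G n ` N = N" using bij by (simp add: bij_betw_def)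
    finally show ?thesis by (simp add: a_def)
  qed
  \<comment> \<open>Each conjugate is congruent to \<open>a1\<close> modulo \<open>I\<close> because
    the inertia group acts trivially on the centre there; primeness then keeps the product outside
    \<open>I\<close>.\<close>
  moreover have "finprod M (\<lambda>h. B h a1) F \<notin> I" if "F \<subseteq> N" for F
    using finite_subset[OF that finite_N] that
  proof (induction F rule: finite_induct)
    case empty
    then show ?case using \<epsilon>_notin by (simp add: Mm)
  next
    case (insert h F)
    then have h: "h \<in> N" and F: "F \<subseteq> N" by auto
    have Bh: "B h a1 \<in> ring_center R" using B_center[OF N_carrier[OF h] a1] .
    have "B h a1 \<notin> I"
      using mem_cong[OF N_cong[OF h a1] center_closed[OF Bh] a1c] a1_notin by simp
    moreover have p: "finprod M (\<lambda>h. B h a1) F \<in> carrier M" using fM[OF F] by (rule M.finprod_closed)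
    ultimately have "B h a1 \<otimes> finprod M (\<lambda>h. B h a1) F \<notin> I"
      using central_prime[OF Bh, of "finprod M (\<lambda>h. B h a1) F"] insert.IH[OF F] center_closed by (auto simp: Mc)
    then show ?case
      using M.finprod_insert[OF insert.hyps fM[OF F] BM[OF h a1]] by (simp add: Mm)
  qed
  then have "a \<notin> I" unfolding a_def by simp
  moreover have "a \<otimes> (B h s \<ominus> s) = \<zero>" if hs: "h \<in> N" "s \<in> D" for h s
  proof -
    have t: "B h s \<ominus> s \<in> carrier R" using hs N_carrier B_closed D_closed by blast
    \<comment> \<open>Splitting off the factor at \<open>e\<close>, which is \<open>a1\<close>
      itself, shows that the norm is a multiple of \<open>a1\<close> and annihilates whatever
      \<open>a1\<close> does.\<close>
    let ?p = "finprod M (\<lambda>h. B h a1) (N - {e})"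
    have p: "?p \<in> carrier M" by (rule M.finprod_closed) (use fM[of "N - {e}"] in auto)
    then have pc: "?p \<in> ring_center R" "?p \<in> carrier R" using center_closed by (simp_all add: Mc)
    have "finprod M (\<lambda>h. B h a1) (insert e (N - {e})) = B e a1 \<otimes>\<^bsub>M\<^esub> ?p"
      using finite_N fM[of "N - {e}"] BM[OF N_e a1] by (intro M.finprod_insert) auto
    then have "a = a1 \<otimes> ?p"
      using N_e B_object[OF e a1c] a1e by (simp add: a_def Mm insert_absorb)
    then have "a \<otimes> (B h s \<ominus> s) = ?p \<otimes> (a1 \<otimes> (B h s \<ominus> s))"
      using center_comm[OF a1 pc(2)] a1c pc(2) t by (simp add: m_assoc)
    then show ?thesis using kill1[OF hs] pc(2) by simp
  qed
  ultimately show ?thesis using aM by (auto simp: Mc)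
qed

text \<open>On the following set the inertia group acts trivially, even after multiplication by central
  elements; so the trace over \<open>H\<close> may be replaced by a sum over representatives of the maps
  that \<open>H\<close> induces on it.  The full trace would be useless where the order of the inertia group
  vanishes.\<close>

definition Q :: "'a set" where
  "Q = {x \<in> carrier R. x \<otimes> \<epsilon> e = x \<and> (\<forall>h\<in>N. \<forall>c\<in>ring_center R. B h (c \<otimes> x) = c \<otimes> x)}"

lemma Q_closed: "x \<in> Q \<Longrightarrow> x \<in> carrier R"
  and Q_object: "x \<in> Q \<Longrightarrow> x \<otimes> \<epsilon> e = x"
  by (simp_all add: Q_def)

lemma Q_fixed: "x \<in> Q \<Longrightarrow> h \<in> N \<Longrightarrow> B h x = x"
proof -
  assume x: "x \<in> Q" and h: "h \<in> N"
  have "B h (\<one> \<otimes> x) = \<one> \<otimes> x" using x h center_one unfolding Q_def by blast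
  then show ?thesis using Q_closed[OF x] by simp
qed

lemma Q_smult:
  assumes c: "c \<in> ring_center R" and x: "x \<in> Q"
  shows "c \<otimes> x \<in> Q"
proof -
  have "B h (d \<otimes> (c \<otimes> x)) = d \<otimes> (c \<otimes> x)" if "h \<in> N" "d \<in> ring_center R" for h d
  proof -
    have "B h ((d \<otimes> c) \<otimes> x) = (d \<otimes> c) \<otimes> x" using x center_mult[OF that(2) c] that(1) by (simp add: Q_def)
    then show ?thesis using center_closed[OF c] center_closed[OF that(2)] Q_closed[OF x] by (simp add: m_assoc)
  qed
  then show ?thesis
    using center_closed[OF c] Q_closed[OF x] Q_object[OF x] ec by (simp add: Q_def m_assoc)
qed

definition He :: "'g set" where
  "He = {h \<in> H. gdom G h = e}"

text \<open>Elements of one left coset of \<open>N\<close> are related, but the relation may be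
  coarser. Equality of ranges is required separately, since maps into different components could
  still agree on a small \<open>Q\<close>.\<close>

definition same_on_Q :: "'g \<Rightarrow> 'g \<Rightarrow> bool" where
  "same_on_Q h k \<longleftrightarrow> grng G h = grng G k \<and> (\<forall>x\<in>Q. B h x = B k x)"

text \<open>The class of \<open>e\<close> is represented by \<open>e\<close> so that the term to be
  isolated later is the identity; elsewhere the choice depends only on the class.\<close>

definition rep :: "'g \<Rightarrow> 'g" where
  "rep h = (if same_on_Q h e then e else SOME k. k \<in> He \<and> same_on_Q h k)"

lemma He_carrier: "h \<in> He \<Longrightarrow> h \<in> carrier G"
  using HG by (auto simp: He_def)

lemma e_He: "e \<in> He"
  using eH dom_object[OF e] by (simp add: He_def)

lemma He_comp: "k \<in> H \<Longrightarrow> h \<in> He \<Longrightarrow> gdom G k = grng G h \<Longrightarrow> gcomp G k h \<in> He"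
  using wide_comp[OF H] dom_comp HG by (simp add: He_def)

lemma rep_spec:
  assumes "h \<in> He"
  shows "rep h \<in> He \<and> same_on_Q h (rep h)"
proof (cases "same_on_Q h e")
  case True
  then show ?thesis using e_He by (simp add: rep_def)
next
  case False
  have "\<exists>k. k \<in> He \<and> same_on_Q h k" using assms by (auto simp: same_on_Q_def)
  then have "(SOME k. k \<in> He \<and> same_on_Q h k) \<in> He \<and> same_on_Q h (SOME k. k \<in> He \<and> same_on_Q h k)"
    by (rule someI_ex)
  then show ?thesis using False by (simp add: rep_def)
qed

lemma rep_cong:
  assumes "same_on_Q h k"
  shows "rep h = rep k"
proof -
  have "same_on_Q h l \<longleftrightarrow> same_on_Q k l" for l using assms by (auto simp: same_on_Q_def)
  then show ?thesis by (simp add: rep_def)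
qed

lemma rep_e: "rep e = e"
  by (simp add: rep_def same_on_Q_def)

lemma same_on_Q_comp:
  assumes k: "k \<in> H" and h: "h \<in> He" "h' \<in> He" "same_on_Q h h'" "gdom G k = grng G h"
  shows "same_on_Q (gcomp G k h) (gcomp G k h')"
proof -
  have r: "gdom G k = grng G h'" using h(3,4) by (simp add: same_on_Q_def)
  have kG: "k \<in> carrier G" and hG: "h \<in> carrier G" "h' \<in> carrier G" using k h HG He_carrier by auto
  show ?thesis
    unfolding same_on_Q_def
    using rng_comp[OF kG hG(1) h(4)] rng_comp[OF kG hG(2) r] B_comp[OF kG hG(1) h(4)] B_comp[OF kG hG(2) r]
      h(3) Q_closed by (simp add: same_on_Q_def) metis
qed

definition T :: "'g set" where
  "T = rep ` He"

lemma
  assumes "t \<in> T"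
  shows T_He: "t \<in> He" and rep_T: "rep t = t"
proof -
  obtain h where h: "h \<in> He" "t = rep h" using assms unfolding T_def by blast
  then show "t \<in> He" using rep_spec by simp
  show "rep t = t" using rep_cong[OF conjunct2[OF rep_spec[OF h(1)]]] h(2) by simp
qed

lemma finite_T: "finite T"
proof -
  have "He \<subseteq> carrier G" using He_carrier by blast
  then show ?thesis using finite_carrier by (auto simp: T_def intro: finite_subset)
qed

lemma e_T: "e \<in> T"
  unfolding T_def using rep_e e_He by (metis imageI)

text \<open>Left composition with \<open>k\<close> respects the relation and hence permutes the
  classes, with composition by the inverse of \<open>k\<close> as its inverse; the summand of a
  class at \<open>x\<close> is independent of the representative.\<close>

lemma reduced_trace_invariant:
  assumes x: "x \<in> Q"
  shows "(\<Oplus>t\<in>T. B t x) \<in> invariants H"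
proof (rule orbit_sum_invariant[where \<rho> = "grng G" and \<phi> = "\<lambda>k t. rep (gcomp G k t)"])
  show "H \<subseteq> carrier G" using HG by blast
  have tG: "t \<in> carrier G" if "t \<in> T" for t using that T_He He_carrier by blast
  note xc = Q_closed[OF x]
  have step: "rep (gcomp G k t) \<in> T" "grng G (rep (gcomp G k t)) = grng G k"
    "same_on_Q (gcomp G k t) (rep (gcomp G k t))" "gcomp G k t \<in> He"
    if k: "k \<in> H" and t: "t \<in> T" "grng G t = gdom G k" for k t
  proof -
    show kt: "gcomp G k t \<in> He" using He_comp[OF k T_He[OF t(1)]] t(2) by simp
    then show "rep (gcomp G k t) \<in> T" by (simp add: T_def)
    show s: "same_on_Q (gcomp G k t) (rep (gcomp G k t))" using rep_spec[OF kt] by simp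
    then show "grng G (rep (gcomp G k t)) = grng G k"
      using rng_comp[OF HG[OF k] tG[OF t(1)]] t(2) by (simp add: same_on_Q_def)
  qed
  have retract: "rep (gcomp G (ginv G k) (rep (gcomp G k t))) = t"
    if k: "k \<in> H" and t: "t \<in> T" "grng G t = gdom G k" for k t
  proof -
    note kG = HG[OF k] and kt = step[OF k t]
    have "same_on_Q (gcomp G (ginv G k) (gcomp G k t)) (gcomp G (ginv G k) (rep (gcomp G k t)))"
      using kt rng_comp[OF kG tG[OF t(1)]] t(2) dom_ginv[OF kG] rep_spec[OF kt(4)]
      by (intro same_on_Q_comp wide_ginv[OF H k]) auto
    then have "rep (gcomp G (ginv G k) (rep (gcomp G k t))) = rep (gcomp G (ginv G k) (gcomp G k t))"
      using rep_cong by simp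
    also have "\<dots> = t" using ginv_cancel[OF kG tG[OF t(1)]] t rep_T by simp
    finally show ?thesis .
  qed
  fix k assume k: "k \<in> H"
  note kG = HG[OF k] and k' = wide_ginv[OF H k]
  show "bij_betw (\<lambda>t. rep (gcomp G k t)) {t \<in> T. grng G t = gdom G k} {t \<in> T. grng G t = grng G k}"
  proof (rule bij_betw_byWitness[where f' = "\<lambda>t. rep (gcomp G (ginv G k) t)"])
    show "\<forall>t\<in>{t \<in> T. grng G t = grng G k}. rep (gcomp G k (rep (gcomp G (ginv G k) t))) = t"
      using retract[OF k'] ginv_ginv[OF kG] dom_ginv[OF kG] by simp
  qed (use k k' kG step retract in \<open>auto simp: dom_ginv rng_ginv\<close>)
  show "B k (B t x) = B (rep (gcomp G k t)) x" if t: "t \<in> T" "grng G t = gdom G k" for t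
    using B_comp[OF kG tG[OF t(1)] _ xc] t(2) step(3)[OF k t] x by (simp add: same_on_Q_def)
qed (use T_He He_carrier finite_T Q_closed[OF x] B_closed B_rng rng_in_objects in auto)

text \<open>A weighted reduced trace stays in the span when its weights \<open>\<theta> t\<close> are multiplied by
  \<open>B g c - B t c\<close>, and this kills the weight at \<open>t = g\<close>.\<close>

lemma isolate_identity:
  assumes "finite F" "F \<subseteq> T - {e}"
  shows "\<exists>\<theta>\<in>T \<rightarrow> ring_center R. \<theta> e \<notin> I \<and> (\<forall>t\<in>F. \<theta> t = \<zero>) \<and>
    (\<forall>x\<in>Q. (\<Oplus>t\<in>T. \<theta> t \<otimes> B t x) \<in> sums_of_products R (invariants H) (ring_center R))"
  using assms
proof (induction F rule: finite_induct)
  case empty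
  have "(\<Oplus>t\<in>T. \<one> \<otimes> B t x) \<in> sums_of_products R (invariants H) (ring_center R)" if x: "x \<in> Q" for x
  proof -
    have tc: "B t x \<in> carrier R" if "t \<in> T" for t
      using that T_He He_carrier B_closed Q_closed[OF x] by blast
    then have "(\<Oplus>t\<in>T. \<one> \<otimes> B t x) = (\<Oplus>t\<in>T. B t x)" by (intro finsum_ring_cong) auto
    moreover have "(\<Oplus>t\<in>T. B t x) \<otimes> \<one> \<in> sums_of_products R (invariants H) (ring_center R)"
      using reduced_trace_invariant[OF x] invariants_closed center_one by (intro sums_of_products_incl) auto
    moreover have "(\<Oplus>t\<in>T. B t x) \<in> carrier R" using reduced_trace_invariant[OF x] by (rule invariants_closed)
    ultimately show ?thesis by simp
  qed
  then show ?case using center_one one_notin by (intro bexI[of _ "\<lambda>_. \<one>"]) auto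
next
  case (insert g F)
  then obtain \<theta> where \<theta>: "\<theta> \<in> T \<rightarrow> ring_center R" "\<theta> e \<notin> I" "\<And>t. t \<in> F \<Longrightarrow> \<theta> t = \<zero>"
    and span: "\<And>x. x \<in> Q \<Longrightarrow> (\<Oplus>t\<in>T. \<theta> t \<otimes> B t x) \<in> sums_of_products R (invariants H) (ring_center R)"
    by blast
  have tG: "t \<in> carrier G" if "t \<in> T" for t using that T_He He_carrier by blast
  have \<theta>C: "\<theta> t \<in> ring_center R" if "t \<in> T" for t using \<theta>(1) that by blast
  note \<theta>c = center_closed[OF \<theta>C]
  have g: "g \<in> T" "g \<noteq> e" using insert.prems by auto
  have gG: "g \<in> carrier G" using tG g by simp
  \<comment> \<open>An element of \<open>N\<close> acts on \<open>Q\<close> like \<open>e\<close>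
    and would be represented by \<open>e\<close>. So every other representative moves some central
    \<open>c\<close> modulo \<open>I\<close>, which supplies the separating factor.\<close>
  have "g \<notin> N"
  proof
    assume gN: "g \<in> N"
    have "same_on_Q g e"
      using N_rng[OF gN] rng_object[OF e] Q_fixed[OF _ gN] B_object[OF e Q_closed] Q_object
      by (simp add: same_on_Q_def)
    then show False using rep_cong rep_e rep_T[OF g(1)] g(2) by metis
  qed
  then obtain c where c: "c \<in> ring_center R" "B g c \<ominus> c \<notin> I"
    using T_He[OF g(1)] by (auto simp: N_def He_def)
  note cc = center_closed[OF c(1)]
  have Bc: "B t c \<in> ring_center R" "B t c \<in> carrier R" if "t \<in> T" for t
    using B_center[OF tG[OF that] c(1)] center_closed by auto
  define \<theta>' where "\<theta>' t = \<theta> t \<otimes> (B g c \<ominus> B t c)" for t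
  have "\<theta>' \<in> T \<rightarrow> ring_center R"
    using \<theta>C Bc g unfolding \<theta>'_def by (auto intro!: center_mult center_minus)
  moreover have "\<theta>' e \<notin> I"
  proof
    assume "\<theta>' e \<in> I"
    then have "B g c \<ominus> c \<otimes> \<epsilon> e \<in> I"
      using central_prime[OF \<theta>C[OF e_T], of "B g c \<ominus> B e c"] \<theta>(2) Bc[OF g(1)] Bc[OF e_T] B_object[OF e cc]
      by (simp add: \<theta>'_def)
    then have "B g c \<ominus> c \<in> I"
      using cong_trans[OF _ \<epsilon>_mod[OF cc]] Bc[OF g(1)] cc ec by simp
    then show False using c(2) by contradiction
  qed
  moreover have "\<theta>' t = \<zero>" if t: "t \<in> insert g F" for t
  proof (cases "t = g")
    case True
    then show ?thesis using Bc[OF g(1)] \<theta>c[OF g(1)] by (simp add: \<theta>'_def a_minus_def r_neg)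
  next
    case False
    then have "t \<in> F" "t \<in> T" using t insert.prems by auto
    then show ?thesis using \<theta>(3) Bc[of t] Bc[OF g(1)] by (simp add: \<theta>'_def)
  qed
  moreover have "(\<Oplus>t\<in>T. \<theta>' t \<otimes> B t x) \<in> sums_of_products R (invariants H) (ring_center R)"
    if x: "x \<in> Q" for x
  proof -
    note xc = Q_closed[OF x]
    have Bx: "B t x \<in> carrier R" if "t \<in> T" for t using B_closed[OF tG[OF that] xc] .
    \<comment> \<open>The new weighted trace at \<open>x\<close> is \<open>B g c\<close> times the
      old one at \<open>x\<close>, minus the old one at \<open>c \<otimes> x\<close>. Both lie in
      the span because \<open>Q\<close> is closed under central multiples.\<close>
    have "(\<Oplus>t\<in>T. \<theta>' t \<otimes> B t x) = (\<Oplus>t\<in>T. B g c \<otimes> (\<theta> t \<otimes> B t x) \<ominus> \<theta> t \<otimes> B t (c \<otimes> x))"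
    proof (rule finsum_ring_cong)
      fix t assume t: "t \<in> T"
      have "\<theta>' t \<otimes> B t x = \<theta> t \<otimes> (B g c \<otimes> B t x) \<ominus> \<theta> t \<otimes> (B t c \<otimes> B t x)"
        unfolding \<theta>'_def using \<theta>c[OF t] Bc(2)[OF g(1)] Bc(2)[OF t] Bx[OF t] by algebra
      then show "\<theta>' t \<otimes> B t x = B g c \<otimes> (\<theta> t \<otimes> B t x) \<ominus> \<theta> t \<otimes> B t (c \<otimes> x)"
        using center_lcomm[OF Bc(1)[OF g(1)] \<theta>c[OF t] Bx[OF t]] B_mult[OF tG[OF t] cc xc] by simp
    qed (use \<theta>c Bc(2) g Bx xc cc B_closed tG in auto)
    also have "\<dots> = (\<Oplus>t\<in>T. B g c \<otimes> (\<theta> t \<otimes> B t x)) \<ominus> (\<Oplus>t\<in>T. \<theta> t \<otimes> B t (c \<otimes> x))"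
      using \<theta>c Bc(2) g Bx xc cc B_closed tG by (intro finsum_sub) auto
    also have "(\<Oplus>t\<in>T. B g c \<otimes> (\<theta> t \<otimes> B t x)) = B g c \<otimes> (\<Oplus>t\<in>T. \<theta> t \<otimes> B t x)"
      using \<theta>c Bc(2) g Bx finite_T by (intro finsum_rdistr[symmetric]) auto
    also have "B g c \<otimes> (\<Oplus>t\<in>T. \<theta> t \<otimes> B t x) \<ominus> (\<Oplus>t\<in>T. \<theta> t \<otimes> B t (c \<otimes> x))
      \<in> sums_of_products R (invariants H) (ring_center R)"
      using invariants_closed Bc(1)[OF g(1)] span[OF x] span[OF Q_smult[OF c(1) x]]
      by (intro sums_of_products_minus sums_of_products_smult) auto
    finally show ?thesis .
  qed
  ultimately show ?case by blast
qed

text \<open>The invariant annihilator \<open>a\<close> brings \<open>a \<otimes> r\<close> into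
  \<open>Q\<close>. Once all weights away from \<open>e\<close> vanish, the weighted reduced trace
  of this element is just \<open>\<theta> e \<otimes> a \<otimes> r\<close>, a multiple of
  \<open>r\<close> by a central element outside \<open>I\<close>.\<close>

lemma local_double_centralizer:
  assumes r: "r \<in> D"
  shows "\<exists>c\<in>ring_center R. c \<notin> I \<and> c \<otimes> r \<in> sums_of_products R (invariants H) (ring_center R)"
proof -
  obtain a where a: "a \<in> ring_center R" "a \<notin> I" "a \<otimes> \<epsilon> e = a" and fixed: "\<And>h. h \<in> N \<Longrightarrow> B h a = a"
    and kill: "\<And>h s. h \<in> N \<Longrightarrow> s \<in> D \<Longrightarrow> a \<otimes> (B h s \<ominus> s) = \<zero>"
    using inertia_invariant_annihilator by blast
  note ac = center_closed[OF a(1)] and rc = D_closed[OF r]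
  have arQ: "a \<otimes> r \<in> Q"
  proof -
    have "a \<otimes> r \<otimes> \<epsilon> e = a \<otimes> r"
    proof -
      have "a \<otimes> r \<otimes> \<epsilon> e = (a \<otimes> \<epsilon> e) \<otimes> r"
        using center_comm[OF \<epsilon>_center[OF e] rc] ac rc ec by (simp add: m_assoc)
      then show ?thesis using a(3) by simp
    qed
    moreover have "B h (c \<otimes> (a \<otimes> r)) = c \<otimes> (a \<otimes> r)" if h: "h \<in> N" and c: "c \<in> ring_center R" for h c
    proof -
      have cr: "c \<otimes> r \<in> D" using center_bicentralizer_mult[OF c r] .
      have crc: "c \<otimes> r \<in> carrier R" using cr by (rule D_closed)
      have Bcr: "B h (c \<otimes> r) \<in> carrier R" using B_closed[OF N_carrier[OF h] crc] .
      have "a \<otimes> B h (c \<otimes> r) \<ominus> a \<otimes> (c \<otimes> r) = \<zero>"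
        using kill[OF h cr] ac crc Bcr by (simp add: a_minus_def r_distr r_minus)
      then have "a \<otimes> B h (c \<otimes> r) = a \<otimes> (c \<otimes> r)" using ac crc Bcr by simp
      then have "B h (a \<otimes> (c \<otimes> r)) = a \<otimes> (c \<otimes> r)"
        using B_mult[OF N_carrier[OF h] ac crc] fixed[OF h] by simp
      then show ?thesis using center_lcomm[OF a(1) center_closed[OF c] rc] by simp
    qed
    ultimately show ?thesis using ac rc by (simp add: Q_def)
  qed
  obtain \<theta> where \<theta>: "\<theta> \<in> T \<rightarrow> ring_center R" "\<theta> e \<notin> I" "\<And>t. t \<in> T - {e} \<Longrightarrow> \<theta> t = \<zero>"
    and span: "\<And>x. x \<in> Q \<Longrightarrow> (\<Oplus>t\<in>T. \<theta> t \<otimes> B t x) \<in> sums_of_products R (invariants H) (ring_center R)"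
    using isolate_identity[of "T - {e}"] finite_T by blast
  have tG: "t \<in> carrier G" if "t \<in> T" for t using that T_He He_carrier by blast
  have \<theta>c: "\<theta> t \<in> carrier R" if "t \<in> T" for t using \<theta>(1) that center_closed by blast
  have \<theta>e: "\<theta> e \<in> ring_center R" using \<theta>(1) e_T by blast
  have Bc: "B t (a \<otimes> r) \<in> carrier R" if "t \<in> T" for t using B_closed[OF tG[OF that]] ac rc by simp
  have "(\<Oplus>t\<in>{e}. \<theta> t \<otimes> B t (a \<otimes> r)) = (\<Oplus>t\<in>T. \<theta> t \<otimes> B t (a \<otimes> r))"
    using e_T finite_T \<theta>(3) Bc \<theta>c by (intro add.finprod_mono_neutral_cong_left) auto
  moreover have "(\<Oplus>t\<in>{e}. \<theta> t \<otimes> B t (a \<otimes> r)) = \<theta> e \<otimes> B e (a \<otimes> r)"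
    using center_closed[OF \<theta>e] Bc[OF e_T] by (simp add: finsum_insert)
  moreover have "B e (a \<otimes> r) = a \<otimes> r" using Q_fixed[OF arQ N_e] .
  ultimately have "(\<theta> e \<otimes> a) \<otimes> r \<in> sums_of_products R (invariants H) (ring_center R)"
    using span[OF arQ] center_closed[OF \<theta>e] ac rc by (simp add: m_assoc)
  moreover have "\<theta> e \<otimes> a \<notin> I" using central_prime[OF \<theta>e ac] \<theta>(2) a(2) by blast
  ultimately show ?thesis using center_mult[OF \<theta>e a(1)] by blast
qed

end

section \<open>From the local statement to the global one\<close>

context separable_action
begin

theorem double_centralizer:
  assumes H: "H \<in> wide_subgroupoids G"
  shows "ring_centralizer R (ring_centralizer R (invariants H)) = sums_of_products R (invariants H) (ring_center R)"
proof
  let ?A = "sums_of_products R (invariants H) (ring_center R)"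
  have S: "invariants H \<subseteq> carrier R" using invariants_closed by blast
  have C: "ring_center R \<subseteq> carrier R" using center_closed by blast
  note Ac = sums_of_products_closed[OF S C]
  show "?A \<subseteq> bicentralizer (invariants H)"
  proof
    fix x assume x: "x \<in> ?A"
    have "x \<otimes> w = w \<otimes> x" if "w \<in> ring_centralizer R (invariants H)" for w
    proof -
      have "w \<in> ring_centralizer R ?A" using that centralizer_sums_of_products[OF S] by simp
      then show ?thesis using x unfolding ring_centralizer_def by auto
    qed
    then show "x \<in> bicentralizer (invariants H)"
      using Ac[OF x] unfolding ring_centralizer_def[of R "ring_centralizer R (invariants H)"] by blast
  qed
  show "bicentralizer (invariants H) \<subseteq> ?A"
  proof
    fix r assume r: "r \<in> bicentralizer (invariants H)"
    then have rc: "r \<in> carrier R" by (simp add: ring_centralizer_def)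
    define n where "n = {c \<in> ring_center R. c \<otimes> r \<in> ?A}"
    \<comment> \<open>The ideal \<open>n\<close> of the centre must be enlarged to a two-sided ideal
      of \<open>R\<close> without becoming improper. \<open>J\<close> contains \<open>n\<close>
      since \<open>P\<close> is linear over the centre, and \<open>\<one>\<close> in
      \<open>J\<close> would force \<open>P \<one>\<close>, which is \<open>\<one>\<close>, into
      \<open>n\<close>.\<close>
    define J where "J = {z \<in> carrier R. \<forall>x\<in>carrier R. \<forall>y\<in>carrier R. P (x \<otimes> z \<otimes> y) \<in> n}"
    have n_add: "c \<oplus> d \<in> n" if "c \<in> n" "d \<in> n" for c d
      using that sums_of_products_add[OF S C] center_closed rc
      by (auto simp: n_def l_distr intro: center_add)
    have n_smult: "c \<otimes> d \<in> n" if "c \<in> n" "d \<in> ring_center R" for c d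
    proof -
      have "(c \<otimes> d) \<otimes> r = d \<otimes> (c \<otimes> r)"
        using that center_comm[OF that(2), of c] center_closed rc by (auto simp: n_def m_assoc[symmetric])
      then show ?thesis
        using that sums_of_products_smult[OF S that(2)] by (auto simp: n_def intro: center_mult)
    qed
    have n_J: "n \<subseteq> J"
    proof
      fix c assume c: "c \<in> n"
      then have cC: "c \<in> ring_center R" by (simp add: n_def)
      note cc = center_closed[OF cC]
      have "P (x \<otimes> c \<otimes> y) \<in> n" if x: "x \<in> carrier R" and y: "y \<in> carrier R" for x y
      proof -
        have "x \<otimes> c \<otimes> y = c \<otimes> (x \<otimes> y)" using center_lcomm[OF cC x y] x y cc by (simp add: m_assoc)
        then show ?thesis using P_smult[OF cC, of "x \<otimes> y"] n_smult[OF c P_center] x y by simp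
      qed
      then show "c \<in> J" using cc by (simp add: J_def)
    qed
    have "\<one> \<in> n"
    proof (rule ccontr)
      assume one: "\<one> \<notin> n"
      have zero: "\<zero> \<in> n"
      proof -
        have "\<zero> \<otimes> \<one> \<in> ?A"
        proof (rule sums_of_products_incl)
          show "\<zero> \<in> invariants H"
            using wide_subset[OF H] B_zero \<epsilon>_rng_closed by (auto simp: invariants_def subset_iff)
        qed (auto intro: center_one)
        then show ?thesis using rc center_zero by (simp add: n_def)
      qed
      have J_ideal: "ideal J R"
      proof (rule idealI)
        show "subgroup J (add_monoid R)"
        proof (rule subgroup.intro)
          show "J \<subseteq> carrier (add_monoid R)" by (auto simp: J_def)
          show "\<one>\<^bsub>add_monoid R\<^esub> \<in> J" using zero n_J by auto
          fix z assume z: "z \<in> J"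
          then have zc: "z \<in> carrier R" by (simp add: J_def)
          have "P (x \<otimes> (\<ominus> z) \<otimes> y) \<in> n" if x: "x \<in> carrier R" and y: "y \<in> carrier R" for x y
          proof -
            have "x \<otimes> (\<ominus> z) \<otimes> y = (\<ominus> x) \<otimes> z \<otimes> y" using x y zc by algebra
            then show ?thesis using z x y by (simp add: J_def)
          qed
          then have "\<ominus> z \<in> J" using zc by (simp add: J_def)
          then show "inv\<^bsub>add_monoid R\<^esub> z \<in> J" by (simp add: a_inv_def)
          fix z' assume z': "z' \<in> J"
          then have zc': "z' \<in> carrier R" by (simp add: J_def)
          have "P (x \<otimes> (z \<oplus> z') \<otimes> y) \<in> n" if x: "x \<in> carrier R" and y: "y \<in> carrier R" for x y
          proof -
            have "x \<otimes> (z \<oplus> z') \<otimes> y = x \<otimes> z \<otimes> y \<oplus> x \<otimes> z' \<otimes> y" using x y zc zc' by algebra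
            then have "P (x \<otimes> (z \<oplus> z') \<otimes> y) = P (x \<otimes> z \<otimes> y) \<oplus> P (x \<otimes> z' \<otimes> y)"
              using P_add x y zc zc' by simp
            then show ?thesis using n_add z z' x y by (simp add: J_def)
          qed
          then have "z \<oplus> z' \<in> J" using zc zc' by (simp add: J_def)
          then show "z \<otimes>\<^bsub>add_monoid R\<^esub> z' \<in> J" by simp
        qed
      next
        fix z q assume z: "z \<in> J" and q: "q \<in> carrier R"
        have zc: "z \<in> carrier R" using z by (simp add: J_def)
        have "P (x \<otimes> (q \<otimes> z) \<otimes> y) \<in> n" "P (x \<otimes> (z \<otimes> q) \<otimes> y) \<in> n"
          if x: "x \<in> carrier R" and y: "y \<in> carrier R" for x y
        proof -
          have *: "x \<otimes> (q \<otimes> z) \<otimes> y = (x \<otimes> q) \<otimes> z \<otimes> y" "x \<otimes> (z \<otimes> q) \<otimes> y = x \<otimes> z \<otimes> (q \<otimes> y)"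
            using x y q zc by (simp_all add: m_assoc)
          have "P ((x \<otimes> q) \<otimes> z \<otimes> y) \<in> n" "P (x \<otimes> z \<otimes> (q \<otimes> y)) \<in> n"
            using z x y q unfolding J_def by blast+
          then show "P (x \<otimes> (q \<otimes> z) \<otimes> y) \<in> n" "P (x \<otimes> (z \<otimes> q) \<otimes> y) \<in> n" unfolding * .
        qed
        then show "q \<otimes> z \<in> J" "z \<otimes> q \<in> J" using q zc by (simp_all add: J_def)
      qed (rule ring_axioms)
      have "\<one> \<notin> J"
      proof
        assume "\<one> \<in> J"
        then have "P (\<one> \<otimes> \<one> \<otimes> \<one>) \<in> n" unfolding J_def by blast
        then show False using P_one one by simp
      qed
      then obtain I where I: "maximalideal I R" "J \<subseteq> I" using exists_maximalideal[OF J_ideal] by blast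
      interpret I: central_maximalideal I R using maximalideal_central[OF I(1)] .
      have "\<exists>e\<in>gobjects G. \<epsilon> e \<notin> I"
      proof (rule ccontr)
        assume "\<not> ?thesis"
        then have "(\<Oplus>e\<in>gobjects G. \<epsilon> e) \<in> I" by (intro I.finsum_mem) auto
        then show False using \<epsilon>_sum I.one_notin by simp
      qed
      then obtain e where e: "e \<in> gobjects G" "\<epsilon> e \<notin> I" by blast
      interpret action_at_ideal G R \<epsilon> B K u v I H e
        using H e by unfold_locales
      obtain c where "c \<in> ring_center R" "c \<notin> I" "c \<otimes> r \<in> ?A" using local_double_centralizer[OF r] by blast
      then show False using n_J I(2) by (auto simp: n_def)
    qed
    then show "r \<in> ?A" using rc by (simp add: n_def)
  qed
qed

end

section \<open>Separability over a central subring and unital actions\<close>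

text \<open>The universal property in the form required: \<phi> extends to the free abelian group,
  biadditivity and balancedness put the relators into the kernel, and equal tensors are represented
  by elements differing by a relation. \<open>M\<close> is multiplicative so that the additive group
  of a ring can be inserted.\<close>

lemma tensor_square_eqD:
  fixes A :: "('a, 'm) ring_scheme" and M :: "('c, 'n) monoid_scheme"
  assumes A: "ring A" and S: "S \<subseteq> carrier A" and M: "comm_group M"
    and \<phi>: "\<And>x y. x \<in> carrier A \<Longrightarrow> y \<in> carrier A \<Longrightarrow> \<phi> x y \<in> carrier M"
    and add_left: "\<And>x x' y. x \<in> carrier A \<Longrightarrow> x' \<in> carrier A \<Longrightarrow> y \<in> carrier A \<Longrightarrow>
      \<phi> (x \<oplus>\<^bsub>A\<^esub> x') y = \<phi> x y \<otimes>\<^bsub>M\<^esub> \<phi> x' y"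
    and add_right: "\<And>x y y'. x \<in> carrier A \<Longrightarrow> y \<in> carrier A \<Longrightarrow> y' \<in> carrier A \<Longrightarrow>
      \<phi> x (y \<oplus>\<^bsub>A\<^esub> y') = \<phi> x y \<otimes>\<^bsub>M\<^esub> \<phi> x y'"
    and balanced: "\<And>x s y. x \<in> carrier A \<Longrightarrow> s \<in> S \<Longrightarrow> y \<in> carrier A \<Longrightarrow>
      \<phi> (x \<otimes>\<^bsub>A\<^esub> s) y = \<phi> x (s \<otimes>\<^bsub>A\<^esub> y)"
    and p: "p \<in> J \<rightarrow> carrier A" "p' \<in> J \<rightarrow> carrier A" and q: "q \<in> J \<rightarrow> carrier A" "q' \<in> J \<rightarrow> carrier A"
    and eq: "(\<Otimes>\<^bsub>tensor_square A S\<^esub>i\<in>J. pure_tensor A S (p i) (q i)) =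
      (\<Otimes>\<^bsub>tensor_square A S\<^esub>i\<in>J. pure_tensor A S (p' i) (q' i))"
  shows "(\<Otimes>\<^bsub>M\<^esub>i\<in>J. \<phi> (p i) (q i)) = (\<Otimes>\<^bsub>M\<^esub>i\<in>J. \<phi> (p' i) (q' i))"
proof -
  interpret A: ring A by fact
  interpret M: comm_group M by fact
  define F where "F = free_Abelian_group (carrier A \<times> carrier A)"
  interpret F: comm_group F unfolding F_def by (rule abelian_free_Abelian_group)
  have F_mult: "x \<otimes>\<^bsub>F\<^esub> y = x + y" for x y by (simp add: F_def)
  have F_of: "frag_of (x, y) \<in> carrier F" if "x \<in> carrier A" "y \<in> carrier A" for x y
    using that unfolding F_def by simp
  have F_diff: "x - y \<in> carrier F" if "x \<in> carrier F" "y \<in> carrier F" for x y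
    using that keys_diff[of x y] unfolding F_def by auto
  have im: "(\<lambda>(x, y). \<phi> x y) ` (carrier A \<times> carrier A) \<subseteq> carrier M" using \<phi> by auto
  obtain h where h: "h \<in> hom F M"
    and h_of: "\<And>z. z \<in> carrier A \<times> carrier A \<Longrightarrow> h (frag_of z) = (\<lambda>(x, y). \<phi> x y) z"
    by (rule M.free_Abelian_group_universal[OF im, folded F_def]) (rule that)
  have h_of': "h (frag_of (x, y)) = \<phi> x y" if "x \<in> carrier A" "y \<in> carrier A" for x y
    using h_of[of "(x, y)"] that by simp
  interpret h: group_hom F M h using h by unfold_locales
  have h_add: "h (x + y) = h x \<otimes>\<^bsub>M\<^esub> h y" if "x \<in> carrier F" "y \<in> carrier F" for x y
    using h.hom_mult[OF that] by (simp add: F_mult)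
  have h_diff: "x - y \<in> kernel F M h" if xy: "x \<in> carrier F" "y \<in> carrier F" "h x = h y" for x y
  proof -
    have "h (x - y) \<otimes>\<^bsub>M\<^esub> h y = h x" using h_add[OF F_diff[OF xy(1,2)] xy(2)] by simp
    then have "h (x - y) = \<one>\<^bsub>M\<^esub>"
      using xy F_diff[OF xy(1,2)] h.hom_closed by (metis M.l_cancel_one' M.m_comm)
    then show ?thesis using F_diff[OF xy(1,2)] by (simp add: kernel_def)
  qed
  have F_sum: "x + y \<in> carrier F" if "x \<in> carrier F" "y \<in> carrier F" for x y
    using F.m_closed[OF that] by (simp add: F_mult)
  have rel: "tensor_relators A S \<subseteq> kernel F M h"
    unfolding tensor_relators_def
    by (intro Un_least subsetI; elim CollectE exE conjE; hypsubst; rule h_diff)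
      (simp_all add: F_of F_sum h_add h_of' add_left add_right balanced subsetD[OF S])
  define W where "W = tensor_relations A S"
  have W_ker: "W \<subseteq> kernel F M h"
    unfolding W_def tensor_relations_def F_def[symmetric]
    using rel h.subgroup_kernel by (rule F.generate_subgroup_incl)
  have W: "subgroup W F"
    unfolding W_def tensor_relations_def F_def[symmetric]
    using rel by (intro F.generate_is_subgroup) (auto simp: kernel_def)
  then interpret W: normal W F by (rule F.subgroup_imp_normal)
  have sq: "tensor_square A S = F Mod W" and pt: "pure_tensor A S x y = W #>\<^bsub>F\<^esub> frag_of (x, y)" for x y
    by (simp_all add: tensor_square_def pure_tensor_def F_def W_def)
  interpret FW: comm_group "F Mod W" using W by (rule F.abelian_FactGroup)
  have sum: "(\<Otimes>\<^bsub>F Mod W\<^esub>i\<in>J. W #>\<^bsub>F\<^esub> frag_of (f i, g i)) = W #>\<^bsub>F\<^esub> (\<Otimes>\<^bsub>F\<^esub>i\<in>J. frag_of (f i, g i))"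
    "h (\<Otimes>\<^bsub>F\<^esub>i\<in>J. frag_of (f i, g i)) = (\<Otimes>\<^bsub>M\<^esub>i\<in>J. \<phi> (f i) (g i))"
    "(\<Otimes>\<^bsub>F\<^esub>i\<in>J. frag_of (f i, g i)) \<in> carrier F"
    if f: "f \<in> J \<rightarrow> carrier A" and g: "g \<in> J \<rightarrow> carrier A" for f g
  proof -
    have fg: "(\<lambda>i. frag_of (f i, g i)) \<in> J \<rightarrow> carrier F" using f g F_of by auto
    show "(\<Otimes>\<^bsub>F\<^esub>i\<in>J. frag_of (f i, g i)) \<in> carrier F" using fg by (rule F.finprod_closed)
    have one: "W #>\<^bsub>F\<^esub> \<one>\<^bsub>F\<^esub> = \<one>\<^bsub>F Mod W\<^esub>"
      using W.subset by (simp add: FactGroup_def F.coset_mult_one)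
    show "(\<Otimes>\<^bsub>F Mod W\<^esub>i\<in>J. W #>\<^bsub>F\<^esub> frag_of (f i, g i)) = W #>\<^bsub>F\<^esub> (\<Otimes>\<^bsub>F\<^esub>i\<in>J. frag_of (f i, g i))"
      using F.hom_finprod[OF FW.comm_monoid_axioms W.r_coset_hom_Mod one fg] by simp
    have "h (\<Otimes>\<^bsub>F\<^esub>i\<in>J. frag_of (f i, g i)) = (\<Otimes>\<^bsub>M\<^esub>i\<in>J. h (frag_of (f i, g i)))"
      using M.comm_monoid_axioms h h.hom_one fg by (rule F.hom_finprod)
    also have "\<dots> = (\<Otimes>\<^bsub>M\<^esub>i\<in>J. \<phi> (f i) (g i))"
    proof (rule M.finprod_cong')
      show "h (frag_of (f i, g i)) = \<phi> (f i) (g i)" if "i \<in> J" for i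
        using f g that by (intro h_of') auto
      show "(\<lambda>i. \<phi> (f i) (g i)) \<in> J \<rightarrow> carrier M" using f g \<phi> by blast
    qed simp
    finally show "h (\<Otimes>\<^bsub>F\<^esub>i\<in>J. frag_of (f i, g i)) = (\<Otimes>\<^bsub>M\<^esub>i\<in>J. \<phi> (f i) (g i))" .
  qed
  let ?x = "\<Otimes>\<^bsub>F\<^esub>i\<in>J. frag_of (p i, q i)" and ?y = "\<Otimes>\<^bsub>F\<^esub>i\<in>J. frag_of (p' i, q' i)"
  have "W #>\<^bsub>F\<^esub> ?x = W #>\<^bsub>F\<^esub> ?y"
    using eq sum(1)[OF p(1) q(1)] sum(1)[OF p(2) q(2)] by (simp add: sq pt)
  then have "?x \<in> W #>\<^bsub>F\<^esub> ?y" using F.rcos_self[OF sum(3)[OF p(1) q(1)] W] by simp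
  then obtain w where w: "w \<in> W" "?x = w \<otimes>\<^bsub>F\<^esub> ?y" by (auto simp: r_coset_def)
  have "w \<in> carrier F" "h w = \<one>\<^bsub>M\<^esub>" using w(1) W_ker by (auto simp: kernel_def)
  then have "h ?x = h ?y"
    using w(2) h.hom_mult[of w ?y] sum(3)[OF p(2) q(2)] h.hom_closed by simp
  then show ?thesis using sum(2)[OF p(1) q(1)] sum(2)[OF p(2) q(2)] by simp
qed

lemma (in ring) finsum_subring:
  assumes "subring S R" "f \<in> J \<rightarrow> S"
  shows "finsum (R\<lparr>carrier := S\<rparr>) f J = finsum R f J"
proof -
  interpret S: ring "R\<lparr>carrier := S\<rparr>" using assms(1) by (rule subring_is_ring)
  have "S \<subseteq> carrier R" using assms(1) subringE(1) by blast
  then have "(\<lambda>x. x) \<in> hom (add_monoid (R\<lparr>carrier := S\<rparr>)) (add_monoid R)"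
    by (auto simp: hom_def)
  then show ?thesis
    using comm_monoid.hom_finprod[OF S.a_comm_monoid a_comm_monoid, of "\<lambda>x. x" f J] assms(2)
    by (simp add: finsum_def)
qed

text \<open>Evaluate the identity between tensors by the map taking \<open>x\<close>,
  \<open>y\<close> to \<open>x \<otimes> r \<otimes> y\<close>. It is balanced over \<open>S\<close>
  for every \<open>r\<close> in \<open>R\<close> because \<open>S\<close> is central in
  \<open>R\<close>, not merely in \<open>A\<close>.\<close>

lemma separable_overD:
  fixes R (structure)
  assumes R: "ring R" and A: "subring A R" and S: "S \<subseteq> A" "S \<subseteq> ring_center R"
    and sep: "separable_over (R\<lparr>carrier := A\<rparr>) S"
  shows "\<exists>(n::nat) a b. a \<in> {1..n} \<rightarrow> A \<and> b \<in> {1..n} \<rightarrow> A \<and> (\<Oplus>\<^bsub>R\<^esub>i\<in>{1..n}. a i \<otimes>\<^bsub>R\<^esub> b i) = \<one>\<^bsub>R\<^esub> \<and>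
    (\<forall>s\<in>A. \<forall>r\<in>carrier R. s \<otimes>\<^bsub>R\<^esub> (\<Oplus>\<^bsub>R\<^esub>i\<in>{1..n}. a i \<otimes>\<^bsub>R\<^esub> r \<otimes>\<^bsub>R\<^esub> b i) =
      (\<Oplus>\<^bsub>R\<^esub>i\<in>{1..n}. a i \<otimes>\<^bsub>R\<^esub> r \<otimes>\<^bsub>R\<^esub> b i) \<otimes>\<^bsub>R\<^esub> s)"
proof -
  interpret ring R by fact
  let ?A = "R\<lparr>carrier := A\<rparr>"
  interpret A: ring ?A using A by (rule subring_is_ring)
  have AR: "x \<in> carrier R" if "x \<in> A" for x using that subringE(1)[OF A] by blast
  have Am: "x \<otimes> y \<in> A" if "x \<in> A" "y \<in> A" for x y using that A.m_closed by simp
  have Aa: "x \<oplus> y \<in> A" if "x \<in> A" "y \<in> A" for x y using that A.a_closed by simp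
  obtain n a b where ab: "a \<in> {1..n::nat} \<rightarrow> A" "b \<in> {1..n} \<rightarrow> A"
    and one: "(\<Oplus>\<^bsub>?A\<^esub>i\<in>{1..n}. a i \<otimes> b i) = \<one>"
    and eq: "\<And>s. s \<in> A \<Longrightarrow> (\<Otimes>\<^bsub>tensor_square ?A S\<^esub>i\<in>{1..n}. pure_tensor ?A S (s \<otimes> a i) (b i)) =
      (\<Otimes>\<^bsub>tensor_square ?A S\<^esub>i\<in>{1..n}. pure_tensor ?A S (a i) (b i \<otimes> s))"
    using sep unfolding separable_over_def by auto
  have abA: "a i \<in> A" "b i \<in> A" if "i \<in> {1..n}" for i using ab that by blast+
  have "(\<Oplus>i\<in>{1..n}. a i \<otimes> b i) = \<one>"
    using one finsum_subring[OF A, of "\<lambda>i. a i \<otimes> b i" "{1..n}"] abA Am by simp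
  moreover have "s \<otimes> (\<Oplus>i\<in>{1..n}. a i \<otimes> r \<otimes> b i) = (\<Oplus>i\<in>{1..n}. a i \<otimes> r \<otimes> b i) \<otimes> s"
    if s: "s \<in> A" and r: "r \<in> carrier R" for s r
  proof -
    have "(\<Otimes>\<^bsub>add_monoid R\<^esub>i\<in>{1..n}. (s \<otimes> a i) \<otimes> r \<otimes> b i) = (\<Otimes>\<^bsub>add_monoid R\<^esub>i\<in>{1..n}. a i \<otimes> r \<otimes> (b i \<otimes> s))"
    proof (rule tensor_square_eqD[where \<phi> = "\<lambda>x y. x \<otimes> r \<otimes> y" and A = ?A and S = S])
      show "(x \<otimes>\<^bsub>?A\<^esub> c) \<otimes> r \<otimes> y = x \<otimes> r \<otimes> (c \<otimes>\<^bsub>?A\<^esub> y)"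
        if x: "x \<in> carrier ?A" and c: "c \<in> S" and y: "y \<in> carrier ?A" for x c y
      proof -
        have cC: "c \<in> ring_center R" using c S by blast
        have xy: "x \<in> carrier R" "y \<in> carrier R" using x y AR by simp_all
        show ?thesis
          using center_comm[OF cC r] xy r center_closed[OF cC] by (simp add: m_assoc)
      qed
    qed (use A.ring_axioms S a_comm_group r s abA AR Am Aa eq[OF s] in \<open>auto simp: l_distr r_distr\<close>)
    then have *: "(\<Oplus>i\<in>{1..n}. (s \<otimes> a i) \<otimes> r \<otimes> b i) = (\<Oplus>i\<in>{1..n}. a i \<otimes> r \<otimes> (b i \<otimes> s))"
      by (simp add: finsum_def)
    have "s \<otimes> (\<Oplus>i\<in>{1..n}. a i \<otimes> r \<otimes> b i) = (\<Oplus>i\<in>{1..n}. s \<otimes> (a i \<otimes> r \<otimes> b i))"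
      using s r abA AR by (intro finsum_rdistr) auto
    also have "\<dots> = (\<Oplus>i\<in>{1..n}. (s \<otimes> a i) \<otimes> r \<otimes> b i)"
      using s r abA AR by (intro finsum_ring_cong) (auto simp: m_assoc)
    also have "\<dots> = (\<Oplus>i\<in>{1..n}. (a i \<otimes> r \<otimes> b i) \<otimes> s)"
      unfolding * using s r abA AR by (intro finsum_ring_cong) (auto simp: m_assoc)
    also have "\<dots> = (\<Oplus>i\<in>{1..n}. a i \<otimes> r \<otimes> b i) \<otimes> s"
      using s r abA AR by (intro finsum_ldistr[symmetric]) auto
    finally show ?thesis .
  qed
  ultimately show ?thesis using ab by blast
qed

section \<open>From a unital action to maps on the whole ring\<close>

locale finite_unital_action = unital_groupoid_action +
  assumes finite_G: "finite (carrier G)"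
    and direct_sum: "is_direct_sum R (gobjects G) E"
begin

definition \<epsilon> where
  "\<epsilon> e = identity_of R (E e)"

text \<open>The element \<open>x \<otimes> \<epsilon> (gdom G g)\<close> is \<open>x 1\<^sub>g\<^sup>-\<^sup>1\<close>, since the ideal at \<open>g\<close> depends only on the range of \<open>g\<close>.\<close>

definition B where
  "B g x = \<beta> g (x \<otimes>\<^bsub>R\<^esub> \<epsilon> (gdom G g))"

lemma \<epsilon>_identity:
  assumes "e \<in> gobjects G"
  shows "is_identity_of R (E e) (\<epsilon> e)"
proof -
  obtain w where w: "is_identity_of R (E e) w" using E_unital[OF object_closed[OF assms]] by blast
  have "z = w" if "is_identity_of R (E e) z" for z
    using that w unfolding is_identity_of_def by metis
  with w have "\<exists>!z. is_identity_of R (E e) z" by blast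
  then show ?thesis unfolding \<epsilon>_def identity_of_def by (rule theI')
qed

lemma E_carrier: "e \<in> gobjects G \<Longrightarrow> x \<in> E e \<Longrightarrow> x \<in> carrier R"
  using ideal.Icarr[OF E_ideal[OF object_closed]] .

lemma
  assumes "e \<in> gobjects G"
  shows \<epsilon>_E: "\<epsilon> e \<in> E e" and \<epsilon>_left: "x \<in> E e \<Longrightarrow> \<epsilon> e \<otimes>\<^bsub>R\<^esub> x = x" and \<epsilon>_right: "x \<in> E e \<Longrightarrow> x \<otimes>\<^bsub>R\<^esub> \<epsilon> e = x"
  using \<epsilon>_identity[OF assms] by (auto simp: is_identity_of_def)

lemma
  assumes "e \<in> gobjects G" "x \<in> E e" "r \<in> carrier R"
  shows E_left: "r \<otimes>\<^bsub>R\<^esub> x \<in> E e" and E_right: "x \<otimes>\<^bsub>R\<^esub> r \<in> E e"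
  using ideal.I_l_closed[OF E_ideal[OF object_closed]] ideal.I_r_closed[OF E_ideal[OF object_closed]] assms by auto

lemma E_ginv: "g \<in> carrier G \<Longrightarrow> E (ginv G g) = E (gdom G g)"
  using E_rng[OF ginv_closed, of g] rng_ginv[of g] by simp

lemma \<epsilon>_ginv: "g \<in> carrier G \<Longrightarrow> identity_of R (E (ginv G g)) = \<epsilon> (gdom G g)"
  and \<epsilon>_grng: "g \<in> carrier G \<Longrightarrow> identity_of R (E g) = \<epsilon> (grng G g)"
  using E_ginv[of g] E_rng[of g] by (simp_all add: \<epsilon>_def)

text \<open>A common element \<open>x\<close> has two decompositions, one concentrated at
  \<open>e\<close> and one at \<open>f\<close>. Uniqueness identifies them, and comparing entries at
  \<open>e\<close> gives zero.\<close>

lemma E_disjoint: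
  assumes e: "e \<in> gobjects G" and f: "f \<in> gobjects G" and ne: "e \<noteq> f" and x: "x \<in> E e" "x \<in> E f"
  shows "x = \<zero>\<^bsub>R\<^esub>"
proof -
  have fin: "finite (gobjects G)" using finite_G by (simp add: gobjects_def)
  have xc: "x \<in> carrier R" using e x(1) by (rule E_carrier)
  define d where "d k = (\<lambda>i\<in>gobjects G. if i = k then x else \<zero>\<^bsub>R\<^esub>)" for k
  have z: "\<zero>\<^bsub>R\<^esub> \<in> E i" if "i \<in> gobjects G" for i
    using additive_subgroup.zero_closed[OF ideal.axioms(1)[OF E_ideal[OF object_closed[OF that]]]] .
  have d: "d k \<in> (\<Pi>\<^sub>E i\<in>gobjects G. E i)" "(\<Oplus>\<^bsub>R\<^esub>i\<in>gobjects G. d k i) = x"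
    if k: "k \<in> gobjects G" "x \<in> E k" for k
  proof -
    show "d k \<in> (\<Pi>\<^sub>E i\<in>gobjects G. E i)" using k z by (auto simp: d_def)
    have "(\<Oplus>\<^bsub>R\<^esub>i\<in>gobjects G. d k i) = (\<Oplus>\<^bsub>R\<^esub>i\<in>gobjects G. if i = k then x else \<zero>\<^bsub>R\<^esub>)"
      using xc by (intro finsum_ring_cong) (auto simp: d_def)
    also have "\<dots> = x" using k fin xc by (intro add.finprod_singleton_swap) auto
    finally show "(\<Oplus>\<^bsub>R\<^esub>i\<in>gobjects G. d k i) = x" .
  qed
  have "\<exists>!y. y \<in> (\<Pi>\<^sub>E i\<in>gobjects G. E i) \<and> x = (\<Oplus>\<^bsub>R\<^esub>i\<in>gobjects G. y i)"
    using direct_sum xc unfolding is_direct_sum_def by blast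
  then have "d e = d f" using d[OF e x(1)] d[OF f x(2)] by metis
  then have "d e e = d f e" by simp
  then show ?thesis using e ne by (simp add: d_def)
qed

text \<open>Both products lie in the ideal at \<open>e\<close>, so each equals
  \<open>\<epsilon> e \<otimes> r \<otimes> \<epsilon> e\<close>.\<close>

lemma \<epsilon>_in_center:
  assumes e: "e \<in> gobjects G"
  shows "\<epsilon> e \<in> ring_center R"
proof (rule center_memI)
  note ec = E_carrier[OF e \<epsilon>_E[OF e]]
  show "\<epsilon> e \<in> carrier R" by (rule ec)
  fix r assume r: "r \<in> carrier R"
  have "\<epsilon> e \<otimes>\<^bsub>R\<^esub> r = \<epsilon> e \<otimes>\<^bsub>R\<^esub> r \<otimes>\<^bsub>R\<^esub> \<epsilon> e"
    using \<epsilon>_right[OF e E_right[OF e \<epsilon>_E[OF e] r]] by simp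
  also have "\<dots> = r \<otimes>\<^bsub>R\<^esub> \<epsilon> e"
    using \<epsilon>_left[OF e E_left[OF e \<epsilon>_E[OF e] r]] ec r by (simp add: m_assoc)
  finally show "\<epsilon> e \<otimes>\<^bsub>R\<^esub> r = r \<otimes>\<^bsub>R\<^esub> \<epsilon> e" .
qed

text \<open>Multiplying the decomposition of \<open>\<one>\<close> by \<open>\<epsilon> e\<close>
  kills every component except the one at \<open>e\<close>, which must therefore be
  \<open>\<epsilon> e\<close>.\<close>

lemma \<epsilon>_total: "(\<Oplus>\<^bsub>R\<^esub>e\<in>gobjects G. \<epsilon> e) = \<one>\<^bsub>R\<^esub>"
proof -
  have fin: "finite (gobjects G)" using finite_G by (simp add: gobjects_def)
  obtain y where y: "y \<in> (\<Pi>\<^sub>E i\<in>gobjects G. E i)" "\<one>\<^bsub>R\<^esub> = (\<Oplus>\<^bsub>R\<^esub>i\<in>gobjects G. y i)"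
    using direct_sum one_closed unfolding is_direct_sum_def by blast
  have yE: "y i \<in> E i" if "i \<in> gobjects G" for i using y(1) that by blast
  note yc = E_carrier[OF _ yE]
  have "\<epsilon> e = y e" if e: "e \<in> gobjects G" for e
  proof -
    note ec = E_carrier[OF e \<epsilon>_E[OF e]]
    have "\<epsilon> e = \<epsilon> e \<otimes>\<^bsub>R\<^esub> (\<Oplus>\<^bsub>R\<^esub>i\<in>gobjects G. y i)" using y(2)[symmetric] ec by simp
    also have "\<dots> = (\<Oplus>\<^bsub>R\<^esub>i\<in>gobjects G. \<epsilon> e \<otimes>\<^bsub>R\<^esub> y i)"
      using fin ec yc by (intro finsum_rdistr) auto
    also have "\<dots> = (\<Oplus>\<^bsub>R\<^esub>i\<in>gobjects G. if i = e then y i else \<zero>\<^bsub>R\<^esub>)"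
    proof (rule finsum_ring_cong)
      fix i assume i: "i \<in> gobjects G"
      show "\<epsilon> e \<otimes>\<^bsub>R\<^esub> y i = (if i = e then y i else \<zero>\<^bsub>R\<^esub>)"
        using \<epsilon>_left[OF e] yE[OF i] E_disjoint[OF e i] E_left[OF i yE[OF i] ec] E_right[OF e \<epsilon>_E[OF e] yc[OF i i]]
        by auto
      show "(if i = e then y i else \<zero>\<^bsub>R\<^esub>) \<in> carrier R" using yc[OF i i] by auto
    qed
    also have "\<dots> = y e" using e fin yc by (intro add.finprod_singleton_swap) auto
    finally show ?thesis .
  qed
  then have "(\<Oplus>\<^bsub>R\<^esub>e\<in>gobjects G. \<epsilon> e) = (\<Oplus>\<^bsub>R\<^esub>i\<in>gobjects G. y i)"
    using yc by (intro finsum_ring_cong) auto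
  also have "\<dots> = \<one>\<^bsub>R\<^esub>" using y(2) by (rule sym)
  finally show ?thesis .
qed

lemma
  assumes "g \<in> carrier G"
  shows \<beta>_bij: "bij_betw (\<beta> g) (E (gdom G g)) (E (grng G g))"
    and \<beta>_add: "x \<in> E (gdom G g) \<Longrightarrow> y \<in> E (gdom G g) \<Longrightarrow> \<beta> g (x \<oplus>\<^bsub>R\<^esub> y) = \<beta> g x \<oplus>\<^bsub>R\<^esub> \<beta> g y"
    and \<beta>_mult: "x \<in> E (gdom G g) \<Longrightarrow> y \<in> E (gdom G g) \<Longrightarrow> \<beta> g (x \<otimes>\<^bsub>R\<^esub> y) = \<beta> g x \<otimes>\<^bsub>R\<^esub> \<beta> g y"
  using \<beta>_iso[OF assms] E_ginv[OF assms] E_rng[OF assms] by (auto simp: ideal_algebra_iso_def)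

text \<open>By surjectivity the identity of the target has a preimage \<open>x\<close>; applying the
  multiplicative map to \<open>\<epsilon> (gdom G g) \<otimes> x\<close> shows that the image of the
  identity absorbs into the identity of the target.\<close>

lemma \<beta>_\<epsilon>:
  assumes g: "g \<in> carrier G"
  shows "\<beta> g (\<epsilon> (gdom G g)) = \<epsilon> (grng G g)"
proof -
  note d = dom_in_objects[OF g] and r = rng_in_objects[OF g]
  obtain x where x: "x \<in> E (gdom G g)" "\<beta> g x = \<epsilon> (grng G g)"
    using \<beta>_bij[OF g] \<epsilon>_E[OF r] unfolding bij_betw_def by (metis imageE)
  have in_E: "\<beta> g (\<epsilon> (gdom G g)) \<in> E (grng G g)" using bij_betwE[OF \<beta>_bij[OF g]] \<epsilon>_E[OF d] by blast
  have "\<epsilon> (grng G g) = \<beta> g (\<epsilon> (gdom G g) \<otimes>\<^bsub>R\<^esub> x)" using x \<epsilon>_left[OF d x(1)] by simp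
  also have "\<dots> = \<beta> g (\<epsilon> (gdom G g)) \<otimes>\<^bsub>R\<^esub> \<epsilon> (grng G g)" using \<beta>_mult[OF g \<epsilon>_E[OF d] x(1)] x(2) by simp
  also have "\<dots> = \<beta> g (\<epsilon> (gdom G g))" using \<epsilon>_right[OF r in_E] .
  finally show ?thesis ..
qed

lemma total: "total_action G R \<epsilon> B"
proof
  show "finite (carrier G)" by (rule finite_G)
  show "\<epsilon> e \<in> ring_center R" if "e \<in> gobjects G" for e using that by (rule \<epsilon>_in_center)
  show "\<epsilon> e \<otimes>\<^bsub>R\<^esub> \<epsilon> e = \<epsilon> e" if "e \<in> gobjects G" for e using \<epsilon>_left[OF that \<epsilon>_E[OF that]] .
  show "\<epsilon> e \<otimes>\<^bsub>R\<^esub> \<epsilon> f = \<zero>\<^bsub>R\<^esub>" if e: "e \<in> gobjects G" and f: "f \<in> gobjects G" and ne: "e \<noteq> f" for e f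
    using E_disjoint[OF e f ne] E_left[OF f \<epsilon>_E[OF f] E_carrier[OF e \<epsilon>_E[OF e]]]
      E_right[OF e \<epsilon>_E[OF e] E_carrier[OF f \<epsilon>_E[OF f]]] by simp
  show "(\<Oplus>\<^bsub>R\<^esub>e\<in>gobjects G. \<epsilon> e) = \<one>\<^bsub>R\<^esub>" by (rule \<epsilon>_total)
  fix g assume g: "g \<in> carrier G"
  note d = dom_in_objects[OF g] and r = rng_in_objects[OF g]
  note dc = E_carrier[OF d \<epsilon>_E[OF d]]
  have xE: "x \<otimes>\<^bsub>R\<^esub> \<epsilon> (gdom G g) \<in> E (gdom G g)" if "x \<in> carrier R" for x using E_left[OF d \<epsilon>_E[OF d] that] .
  show "B g \<one>\<^bsub>R\<^esub> = \<epsilon> (grng G g)" using \<beta>_\<epsilon>[OF g] dc by (simp add: B_def)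
  fix x assume x: "x \<in> carrier R"
  have BE: "B h x \<in> E (grng G h)" if h: "h \<in> carrier G" for h
    unfolding B_def using bij_betwE[OF \<beta>_bij[OF h]]
      E_left[OF dom_in_objects[OF h] \<epsilon>_E[OF dom_in_objects[OF h]] x] by blast
  show "B g x \<in> carrier R" using E_carrier[OF r BE[OF g]] .
  show "B g (B h x) = B (gcomp G g h) x" if h: "h \<in> carrier G" and gh: "gdom G g = grng G h" for h
  proof -
    note dh = dom_in_objects[OF h]
    have xh: "x \<otimes>\<^bsub>R\<^esub> \<epsilon> (gdom G h) \<in> E (gdom G h)" using E_left[OF dh \<epsilon>_E[OF dh] x] .
    have "B h x \<in> E (gdom G g)" using BE[OF h] gh by metis
    \<comment> \<open>\<open>B h x\<close> already lies in the source ideal of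
      \<open>\<beta> g\<close>, so the cut-off by the idempotent in \<open>B g\<close> has no
      effect.\<close>
    then have "B g (B h x) = \<beta> g (B h x)" unfolding B_def[of g] by (simp only: \<epsilon>_right[OF d])
    also have "\<dots> = \<beta> (gcomp G g h) (x \<otimes>\<^bsub>R\<^esub> \<epsilon> (gdom G h))"
      unfolding B_def by (rule \<beta>_comp[OF g h gh]) (use xh E_ginv[OF h] in metis)
    also have "\<dots> = B (gcomp G g h) x" unfolding B_def by (simp only: dom_comp[OF g h gh])
    finally show ?thesis .
  qed
  fix y assume y: "y \<in> carrier R"
  show "B g (x \<oplus>\<^bsub>R\<^esub> y) = B g x \<oplus>\<^bsub>R\<^esub> B g y"
    using \<beta>_add[OF g xE[OF x] xE[OF y]] x y dc by (simp add: B_def l_distr)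
  have "x \<otimes>\<^bsub>R\<^esub> y \<otimes>\<^bsub>R\<^esub> \<epsilon> (gdom G g) = (x \<otimes>\<^bsub>R\<^esub> \<epsilon> (gdom G g)) \<otimes>\<^bsub>R\<^esub> (y \<otimes>\<^bsub>R\<^esub> \<epsilon> (gdom G g))"
    using \<epsilon>_left[OF d xE[OF y]] x y dc by (simp add: m_assoc)
  then show "B g (x \<otimes>\<^bsub>R\<^esub> y) = B g x \<otimes>\<^bsub>R\<^esub> B g y"
    using \<beta>_mult[OF g xE[OF x] xE[OF y]] by (simp add: B_def)
next
  fix e x assume e: "e \<in> gobjects G" and x: "x \<in> carrier R"
  show "B e x = x \<otimes>\<^bsub>R\<^esub> \<epsilon> e"
    using \<beta>_object[OF e E_left[OF e \<epsilon>_E[OF e] x]] dom_object[OF e] by (simp add: B_def)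
qed

sublocale total_action G R \<epsilon> B
  by (rule total)

lemma action_invariants_eq:
  assumes "H \<subseteq> carrier G"
  shows "action_invariants G R E \<beta> H = invariants H"
proof -
  have "\<beta> h (r \<otimes>\<^bsub>R\<^esub> identity_of R (E (ginv G h))) = r \<otimes>\<^bsub>R\<^esub> identity_of R (E h) \<longleftrightarrow>
    B h r = r \<otimes>\<^bsub>R\<^esub> \<epsilon> (grng G h)" if "h \<in> H" for h r
    unfolding B_def using that assms \<epsilon>_ginv[of h] \<epsilon>_grng[of h] by auto
  then show ?thesis unfolding action_invariants_def invariants_def by auto
qed

lemma invariants_subring: "subring (invariants H) R" if "H \<subseteq> carrier G"
proof (rule subringI)
  have HG: "h \<in> carrier G" if "h \<in> H" for h using that \<open>H \<subseteq> carrier G\<close> by blast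
  show "invariants H \<subseteq> carrier R" using invariants_closed by blast
  show "\<one>\<^bsub>R\<^esub> \<in> invariants H" using B_one HG \<epsilon>_rng_closed by (simp add: invariants_def)
  fix x assume x: "x \<in> invariants H"
  note xc = invariants_closed[OF x]
  show "\<ominus>\<^bsub>R\<^esub> x \<in> invariants H"
    using x xc HG B_uminus \<epsilon>_rng_closed by (simp add: invariants_def l_minus)
  fix y assume y: "y \<in> invariants H"
  note yc = invariants_closed[OF y]
  show "x \<oplus>\<^bsub>R\<^esub> y \<in> invariants H"
    using x y xc yc HG B_add \<epsilon>_rng_closed by (simp add: invariants_def l_distr)
  have "B h (x \<otimes>\<^bsub>R\<^esub> y) = x \<otimes>\<^bsub>R\<^esub> y \<otimes>\<^bsub>R\<^esub> \<epsilon> (grng G h)" if h: "h \<in> H" for h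
  proof -
    have "B h (x \<otimes>\<^bsub>R\<^esub> y) = x \<otimes>\<^bsub>R\<^esub> (\<epsilon> (grng G h) \<otimes>\<^bsub>R\<^esub> B h y)"
      using B_mult[OF HG[OF h] xc yc] invariantsD[OF x h] xc B_closed[OF HG[OF h] yc] \<epsilon>_rng_closed[OF HG[OF h]]
      by (simp add: m_assoc)
    also have "\<dots> = x \<otimes>\<^bsub>R\<^esub> y \<otimes>\<^bsub>R\<^esub> \<epsilon> (grng G h)"
      using B_rng'[OF HG[OF h] yc] invariantsD[OF y h] xc yc \<epsilon>_rng_closed[OF HG[OF h]] by (simp add: m_assoc)
    finally show ?thesis .
  qed
  then show "x \<otimes>\<^bsub>R\<^esub> y \<in> invariants H" using xc yc by (simp add: invariants_def)
qed

lemma galois_separable: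
  assumes gal: "galois_extension G R E \<beta>"
    and sep: "separable_over (R\<lparr>carrier := action_invariants G R E \<beta> (carrier G)\<rparr>)
      (ring_center R \<inter> action_invariants G R E \<beta> (carrier G))"
  shows "\<exists>m n x y a b. galois_separable_action G R \<epsilon> B m n x y a b"
proof -
  have A: "action_invariants G R E \<beta> (carrier G) = invariants (carrier G)"
    by (simp add: action_invariants_eq)
  obtain m x y where xy: "x \<in> {1..m::nat} \<rightarrow> carrier R" "y \<in> {1..m} \<rightarrow> carrier R"
    and g: "\<And>g. g \<in> carrier G \<Longrightarrow>
      (\<Oplus>\<^bsub>R\<^esub>i\<in>{1..m}. x i \<otimes>\<^bsub>R\<^esub> \<beta> g (y i \<otimes>\<^bsub>R\<^esub> identity_of R (E (ginv G g)))) =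
      (\<Oplus>\<^bsub>R\<^esub>e\<in>gobjects G. if e = g then identity_of R (E e) else \<zero>\<^bsub>R\<^esub>)"
    using gal unfolding galois_extension_def by blast
  obtain n a b where ab: "a \<in> {1..n::nat} \<rightarrow> invariants (carrier G)" "b \<in> {1..n} \<rightarrow> invariants (carrier G)"
    "(\<Oplus>\<^bsub>R\<^esub>i\<in>{1..n}. a i \<otimes>\<^bsub>R\<^esub> b i) = \<one>\<^bsub>R\<^esub>"
    "\<forall>s\<in>invariants (carrier G). \<forall>r\<in>carrier R. s \<otimes>\<^bsub>R\<^esub> (\<Oplus>\<^bsub>R\<^esub>i\<in>{1..n}. a i \<otimes>\<^bsub>R\<^esub> r \<otimes>\<^bsub>R\<^esub> b i) =
      (\<Oplus>\<^bsub>R\<^esub>i\<in>{1..n}. a i \<otimes>\<^bsub>R\<^esub> r \<otimes>\<^bsub>R\<^esub> b i) \<otimes>\<^bsub>R\<^esub> s"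
    using separable_overD[OF ring_axioms invariants_subring[OF order_refl] _ _ sep[unfolded A]] by blast
  have "(\<Oplus>\<^bsub>R\<^esub>i\<in>{1..m}. x i \<otimes>\<^bsub>R\<^esub> B g (y i)) = (if g \<in> gobjects G then \<epsilon> g else \<zero>\<^bsub>R\<^esub>)"
    if gG: "g \<in> carrier G" for g
  proof -
    have "(\<Oplus>\<^bsub>R\<^esub>i\<in>{1..m}. x i \<otimes>\<^bsub>R\<^esub> B g (y i)) = (\<Oplus>\<^bsub>R\<^esub>e\<in>gobjects G. if e = g then \<epsilon> e else \<zero>\<^bsub>R\<^esub>)"
      using g[OF gG] unfolding \<epsilon>_ginv[OF gG] B_def \<epsilon>_def by simp
    also have "\<dots> = (if g \<in> gobjects G then \<epsilon> g else \<zero>\<^bsub>R\<^esub>)"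
    proof (cases "g \<in> gobjects G")
      case True
      then show ?thesis using finite_objects \<epsilon>_closed by (simp add: add.finprod_singleton_swap)
    next
      case False
      then have "(\<Oplus>\<^bsub>R\<^esub>e\<in>gobjects G. if e = g then \<epsilon> e else \<zero>\<^bsub>R\<^esub>) = (\<Oplus>\<^bsub>R\<^esub>e\<in>gobjects G. \<zero>\<^bsub>R\<^esub>)"
        by (intro finsum_ring_cong) auto
      then show ?thesis using False by simp
    qed
    finally show ?thesis .
  qed
  then have "galois_separable_action G R \<epsilon> B m n x y a b"
    using xy ab by unfold_locales auto
  then show ?thesis by blast
qed

lemma double_centralizer_invariants:
  assumes "galois_extension G R E \<beta>"
    and "separable_over (R\<lparr>carrier := action_invariants G R E \<beta> (carrier G)\<rparr>)
      (ring_center R \<inter> action_invariants G R E \<beta> (carrier G))"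
    and "H \<in> wide_subgroupoids G"
  shows "ring_centralizer R (ring_centralizer R (action_invariants G R E \<beta> H)) =
    sums_of_products R (action_invariants G R E \<beta> H) (ring_center R)"
proof -
  obtain m n x y a b where "galois_separable_action G R \<epsilon> B m n x y a b"
    using galois_separable[OF assms(1,2)] by blast
  then interpret g: galois_separable_action G R \<epsilon> B m n x y a b .
  show ?thesis
    using separable_action.double_centralizer[OF g.separable_action assms(3)]
      action_invariants_eq[OF wide_subset[OF assms(3)]] by simp
qed

end

theorem lemma4p1:
  fixes G :: "('g, 'x) groupoid_scheme"
    and K :: "('k, 'y) ring_scheme"
    and R :: "('k, 'a, 'z) module_scheme"
    and E :: "'g \<Rightarrow> 'a set"
    and \<beta> :: "'g \<Rightarrow> 'a \<Rightarrow> 'a"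
  assumes "finite (carrier G)"
    and "unital_groupoid_action G K R E \<beta>"
    and "is_direct_sum R (gobjects G) E"
    and "galois_extension G R E \<beta>"
    and "separable_over (R\<lparr>carrier := action_invariants G R E \<beta> (carrier G)\<rparr>)
           (ring_center R \<inter> action_invariants G R E \<beta> (carrier G))"
  shows "inj_on (\<lambda>H. sums_of_products R (action_invariants G R E \<beta> H) (ring_center R)) (wide_subgroupoids G) \<longleftrightarrow>
         inj_on (\<lambda>H. ring_centralizer R (action_invariants G R E \<beta> H)) (wide_subgroupoids G)"
proof -
  interpret unital_groupoid_action G K R E \<beta> by fact
  interpret finite_unital_action G K R E \<beta> using assms(1,3) by unfold_locales
  let ?S = "\<lambda>H. sums_of_products R (action_invariants G R E \<beta> H) (ring_center R)"
  let ?V = "\<lambda>H. ring_centralizer R (action_invariants G R E \<beta> H)"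
  \<comment> \<open>On wide subgroupoids each of the two values is the centralizer of the other, so
    two subgroupoids agree under one map exactly when they agree under the other.\<close>
  have S: "?S H = ring_centralizer R (?V H)" if "H \<in> wide_subgroupoids G" for H
    using double_centralizer_invariants[OF assms(4,5) that] by simp
  have V: "?V H = ring_centralizer R (?S H)" for H
    by (rule centralizer_sums_of_products[symmetric]) (auto simp: action_invariants_def)
  show ?thesis
    unfolding inj_on_def using S V by metis
qed

end
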